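(* Let $\omega$ be a non-quasianalytic weight function such that $\log(1+t)=o(\omega(t))$ as $t\to\infty$. Then the spaces of convolutors satisfy $$C(\mathcal{O}_{M,\omega}(\mathbb{R}^N))=C(\mathcal{O}'_{M,\omega}(\mathbb{R}^N))=\mathcal{O}'_{M,\omega}(\mathbb{R}^N),\qquad C(\mathcal{O}_{C,\omega}(\mathbb{R}^N))=C(\mathcal{O}'_{C,\omega}(\mathbb{R}^N))=\mathcal{O}'_{C,\omega}(\mathbb{R}^N).$$
   Context: Weights. A non-quasianalytic weight function is a continuous increasing function $\omega:[0,\infty)\to[0,\infty)$ such that: ($\alpha$) there is $K\ge 1$ with $\omega(2t)\le K(1+\omega(t))$ for all $t\ge 0$; ($\beta$) $\int_1^\infty \frac{\omega(t)}{1+t^2}\,dt<\infty$; ($\gamma$) there are $a\in\mathbb{R}$, $b>0$ with $\omega(t)\ge a+b\log(1+t)$ for all $t\ge 0$; ($\delta$) $\varphi_\omega(t)=\omega(e^t)$ is convex. It is assumed (normalization) that $\omega$ vanishes on $[0,1]$. For $x\in\mathbb{R}^N$, $\omega(x):=\omega(|x|)$. The Young conjugate is $\varphi^*_\omega(s):=\sup_{t\ge 0}\{st-\varphi_\omega(t)\}$, $s\ge 0$ (the value $+\infty$ is allowed, with $\exp(-\infty)=0$). Spaces. $\mathcal{E}_\omega(\mathbb{R}^N)$ is the space of $\omega$-ultradifferentiable functions: all $f\in C^\infty(\mathbb{R}^N)$ with $p_{K,m}(f):=\sup_{x\in K}\sup_{\alpha\in\mathbb{N}_0^N}|\partial^\alpha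 f(x)|\exp\left(-m\varphi^*_\omega\left(\frac{|\alpha|}{m}\right)\right)<\infty$ for all compact $K\subset\mathbb{R}^N$ and $m\in\mathbb{N}$, topologized by the seminorms $p_{K,m}$. $\mathcal{D}_\omega(\mathbb{R}^N)$ is the space of compactly supported elements of $\mathcal{E}_\omega(\mathbb{R}^N)$ with its usual inductive limit topology over compact sets; elements of its dual $\mathcal{D}'_\omega(\mathbb{R}^N)$ are the $\omega$-ultradistributions. For $m,n\in\mathbb{N}$ let $\mathcal{O}^m_{n,\omega}(\mathbb{R}^N)$ be the space of all $f\in C^\infty(\mathbb{R}^N)$ with $r_{m,n}(f):=\sup_{\alpha\in\mathbb{N}_0^N}\sup_{x\in\mathbb{R}^N}|\partial^\alpha f(x)|\exp\left(-n\omega(x)-m\varphi^*_\omega\left(\frac{|\alpha|}{m}\right)\right)<\infty$, with norm $r_{m,n}$. Set $\mathcal{O}_{M,\omega}(\mathbb{R}^N):=\bigcap_{m}\bigcup_{n}\mathcal{O}^m_{n,\omega}(\mathbb{R}^N)$ with the topology of the projective limit over $m$ of the locally convex inductive limits $\mathrm{ind}_{n}\,\mathcal{O}^m_{n,\omega}(\mathbb{R}^N)$, and $\mathcal{O}_{C,\omega}(\mathbb{R}^N):=\bigcup_{n}\bigcap_{m}\mathcal{O}^m_{n,\omega}(\mathbb{R}^N)$ with the topology of the locally convex inductive limit over $n$ of the projective limits $\mathrm{proj}_m\,\mathcal{O}^m_{n,\omega}(\mathbb{R}^N)$. A prime denotes the strong dual. The inclusions $\mathcal{D}_\omega\hookrightarrow\mathcal{O}_{C,\omega}\hookrightarrow\mathcal{O}_{M,\omega}\hookrightarrow\mathcal{E}_\omega$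 (on $\mathbb{R}^N$) are continuous with dense range, so by restriction $\mathcal{O}'_{M,\omega}\subset\mathcal{O}'_{C,\omega}\subset\mathcal{D}'_\omega$. Convolution and convolutors. For an $\omega$-ultradistribution $T$ (extended continuously, when possible, from $\mathcal{D}_\omega(\mathbb{R}^N)$ to the function space $E$ considered) and a function $f\in E$, $(T\star f)(x):=\langle T_y,f(x-y)\rangle$. Put $\check f(x):=f(-x)$, $\check T(f):=T(\check f)$. For a locally convex Hausdorff space $E$ of $\omega$-ultradifferentiable functions on $\mathbb{R}^N$, $C(E)$ is the largest space of $\omega$-ultradistributions on $\mathbb{R}^N$ such that (1) for all $f\in E$, $T\in C(E)$, $T\star f$ is well-defined and belongs to $E$; (2) for all $T\in C(E)$ the operator $E\to E$, $f\mapsto T\star f$, is continuous. $C(E')$ is the largest space of $\omega$-ultradistributions on $\mathbb{R}^N$ such that (1) for all $S\in E'$ and $T\in C(E')$, $T\star S$ is well-defined on $E$ and belongs to $E'$, where $\langle T\star S,f\rangle:=\langle S,\check T\star f\rangle$ for $f\in E$; (2) for all $T\in C(E')$ the operator $E'\to E'$, $S\mapsto T\star S$, is continuous. *)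

theory Defs
  imports
    "HOL-Analysis.Analysis"
    "HOL-Library.Function_Algebras"
    "HOL-Library.Landau_Symbols"
begin

section \<open>Locally convex spaces of complex-valued functions\<close>

text \<open>A locally convex space is a \<^typ>\<open>('b \<Rightarrow> complex) topology\<close> whose \<^term>\<open>topspace\<close> is a linear
  subspace of \<^typ>\<open>'b \<Rightarrow> complex\<close>. Function spaces take \<^typ>\<open>'b\<close> to be \<open>real ^ 'n\<close>; duals take it
  to be the function type itself, functionals being set to \<open>0\<close> outside the space on which they
  live, so that they can be compared and form a linear space.\<close>

definition cscale :: "complex \<Rightarrow> ('b \<Rightarrow> complex) \<Rightarrow> ('b \<Rightarrow> complex)" where
  "cscale c f = (\<lambda>x. c * f x)"

global_interpretation cfun: vector_space cscale
  by unfold_locales (auto simp: cscale_def fun_eq_iff algebra_simps)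

definition seminorm_on :: "('b \<Rightarrow> complex) set \<Rightarrow> (('b \<Rightarrow> complex) \<Rightarrow> real) \<Rightarrow> bool" where
  "seminorm_on V p \<longleftrightarrow>
     (\<forall>f\<in>V. 0 \<le> p f) \<and>
     (\<forall>f\<in>V. \<forall>g\<in>V. p (f + g) \<le> p f + p g) \<and>
     (\<forall>c. \<forall>f\<in>V. p (cscale c f) = cmod c * p f)"

definition seminorm_topology ::
    "('b \<Rightarrow> complex) set \<Rightarrow> (('b \<Rightarrow> complex) \<Rightarrow> real) set \<Rightarrow> ('b \<Rightarrow> complex) topology" where
  "seminorm_topology V P = topology (\<lambda>U. U \<subseteq> V \<and>
     (\<forall>f\<in>U. \<exists>F \<epsilon>. finite F \<and> F \<subseteq> P \<and> 0 < \<epsilon> \<and> {g \<in> V. \<forall>p\<in>F. p (g - f) < \<epsilon>} \<subseteq> U))"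

lemma openin_seminorm_topology:
  "openin (seminorm_topology V P) U \<longleftrightarrow> U \<subseteq> V \<and>
     (\<forall>f\<in>U. \<exists>F \<epsilon>. finite F \<and> F \<subseteq> P \<and> 0 < \<epsilon> \<and> {g \<in> V. \<forall>p\<in>F. p (g - f) < \<epsilon>} \<subseteq> U)"
proof -
  define nb where "nb = (\<lambda>U f. \<exists>F \<epsilon>. finite F \<and> F \<subseteq> P \<and> (0::real) < \<epsilon> \<and>
    {g \<in> V. \<forall>p\<in>F. p (g - f) < \<epsilon>} \<subseteq> U)"
  have int: "nb (S \<inter> T) f" if S: "nb S f" and T: "nb T f" for S T f
  proof -
    obtain F d where F: "finite F" "F \<subseteq> P" "0 < d" "{g \<in> V. \<forall>p\<in>F. p (g - f) < d} \<subseteq> S"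
      using S unfolding nb_def by blast
    obtain G e where G: "finite G" "G \<subseteq> P" "0 < e" "{g \<in> V. \<forall>p\<in>G. p (g - f) < e} \<subseteq> T"
      using T unfolding nb_def by blast
    have "{g \<in> V. \<forall>p\<in>F \<union> G. p (g - f) < min d e} \<subseteq> S \<inter> T"
      using F(4) G(4) by auto
    moreover have "finite (F \<union> G)" "F \<union> G \<subseteq> P" "0 < min d e"
      using F G by auto
    ultimately show ?thesis unfolding nb_def by blast
  qed
  have mono: "nb T f" if S: "nb S f" and ST: "S \<subseteq> T" for S T f
  proof -
    obtain F e where "finite F" "F \<subseteq> P" "0 < e" "{g \<in> V. \<forall>p\<in>F. p (g - f) < e} \<subseteq> S"
      using S unfolding nb_def by blast
    then show ?thesis using ST unfolding nb_def by blast
  qed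
  have "istopology (\<lambda>U. U \<subseteq> V \<and> (\<forall>f\<in>U. nb U f))"
    unfolding istopology_def
  proof (intro conjI allI impI)
    fix S T assume ST: "S \<subseteq> V \<and> (\<forall>f\<in>S. nb S f)" "T \<subseteq> V \<and> (\<forall>f\<in>T. nb T f)"
    show "S \<inter> T \<subseteq> V" using ST by blast
    show "\<forall>f\<in>S \<inter> T. nb (S \<inter> T) f" using ST int by blast
  next
    fix \<K> assume K: "\<forall>S\<in>\<K>. S \<subseteq> V \<and> (\<forall>f\<in>S. nb S f)"
    show "\<Union>\<K> \<subseteq> V" using K by blast
    show "\<forall>f\<in>\<Union>\<K>. nb (\<Union>\<K>) f" using K mono by (meson Union_iff Union_upper)
  qed
  from topology_inverse'[OF this] show ?thesis
    unfolding seminorm_topology_def nb_def by simp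
qed

lemma topspace_seminorm_topology [simp]: "topspace (seminorm_topology V P) = V"
proof -
  have "\<exists>F \<epsilon>. finite F \<and> F \<subseteq> P \<and> (0::real) < \<epsilon> \<and> {g \<in> V. \<forall>p\<in>F. p (g - f) < \<epsilon>} \<subseteq> V" for f
    by (rule exI[of _ "{}"], rule exI[of _ 1]) simp
  then have "openin (seminorm_topology V P) V"
    unfolding openin_seminorm_topology by blast
  moreover have "topspace (seminorm_topology V P) \<subseteq> V"
    using openin_topspace[of "seminorm_topology V P"] unfolding openin_seminorm_topology by (rule conjunct1)
  ultimately show ?thesis
    using openin_subset by blast
qed

definition proj_limit :: "'i set \<Rightarrow> ('i \<Rightarrow> 'a topology) \<Rightarrow> 'a topology" where
  "proj_limit I X =
     topology_generated_by {(\<Inter>j\<in>I. topspace (X j)) \<inter> U | i U. i \<in> I \<and> openin (X i) U}"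

text \<open>The finest locally convex topology on the union making all inclusions continuous: its
  continuous seminorms are exactly those whose restrictions to all steps are continuous.\<close>

definition ind_limit :: "'i set \<Rightarrow> ('i \<Rightarrow> ('b \<Rightarrow> complex) topology) \<Rightarrow> ('b \<Rightarrow> complex) topology" where
  "ind_limit I X =
     seminorm_topology (\<Union>i\<in>I. topspace (X i))
       {p. seminorm_on (\<Union>i\<in>I. topspace (X i)) p \<and>
           (\<forall>i\<in>I. continuous_map (X i) euclideanreal p)}"

definition dual :: "('b \<Rightarrow> complex) topology \<Rightarrow> (('b \<Rightarrow> complex) \<Rightarrow> complex) set" where
  "dual E = {T.
     (\<forall>f. f \<notin> topspace E \<longrightarrow> T f = 0) \<and>
     (\<forall>f\<in>topspace E. \<forall>g\<in>topspace E. T (f + g) = T f + T g) \<and>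
     (\<forall>c. \<forall>f\<in>topspace E. T (cscale c f) = c * T f) \<and>
     continuous_map E euclidean T}"

definition bounded_in :: "('b \<Rightarrow> complex) topology \<Rightarrow> ('b \<Rightarrow> complex) set \<Rightarrow> bool" where
  "bounded_in E B \<longleftrightarrow> B \<subseteq> topspace E \<and>
     (\<forall>U. openin E U \<and> 0 \<in> U \<longrightarrow> (\<exists>r>0. \<forall>c. r \<le> cmod c \<longrightarrow> B \<subseteq> cscale c ` U))"

definition strong_dual ::
    "('b \<Rightarrow> complex) topology \<Rightarrow> (('b \<Rightarrow> complex) \<Rightarrow> complex) topology" where
  "strong_dual E =
     seminorm_topology (dual E)
       {\<lambda>S. enn2real (SUP f\<in>B. ennreal (cmod (S f))) | B. bounded_in E B}"


section \<open>Weight functions\<close>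

definition weight_function :: "(real \<Rightarrow> real) \<Rightarrow> bool" where
  "weight_function \<omega> \<longleftrightarrow>
     continuous_on {0..} \<omega> \<and> mono_on {0..} \<omega> \<and> (\<forall>t\<ge>0. 0 \<le> \<omega> t) \<and>
     (\<exists>K\<ge>1. \<forall>t\<ge>0. \<omega> (2 * t) \<le> K * (1 + \<omega> t)) \<and>
     set_integrable lborel {1..} (\<lambda>t. \<omega> t / (1 + t\<^sup>2)) \<and>
     (\<exists>a b. b > 0 \<and> (\<forall>t\<ge>0. \<omega> t \<ge> a + b * ln (1 + t))) \<and>
     convex_on UNIV (\<lambda>t. \<omega> (exp t)) \<and>
     (\<forall>t\<in>{0..1}. \<omega> t = 0)"

definition young_conj :: "(real \<Rightarrow> real) \<Rightarrow> real \<Rightarrow> ereal" where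
  "young_conj \<omega> s = (SUP t\<in>{0..}. ereal (s * t - \<omega> (exp t)))"

text \<open>\<open>exp (- x)\<close> for \<open>x > -\<infinity>\<close>, with \<open>exp (-\<infinity>) = 0\<close>.\<close>

definition exp_neg :: "ereal \<Rightarrow> real" where
  "exp_neg x = (if x = \<infinity> then 0 else exp (- real_of_ereal x))"


section \<open>Smooth functions and partial derivatives\<close>

definition partial :: "'n \<Rightarrow> (real ^ 'n \<Rightarrow> complex) \<Rightarrow> (real ^ 'n \<Rightarrow> complex)" where
  "partial i f = (\<lambda>x. vector_derivative (\<lambda>t. f (x + t *\<^sub>R axis i 1)) (at 0))"

definition partials :: "'n list \<Rightarrow> (real ^ 'n \<Rightarrow> complex) \<Rightarrow> (real ^ 'n \<Rightarrow> complex)" where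
  "partials is f = foldr partial is f"

definition smooth :: "(real ^ 'n \<Rightarrow> complex) \<Rightarrow> bool" where
  "smooth f \<longleftrightarrow>
     (\<forall>is. continuous_on UNIV (partials is f) \<and>
       (\<forall>i x. (\<lambda>t. partials is f (x + t *\<^sub>R axis i 1)) differentiable (at 0)))"

text \<open>The multi-index derivative. For smooth functions the order of differentiation is irrelevant,
  so any list containing each index \<open>i\<close> exactly \<open>\<alpha> i\<close> times may be used.\<close>

definition mderiv :: "('n \<Rightarrow> nat) \<Rightarrow> (real ^ 'n \<Rightarrow> complex) \<Rightarrow> (real ^ 'n \<Rightarrow> complex)" where
  "mderiv \<alpha> f = partials (SOME is. \<forall>i. count_list is i = \<alpha> i) f"

definition mi_order :: "('n::finite \<Rightarrow> nat) \<Rightarrow> nat" where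
  "mi_order \<alpha> = (\<Sum>i\<in>UNIV. \<alpha> i)"


section \<open>Spaces of ultradifferentiable functions and their duals\<close>

text \<open>The quantities \<open>p\<close> and \<open>r\<close> are computed in \<^typ>\<open>ennreal\<close>, so that the supremum always makes
  sense and finiteness is the membership condition.\<close>

definition p_norm ::
    "(real \<Rightarrow> real) \<Rightarrow> (real ^ 'n) set \<Rightarrow> nat \<Rightarrow> (real ^ 'n \<Rightarrow> complex) \<Rightarrow> ennreal" where
  "p_norm \<omega> K m f =
     (SUP x\<in>K. SUP \<alpha>. ennreal (cmod (mderiv \<alpha> f x) *
        exp_neg (ereal (real m) * young_conj \<omega> (real (mi_order \<alpha>) / real m))))"

definition E_space :: "(real \<Rightarrow> real) \<Rightarrow> (real ^ 'n \<Rightarrow> complex) topology" where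
  "E_space \<omega> =
     seminorm_topology
       {f. smooth f \<and> (\<forall>K m. compact K \<and> 1 \<le> m \<longrightarrow> p_norm \<omega> K m f < \<infinity>)}
       {\<lambda>f. enn2real (p_norm \<omega> K m f) | K m. compact K \<and> 1 \<le> m}"

definition D_space :: "(real \<Rightarrow> real) \<Rightarrow> (real ^ 'n \<Rightarrow> complex) topology" where
  "D_space \<omega> =
     ind_limit {K. compact K} (\<lambda>K. subtopology (E_space \<omega>) {f. closure {x. f x \<noteq> 0} \<subseteq> K})"

definition r_norm ::
    "(real \<Rightarrow> real) \<Rightarrow> nat \<Rightarrow> nat \<Rightarrow> (real ^ 'n \<Rightarrow> complex) \<Rightarrow> ennreal" where
  "r_norm \<omega> m n f =
     (SUP \<alpha>. SUP x. ennreal (cmod (mderiv \<alpha> f x) *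
        exp_neg (ereal (real n * \<omega> (norm x)) +
                 ereal (real m) * young_conj \<omega> (real (mi_order \<alpha>) / real m))))"

definition O_step :: "(real \<Rightarrow> real) \<Rightarrow> nat \<Rightarrow> nat \<Rightarrow> (real ^ 'n \<Rightarrow> complex) topology" where
  "O_step \<omega> m n =
     seminorm_topology {f. smooth f \<and> r_norm \<omega> m n f < \<infinity>} {\<lambda>f. enn2real (r_norm \<omega> m n f)}"

definition OM_space :: "(real \<Rightarrow> real) \<Rightarrow> (real ^ 'n \<Rightarrow> complex) topology" where
  "OM_space \<omega> = proj_limit {1..} (\<lambda>m. ind_limit {1..} (\<lambda>n. O_step \<omega> m n))"

definition OC_space :: "(real \<Rightarrow> real) \<Rightarrow> (real ^ 'n \<Rightarrow> complex) topology" where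
  "OC_space \<omega> = ind_limit {1..} (\<lambda>n. proj_limit {1..} (\<lambda>m. O_step \<omega> m n))"

abbreviation ultradistributions ::
    "(real \<Rightarrow> real) \<Rightarrow> ((real ^ 'n \<Rightarrow> complex) \<Rightarrow> complex) set" where
  "ultradistributions \<omega> \<equiv> dual (D_space \<omega>)"

definition to_ultradistribution ::
    "(real \<Rightarrow> real) \<Rightarrow> ((real ^ 'n \<Rightarrow> complex) \<Rightarrow> complex) \<Rightarrow> ((real ^ 'n \<Rightarrow> complex) \<Rightarrow> complex)" where
  "to_ultradistribution \<omega> S = (\<lambda>\<phi>. if \<phi> \<in> topspace (D_space \<omega>) then S \<phi> else 0)"

text \<open>The dual of \<open>E\<close> regarded, by restriction, as a space of ultradistributions.\<close>

definition dual_ultradistributions ::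
    "(real \<Rightarrow> real) \<Rightarrow> (real ^ 'n \<Rightarrow> complex) topology \<Rightarrow> ((real ^ 'n \<Rightarrow> complex) \<Rightarrow> complex) set" where
  "dual_ultradistributions \<omega> E = to_ultradistribution \<omega> ` dual E"


section \<open>Convolution and convolutors\<close>

definition is_extension ::
    "(real \<Rightarrow> real) \<Rightarrow> (real ^ 'n \<Rightarrow> complex) topology \<Rightarrow> ((real ^ 'n \<Rightarrow> complex) \<Rightarrow> complex) \<Rightarrow>
     ((real ^ 'n \<Rightarrow> complex) \<Rightarrow> complex) \<Rightarrow> bool" where
  "is_extension \<omega> E T S \<longleftrightarrow> S \<in> dual E \<and> (\<forall>\<phi>\<in>topspace (D_space \<omega>). S \<phi> = T \<phi>)"

text \<open>The continuous extension of \<open>T\<close> to \<open>E\<close>; it is unique for the spaces considered, in which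
  \<open>D_space \<omega>\<close> is dense.\<close>

definition extension ::
    "(real \<Rightarrow> real) \<Rightarrow> (real ^ 'n \<Rightarrow> complex) topology \<Rightarrow> ((real ^ 'n \<Rightarrow> complex) \<Rightarrow> complex) \<Rightarrow>
     ((real ^ 'n \<Rightarrow> complex) \<Rightarrow> complex)" where
  "extension \<omega> E T = (SOME S. is_extension \<omega> E T S)"

definition conv_defined ::
    "(real \<Rightarrow> real) \<Rightarrow> (real ^ 'n \<Rightarrow> complex) topology \<Rightarrow> ((real ^ 'n \<Rightarrow> complex) \<Rightarrow> complex) \<Rightarrow>
     (real ^ 'n \<Rightarrow> complex) \<Rightarrow> bool" where
  "conv_defined \<omega> E T f \<longleftrightarrow>
     (\<exists>S. is_extension \<omega> E T S) \<and> (\<forall>x. (\<lambda>y. f (x - y)) \<in> topspace E)"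

definition conv ::
    "(real \<Rightarrow> real) \<Rightarrow> (real ^ 'n \<Rightarrow> complex) topology \<Rightarrow> ((real ^ 'n \<Rightarrow> complex) \<Rightarrow> complex) \<Rightarrow>
     (real ^ 'n \<Rightarrow> complex) \<Rightarrow> (real ^ 'n \<Rightarrow> complex)" where
  "conv \<omega> E T f = (\<lambda>x. extension \<omega> E T (\<lambda>y. f (x - y)))"

definition reflect :: "((real ^ 'n \<Rightarrow> complex) \<Rightarrow> complex) \<Rightarrow> ((real ^ 'n \<Rightarrow> complex) \<Rightarrow> complex)" where
  "reflect T = (\<lambda>f. T (\<lambda>x. f (- x)))"

definition conv_dual ::
    "(real \<Rightarrow> real) \<Rightarrow> (real ^ 'n \<Rightarrow> complex) topology \<Rightarrow> ((real ^ 'n \<Rightarrow> complex) \<Rightarrow> complex) \<Rightarrow>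
     ((real ^ 'n \<Rightarrow> complex) \<Rightarrow> complex) \<Rightarrow> ((real ^ 'n \<Rightarrow> complex) \<Rightarrow> complex)" where
  "conv_dual \<omega> E T S = (\<lambda>f. if f \<in> topspace E then S (conv \<omega> E (reflect T) f) else 0)"

definition convolutors ::
    "(real \<Rightarrow> real) \<Rightarrow> (real ^ 'n \<Rightarrow> complex) topology \<Rightarrow> ((real ^ 'n \<Rightarrow> complex) \<Rightarrow> complex) set" where
  "convolutors \<omega> E = (GREATEST C.
     cfun.subspace C \<and> C \<subseteq> ultradistributions \<omega> \<and>
     (\<forall>f\<in>topspace E. \<forall>T\<in>C. conv_defined \<omega> E T f \<and> conv \<omega> E T f \<in> topspace E) \<and>
     (\<forall>T\<in>C. continuous_map E E (\<lambda>f. conv \<omega> E T f)))"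

definition dual_convolutors ::
    "(real \<Rightarrow> real) \<Rightarrow> (real ^ 'n \<Rightarrow> complex) topology \<Rightarrow> ((real ^ 'n \<Rightarrow> complex) \<Rightarrow> complex) set" where
  "dual_convolutors \<omega> E = (GREATEST C.
     cfun.subspace C \<and> C \<subseteq> ultradistributions \<omega> \<and>
     (\<forall>S\<in>dual E. \<forall>T\<in>C.
        (\<forall>f\<in>topspace E. conv_defined \<omega> E (reflect T) f \<and> conv \<omega> E (reflect T) f \<in> topspace E) \<and>
        conv_dual \<omega> E T S \<in> dual E) \<and>
     (\<forall>T\<in>C. continuous_map (strong_dual E) (strong_dual E) (\<lambda>S. conv_dual \<omega> E T S)))"

end

(* If T is a functional on a space of smooth functions with |T g| <= A r_{m,nk}(g), where k is a
   constant with omega(s + t) <= k (1 + omega(s) + omega(t)), then convolution with T maps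
   O^{2m}_n continuously into O^m_{nk}: the translation by x costs the factor exp(nk omega(x)), and
   2m phi*((a + b)/(2m)) <= m phi*(a/m) + m phi*(b/m) absorbs the derivatives. For O_C this gives
   continuity step by step. For O_M the functional T lives only on the intersection of the inductive
   limits X m = ind_n O^m_n, so it is first extended by Hahn-Banach to some X m0, after which
   convolution maps X (2m) into X m for every m >= m0. Hence every element of the dual is a
   convolutor; the dual case follows by transposition. Conversely a convolutor has an extension in
   the dual, since the convolution must be defined. Only the fixed extension chosen by epsilon is
   ever used, so density of the test functions plays no role. *)

theory Submission
  imports Defs
begin

section \<open>Seminorm topologies\<close>

text \<open>The growth condition log(1+t) = o(\<omega>(t)) makes the Young conjugate finite, so
  every weight is a positive exponential and r_{m,n}(f) \<le> C amounts to pointwise bounds on all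
  derivatives. Since a multi-index derivative is taken along an unspecified list of directions,
  symmetry of mixed derivatives is needed before these bounds can be handled. That a convolution is
  smooth comes from the norm bound on T alone: the remainder of a translate after its linear term
  has norm O(t^2), so T may be applied to difference quotients. Continuity is then deduced from
  bounds on the directional derivatives. The obstacle for O_M is that its topology is generated by
  seminorms living on whole steps ind_n O^m_n. A seminorm f -> q(T * f) has to be dominated by one
  of these, and it makes sense on a step only if T does. The extension of T is not canonical, but it
  agrees with T on all translates of elements of O_M, hence gives the same convolution there. For
  O_C the steps proj_m O^m_n lie in the domain of T from the start.\<close>

lemma seminorm_onD:
  assumes "seminorm_on V p"
  shows "f \<in> V \<Longrightarrow> 0 \<le> p f"
    and "f \<in> V \<Longrightarrow> g \<in> V \<Longrightarrow> p (f + g) \<le> p f + p g"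
    and "f \<in> V \<Longrightarrow> p (cscale c f) = cmod c * p f"
  using assms unfolding seminorm_on_def by blast+

lemma seminorm_on_subset: "seminorm_on V p \<Longrightarrow> W \<subseteq> V \<Longrightarrow> seminorm_on W p"
  unfolding seminorm_on_def by blast

lemma seminorm_on_zero:
  assumes "cfun.subspace V" "seminorm_on V p"
  shows "p 0 = 0"
  using seminorm_onD(3)[OF assms(2) cfun.subspace_0[OF assms(1)], of 0] by simp

lemma seminorm_on_minus:
  assumes "seminorm_on V p" "f \<in> V"
  shows "p (- f) = p f"
proof -
  have "- f = cscale (- 1) f" by (auto simp: cscale_def)
  then show ?thesis using seminorm_onD(3)[OF assms, of "- 1"] by simp
qed

lemma seminorm_on_diff_le:
  assumes "cfun.subspace V" "seminorm_on V p" "f \<in> V" "g \<in> V"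
  shows "\<bar>p f - p g\<bar> \<le> p (f - g)"
proof -
  have d: "f - g \<in> V" using assms cfun.subspace_diff by blast
  have "p (g - f) = p (f - g)" using seminorm_on_minus[OF assms(2) d] by simp
  moreover have "p f \<le> p (f - g) + p g"
    using seminorm_onD(2)[OF assms(2) d assms(4)] by simp
  moreover have "p g \<le> p (g - f) + p f"
    using seminorm_onD(2)[OF assms(2) cfun.subspace_diff[OF assms(1,4,3)] assms(3)] by simp
  ultimately show ?thesis by linarith
qed

lemma seminorm_on_sum:
  assumes "\<forall>p\<in>F. seminorm_on V p"
  shows "seminorm_on V (\<lambda>f. \<Sum>p\<in>F. p f)"
  using assms unfolding seminorm_on_def
  by (auto simp: sum_nonneg sum_distrib_left simp flip: sum.distrib intro!: sum_mono sum.cong)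

lemma seminorm_on_scale: "seminorm_on V p \<Longrightarrow> 0 \<le> C \<Longrightarrow> seminorm_on V (\<lambda>f. C * p f)"
  unfolding seminorm_on_def by (auto simp: mult_left_mono simp flip: distrib_left)

text \<open>By definition a set is open if it contains a ball around each of its points; the
  triangle inequality fits a smaller ball around any point of a given ball.\<close>

lemma openin_seminorm_ball:
  assumes "cfun.subspace V" "\<forall>p\<in>P. seminorm_on V p" "finite F" "F \<subseteq> P" "f \<in> V"
  shows "openin (seminorm_topology V P) {g \<in> V. \<forall>p\<in>F. p (g - f) < \<epsilon>}"
  unfolding openin_seminorm_topology
proof (intro conjI ballI)
  fix g assume g: "g \<in> {g \<in> V. \<forall>p\<in>F. p (g - f) < \<epsilon>}"
  \<comment> \<open>The smallest gap left by any seminorm; the inserted 1 gives a positive value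
    when \<open>F\<close> is empty.\<close>
  define d where "d = Min (insert 1 ((\<lambda>p. \<epsilon> - p (g - f)) ` F))"
  have d: "0 < d" "\<And>p. p \<in> F \<Longrightarrow> d \<le> \<epsilon> - p (g - f)"
    using g assms(3) by (auto simp: d_def)
  have "p (h - f) < \<epsilon>" if "h \<in> V" "p \<in> F" "p (h - g) < d" for h p
  proof -
    have "h - g \<in> V" "g - f \<in> V" using cfun.subspace_diff[OF assms(1)] that g assms(5) by auto
    then have "p ((h - g) + (g - f)) \<le> p (h - g) + p (g - f)"
      using seminorm_onD(2) assms(2,4) that(2) by blast
    then show ?thesis using d(2)[OF that(2)] that(3) by simp
  qed
  then have "{h \<in> V. \<forall>p\<in>F. p (h - g) < d} \<subseteq> {g \<in> V. \<forall>p\<in>F. p (g - f) < \<epsilon>}" by blast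
  with assms(3,4) d(1) show "\<exists>G e. finite G \<and> G \<subseteq> P \<and> 0 < e \<and>
      {h \<in> V. \<forall>p\<in>G. p (h - g) < e} \<subseteq> {g \<in> V. \<forall>p\<in>F. p (g - f) < \<epsilon>}" by blast
qed blast

text \<open>A Lipschitz bound by finitely many seminorms serves seminorms and linear functionals
  alike. The subset \<open>A\<close> is there for the steps of \<open>D_space\<close>, which carry
  the topology of \<open>E_space\<close> restricted to functions supported in a fixed compact
  set.\<close>

lemma continuous_map_subtopology_seminormI:
  fixes T :: "('b \<Rightarrow> complex) \<Rightarrow> 'c::metric_space"
  assumes V: "cfun.subspace V" "\<forall>p\<in>P. seminorm_on V p"
    and F: "finite F" "F \<subseteq> P" "0 \<le> C"
    and bound: "\<And>f g. f \<in> V \<inter> A \<Longrightarrow> g \<in> V \<inter> A \<Longrightarrow> dist (T g) (T f) \<le> C * (\<Sum>p\<in>F. p (g - f))"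
  shows "continuous_map (subtopology (seminorm_topology V P) A) euclidean T"
  unfolding continuous_map_def
proof (intro conjI allI impI)
  let ?X = "subtopology (seminorm_topology V P) A"
  fix U :: "'c set" assume "openin euclidean U"
  then have U: "open U" by simp
  show "openin ?X {f \<in> topspace ?X. T f \<in> U}"
  proof (subst openin_subopen, intro ballI)
    fix f assume f: "f \<in> {f \<in> topspace ?X. T f \<in> U}"
    then have fV: "f \<in> V" "f \<in> A" by auto
    from f U obtain e where e: "0 < e" "\<And>z. dist z (T f) < e \<Longrightarrow> z \<in> U"
      by (auto simp: open_dist)
    \<comment> \<open>The summand 1 keeps the denominator positive when \<open>C\<close> is 0 or
      \<open>F\<close> is empty, and makes the final estimate strict.\<close>
    define d where "d = e / (C * card F + 1)"
    have pos: "0 < C * card F + 1" using F(3) by (simp add: add_nonneg_pos)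
    have d: "0 < d" using e pos by (simp add: d_def)
    have "T g \<in> U" if g: "g \<in> V" "g \<in> A" "\<forall>p\<in>F. p (g - f) < d" for g
    proof -
      have "(\<Sum>p\<in>F. p (g - f)) \<le> (\<Sum>p\<in>F. d)" using g(3) by (intro sum_mono) auto
      then have "C * (\<Sum>p\<in>F. p (g - f)) \<le> C * card F * d"
        using mult_left_mono[OF _ F(3)] by fastforce
      also have "\<dots> < (C * card F + 1) * d" using d by (simp add: algebra_simps)
      also have "\<dots> = e" using pos by (simp add: d_def)
      finally show ?thesis using bound[of f g] g fV e(2) by force
    qed
    moreover have "openin ?X ({g \<in> V. \<forall>p\<in>F. p (g - f) < d} \<inter> A)"
      using openin_seminorm_ball[OF V F(1,2) fV(1)] by (auto simp: openin_subtopology)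
    moreover have "f \<in> {g \<in> V. \<forall>p\<in>F. p (g - f) < d} \<inter> A"
    proof -
      have "p (f - f) < d" if "p \<in> F" for p
        using that F(2) seminorm_on_zero[OF V(1), of p] V(2) d by auto
      then show ?thesis using fV by blast
    qed
    ultimately show "\<exists>S. openin ?X S \<and> f \<in> S \<and> S \<subseteq> {f \<in> topspace ?X. T f \<in> U}"
      by (intro exI[of _ "{g \<in> V. \<forall>p\<in>F. p (g - f) < d} \<inter> A"]) auto
  qed
qed auto

text \<open>Continuity at 0 puts a ball of radius \<open>e\<close> for finitely many seminorms
  inside the set where \<open>q\<close> is below 1; homogeneity spreads this to a bound with
  constant \<open>1 / e\<close> on all of \<open>V\<close>.\<close>

lemma continuous_map_seminorm_on_iff:
  assumes V: "cfun.subspace V" "\<forall>p\<in>P. seminorm_on V p" and q: "seminorm_on V q"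
  shows "continuous_map (seminorm_topology V P) euclideanreal q \<longleftrightarrow>
    (\<exists>F C. finite F \<and> F \<subseteq> P \<and> 0 \<le> C \<and> (\<forall>f\<in>V. q f \<le> C * (\<Sum>p\<in>F. p f)))"
proof
  assume "continuous_map (seminorm_topology V P) euclideanreal q"
  then have "openin (seminorm_topology V P) {f \<in> topspace (seminorm_topology V P). q f \<in> {..<1}}"
    by (rule openin_continuous_map_preimage) simp
  then have "openin (seminorm_topology V P) {f \<in> V. q f < 1}" by simp
  moreover have "0 \<in> {f \<in> V. q f < 1}"
    using cfun.subspace_0[OF V(1)] seminorm_on_zero[OF V(1) q] by simp
  ultimately obtain F e where F: "finite F" "F \<subseteq> P" "0 < e"
      "{g \<in> V. \<forall>p\<in>F. p (g - 0) < e} \<subseteq> {f \<in> V. q f < 1}"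
    unfolding openin_seminorm_topology by blast
  have "q f \<le> (1 / e) * (\<Sum>p\<in>F. p f)" if f: "f \<in> V" for f
  proof (rule field_le_epsilon)
    fix d :: real assume d: "0 < d"
    \<comment> \<open>The summand \<open>d * e\<close> keeps \<open>s\<close> positive where all
      seminorms of \<open>F\<close> vanish on \<open>f\<close>; after rescaling by
      \<open>e / s\<close> it becomes the error \<open>d\<close>.\<close>
    define s where "s = (\<Sum>p\<in>F. p f) + d * e"
    have p0: "0 \<le> p f" if "p \<in> F" for p using that F(2) V(2) seminorm_onD(1) f by blast
    then have s: "0 < s" using d F(3) unfolding s_def by (intro add_nonneg_pos sum_nonneg) auto
    define g where "g = cscale (complex_of_real (e / s)) f"
    have gV: "g \<in> V" unfolding g_def using cfun.subspace_scale[OF V(1) f] .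
    have cm: "cmod (complex_of_real (e / s)) = e / s"
      using F(3) s by (simp only: norm_of_real) simp
    have "p g < e" if p: "p \<in> F" for p
    proof -
      have "p g = e / s * p f"
        unfolding g_def using seminorm_onD(3)[of V p f] p F(2) V(2) f cm by auto
      moreover have "p f < s"
        unfolding s_def using member_le_sum[OF p, of "\<lambda>p. p f"] p0 F(1,3) d
        by (metis DiffD1 add_le_less_mono add.right_neutral mult_pos_pos)
      ultimately show ?thesis using F(3) s by (simp add: pos_divide_less_eq)
    qed
    then have "g \<in> {f \<in> V. q f < 1}" using F(4) gV by auto
    moreover have "q g = e / s * q f" unfolding g_def using seminorm_onD(3)[OF q f] cm by simp
    ultimately have "q f < s / e" using F(3) s by (simp add: field_simps)
    then show "q f \<le> (1 / e) * (\<Sum>p\<in>F. p f) + d" using F(3) by (simp add: s_def field_simps)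
  qed
  then show "\<exists>F C. finite F \<and> F \<subseteq> P \<and> 0 \<le> C \<and> (\<forall>f\<in>V. q f \<le> C * (\<Sum>p\<in>F. p f))"
    using F by (intro exI[of _ F] exI[of _ "1 / e"]) auto
next
  assume "\<exists>F C. finite F \<and> F \<subseteq> P \<and> 0 \<le> C \<and> (\<forall>f\<in>V. q f \<le> C * (\<Sum>p\<in>F. p f))"
  then obtain F C where F: "finite F" "F \<subseteq> P" "0 \<le> C" "\<And>f. f \<in> V \<Longrightarrow> q f \<le> C * (\<Sum>p\<in>F. p f)"
    by blast
  have "dist (q g) (q f) \<le> C * (\<Sum>p\<in>F. p (g - f))" if "f \<in> V \<inter> UNIV" "g \<in> V \<inter> UNIV" for f g
    using seminorm_on_diff_le[OF V(1) q, of g f] F(4)[of "g - f"] cfun.subspace_diff[OF V(1), of g f] that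
    by (auto simp: dist_real_def)
  from continuous_map_subtopology_seminormI[OF V F(1-3) this, of UNIV]
  show "continuous_map (seminorm_topology V P) euclideanreal q" by simp
qed

section \<open>Linear functionals and linear maps between seminorm topologies\<close>

definition linear_on :: "('b \<Rightarrow> complex) set \<Rightarrow> (('b \<Rightarrow> complex) \<Rightarrow> complex) \<Rightarrow> bool" where
  "linear_on V T \<longleftrightarrow>
     (\<forall>f\<in>V. \<forall>g\<in>V. T (f + g) = T f + T g) \<and> (\<forall>c. \<forall>f\<in>V. T (cscale c f) = c * T f)"

lemma linear_onD:
  assumes "linear_on V T"
  shows "f \<in> V \<Longrightarrow> g \<in> V \<Longrightarrow> T (f + g) = T f + T g"
    and "f \<in> V \<Longrightarrow> T (cscale c f) = c * T f"
  using assms unfolding linear_on_def by blast+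

lemma linear_on_diff:
  assumes "cfun.subspace V" "linear_on V T" "f \<in> V" "g \<in> V"
  shows "T (f - g) = T f - T g"
proof -
  have "f - g = f + cscale (- 1) g" by (auto simp: cscale_def)
  then show ?thesis
    using linear_onD(1)[OF assms(2,3) cfun.subspace_scale[OF assms(1,4), of "- 1"]]
      linear_onD(2)[OF assms(2,4), of "- 1"] by simp
qed

lemma linear_on_subset: "linear_on V T \<Longrightarrow> W \<subseteq> V \<Longrightarrow> linear_on W T"
  unfolding linear_on_def by blast

lemma seminorm_on_cmod_linear: "linear_on V T \<Longrightarrow> seminorm_on V (\<lambda>f. cmod (T f))"
  unfolding linear_on_def seminorm_on_def by (auto simp: norm_mult norm_triangle_ineq)

lemma dual_iff:
  "T \<in> dual E \<longleftrightarrow> (\<forall>f. f \<notin> topspace E \<longrightarrow> T f = 0) \<and> linear_on (topspace E) T \<and>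
     continuous_map E euclidean T"
  unfolding dual_def linear_on_def by auto

lemma continuous_map_cmod:
  assumes "continuous_map E euclidean T"
  shows "continuous_map E euclideanreal (\<lambda>f. cmod (T f))"
  using assms by (intro continuous_map_norm)

text \<open>A bound by finitely many seminorms is continuity of the seminorm
  \<open>cmod (T f)\<close>, and by linearity that is continuity of \<open>T\<close> itself.\<close>

lemma dual_seminorm_topology_iff:
  assumes V: "cfun.subspace V" "\<forall>p\<in>P. seminorm_on V p"
  shows "T \<in> dual (seminorm_topology V P) \<longleftrightarrow>
    (\<forall>f. f \<notin> V \<longrightarrow> T f = 0) \<and> linear_on V T \<and>
    (\<exists>F C. finite F \<and> F \<subseteq> P \<and> 0 \<le> C \<and> (\<forall>f\<in>V. cmod (T f) \<le> C * (\<Sum>p\<in>F. p f)))"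
    (is "_ \<longleftrightarrow> ?z \<and> ?l \<and> ?b")
proof -
  have "continuous_map (seminorm_topology V P) euclidean T \<longleftrightarrow> ?b" if l: ?l
  proof
    assume "continuous_map (seminorm_topology V P) euclidean T"
    from continuous_map_cmod[OF this] show ?b
      using continuous_map_seminorm_on_iff[OF V seminorm_on_cmod_linear[OF l]] by simp
  next
    assume ?b
    then obtain F C where F: "finite F" "F \<subseteq> P" "0 \<le> C"
        "\<And>f. f \<in> V \<Longrightarrow> cmod (T f) \<le> C * (\<Sum>p\<in>F. p f)" by blast
    have "dist (T g) (T f) \<le> C * (\<Sum>p\<in>F. p (g - f))" if "f \<in> V \<inter> UNIV" "g \<in> V \<inter> UNIV" for f g
      using linear_on_diff[OF V(1) l, of g f] F(4)[of "g - f"] cfun.subspace_diff[OF V(1), of g f] that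
      by (auto simp: dist_norm)
    from continuous_map_subtopology_seminormI[OF V F(1-3) this, of UNIV]
    show "continuous_map (seminorm_topology V P) euclidean T" by simp
  qed
  then show ?thesis by (auto simp: dual_iff)
qed

text \<open>A basic neighbourhood of \<open>L f\<close> involves finitely many seminorms, and the
  seminorms dominating their pullbacks define a neighbourhood of \<open>f\<close>. One dominating
  seminorm, without sum or constant, suits families that contain all continuous seminorms of a
  step.\<close>

lemma continuous_map_into_seminorm_topology:
  fixes L :: "('b \<Rightarrow> complex) \<Rightarrow> ('c \<Rightarrow> complex)"
  assumes L: "\<And>f. f \<in> V \<Longrightarrow> L f \<in> W"
    and diff: "\<And>f g. f \<in> V \<Longrightarrow> g \<in> V \<Longrightarrow> L (g - f) = L g - L f"
    and V: "cfun.subspace V"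
    and pull: "\<And>q. q \<in> Q \<Longrightarrow> \<exists>p\<in>P. \<forall>f\<in>V. q (L f) \<le> p f"
  shows "continuous_map (seminorm_topology V P) (seminorm_topology W Q) L"
  unfolding continuous_map_def
proof (intro conjI allI impI)
  show "L \<in> topspace (seminorm_topology V P) \<rightarrow> topspace (seminorm_topology W Q)" using L by simp
  fix U assume U: "openin (seminorm_topology W Q) U"
  obtain r where r: "\<And>q. q \<in> Q \<Longrightarrow> r q \<in> P \<and> (\<forall>f\<in>V. q (L f) \<le> r q f)" using pull by metis
  have "\<exists>F e. finite F \<and> F \<subseteq> P \<and> 0 < e \<and>
      {g \<in> V. \<forall>p\<in>F. p (g - f) < e} \<subseteq> {f \<in> V. L f \<in> U}" if f: "f \<in> V" "L f \<in> U" for f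
  proof -
    obtain F e where F: "finite F" "F \<subseteq> Q" "0 < e" "{h \<in> W. \<forall>q\<in>F. q (h - L f) < e} \<subseteq> U"
      using U f(2) unfolding openin_seminorm_topology by blast
    have "{g \<in> V. \<forall>p\<in>r ` F. p (g - f) < e} \<subseteq> {f \<in> V. L f \<in> U}"
    proof (intro subsetI)
      fix g assume g: "g \<in> {g \<in> V. \<forall>p\<in>r ` F. p (g - f) < e}"
      have "q (L g - L f) < e" if q: "q \<in> F" for q
      proof -
        have "g - f \<in> V" using cfun.subspace_diff[OF V] g f(1) by blast
        then have "q (L (g - f)) \<le> r q (g - f)" using r[of q] q F(2) by blast
        then show ?thesis using diff[OF f(1), of g] g q by force
      qed
      then show "g \<in> {f \<in> V. L f \<in> U}" using F(4) g L by blast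
    qed
    moreover have "finite (r ` F)" "r ` F \<subseteq> P" using F(1,2) r by auto
    ultimately show ?thesis using F(3) by blast
  qed
  then show "openin (seminorm_topology V P) {f \<in> topspace (seminorm_topology V P). L f \<in> U}"
    unfolding openin_seminorm_topology by auto
qed

text \<open>Each generating set contains a ball around each of its points. Conversely, a ball for
  finitely many seminorms is a finite intersection of balls for one seminorm each, and each of these
  comes from a single factor.\<close>

lemma proj_limit_seminorm_topology:
  assumes I: "I \<noteq> {}"
    and V: "\<And>i. i \<in> I \<Longrightarrow> cfun.subspace (V i)"
    and P: "\<And>i p. i \<in> I \<Longrightarrow> p \<in> P i \<Longrightarrow> seminorm_on (V i) p"
  shows "proj_limit I (\<lambda>i. seminorm_topology (V i) (P i)) =
    seminorm_topology (\<Inter>i\<in>I. V i) (\<Union>i\<in>I. P i)"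
proof -
  let ?W = "\<Inter>i\<in>I. V i"
  let ?T = "seminorm_topology ?W (\<Union>i\<in>I. P i)"
  define G where "G = {?W \<inter> U | i U. i \<in> I \<and> openin (seminorm_topology (V i) (P i)) U}"
  have GX: "proj_limit I (\<lambda>i. seminorm_topology (V i) (P i)) = topology_generated_by G"
    unfolding proj_limit_def G_def by simp
  have "openin (topology_generated_by G) U \<longleftrightarrow> openin ?T U" for U
  proof
    assume "openin (topology_generated_by G) U"
    then have gen: "generate_topology_on G U" by (rule openin_topology_generated_by)
    have "openin ?T S" if "S \<in> G" for S
    proof -
      from that obtain i U where i: "S = ?W \<inter> U" "i \<in> I" "openin (seminorm_topology (V i) (P i)) U"
        unfolding G_def by blast
      show ?thesis unfolding openin_seminorm_topology
      proof (intro conjI ballI)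
        fix f assume "f \<in> S"
        then obtain F e where "finite F" "F \<subseteq> P i" "0 < e" "{g \<in> V i. \<forall>p\<in>F. p (g - f) < e} \<subseteq> U"
          using i unfolding openin_seminorm_topology by blast
        then show "\<exists>F e. finite F \<and> F \<subseteq> (\<Union>i\<in>I. P i) \<and> 0 < e \<and>
            {g \<in> ?W. \<forall>p\<in>F. p (g - f) < e} \<subseteq> S"
          using i(1,2) by (intro exI[of _ F] exI[of _ e]) auto
      qed (use i in blast)
    qed
    then show "openin ?T U"
      by (rule generate_topology_on_coarsest[OF istopology_openin _ gen])
  next
    assume U: "openin ?T U"
    show "openin (topology_generated_by G) U"
    proof (subst openin_subopen, intro ballI)
      fix f assume fU: "f \<in> U"
      then obtain F e where F: "finite F" "F \<subseteq> (\<Union>i\<in>I. P i)" "0 < e"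
          "{g \<in> ?W. \<forall>p\<in>F. p (g - f) < e} \<subseteq> U"
        using U unfolding openin_seminorm_topology by blast
      have fW: "f \<in> ?W" using U fU unfolding openin_seminorm_topology by blast
      have ball: "openin (topology_generated_by G) {g \<in> ?W. p (g - f) < e}" if "p \<in> F" for p
      proof -
        obtain i where i: "i \<in> I" "p \<in> P i" using F(2) \<open>p \<in> F\<close> by blast
        have "openin (seminorm_topology (V i) (P i)) {g \<in> V i. \<forall>p\<in>{p}. p (g - f) < e}"
          using openin_seminorm_ball[of "V i" "P i" "{p}" f e] V P i fW by auto
        moreover have "{g \<in> ?W. p (g - f) < e} = ?W \<inter> {g \<in> V i. \<forall>p\<in>{p}. p (g - f) < e}"
          using i by blast
        ultimately have "{g \<in> ?W. p (g - f) < e} \<in> G" unfolding G_def using i by blast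
        then show ?thesis by (rule topology_generated_by_Basis)
      qed
      \<comment> \<open>Base case of the finite intersection: with no seminorm the ball is
        \<open>?W\<close> itself, a generating set because \<open>I\<close> is nonempty.\<close>
      have W: "openin (topology_generated_by G) ?W"
      proof -
        obtain i where i: "i \<in> I" using I by blast
        have "openin (seminorm_topology (V i) (P i)) (V i)"
          using openin_topspace[of "seminorm_topology (V i) (P i)"] by simp
        moreover have "?W = ?W \<inter> V i" using i by blast
        ultimately have "?W \<in> G" unfolding G_def using i by blast
        then show ?thesis by (rule topology_generated_by_Basis)
      qed
      have "F' \<subseteq> F \<Longrightarrow> openin (topology_generated_by G) {g \<in> ?W. \<forall>p\<in>F'. p (g - f) < e}"
        if "finite F'" for F'
        using that
      proof (induction F')
        case empty
        have "{g \<in> ?W. \<forall>p\<in>{}. p (g - f) < e} = ?W" by auto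
        then show ?case using W by (rule ssubst)
      next
        case (insert p F')
        have "{g \<in> ?W. \<forall>p\<in>insert p F'. p (g - f) < e} =
            {g \<in> ?W. p (g - f) < e} \<inter> {g \<in> ?W. \<forall>p\<in>F'. p (g - f) < e}" by blast
        then show ?case
          by (rule ssubst) (rule openin_Int[OF ball insert.IH], use insert.prems in simp_all)
      qed
      from this[OF F(1)] have "openin (topology_generated_by G) {g \<in> ?W. \<forall>p\<in>F. p (g - f) < e}" by simp
      moreover have "p (f - f) < e" if "p \<in> F" for p
      proof -
        obtain i where i: "i \<in> I" "p \<in> P i" using F(2) \<open>p \<in> F\<close> by blast
        then show ?thesis using seminorm_on_zero[OF V[OF i(1)] P[OF i]] F(3) by simp
      qed
      ultimately show "\<exists>T. openin (topology_generated_by G) T \<and> f \<in> T \<and> T \<subseteq> U"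
        using F(4) fW by (intro exI[of _ "{g \<in> ?W. \<forall>p\<in>F. p (g - f) < e}"]) auto
    qed
  qed
  then show ?thesis unfolding GX by (simp add: topology_eq)
qed

text \<open>Both \<open>r_norm\<close> and \<open>p_norm\<close> are suprema in
  \<open>ennreal\<close>, and \<open>Bd C f\<close> stands for the pointwise bounds equivalent to
  \<open>N f \<le> C\<close>. Such bounds add up and scale, which gives the subspace property, the
  triangle inequality and one half of homogeneity; the other half follows by scaling back with
  \<open>1 / c\<close>.\<close>

lemma
  fixes N :: "('b \<Rightarrow> complex) \<Rightarrow> ennreal"
  assumes V0: "cfun.subspace V0"
    and N: "\<And>f C. f \<in> V0 \<Longrightarrow> 0 \<le> C \<Longrightarrow> N f \<le> ennreal C \<longleftrightarrow> Bd C f"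
    and zero: "Bd 0 0"
    and add: "\<And>f g C D. f \<in> V0 \<Longrightarrow> g \<in> V0 \<Longrightarrow> Bd C f \<Longrightarrow> Bd D g \<Longrightarrow> Bd (C + D) (f + g)"
    and scale: "\<And>f c C. f \<in> V0 \<Longrightarrow> Bd C f \<Longrightarrow> Bd (cmod c * C) (cscale c f)"
  defines "V \<equiv> {f \<in> V0. N f < \<infinity>}"
  shows subspace_gauge: "cfun.subspace V"
    and seminorm_on_gauge: "seminorm_on V (\<lambda>f. enn2real (N f))"
    and gauge_bound: "\<And>f. f \<in> V \<Longrightarrow> Bd (enn2real (N f)) f"
    and gauge_least: "\<And>f C. f \<in> V0 \<Longrightarrow> 0 \<le> C \<Longrightarrow> Bd C f \<Longrightarrow> f \<in> V \<and> enn2real (N f) \<le> C"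
proof -
  show bound: "Bd (enn2real (N f)) f" if "f \<in> V" for f
    using that N[of f "enn2real (N f)"] unfolding V_def by auto
  show least: "f \<in> V \<and> enn2real (N f) \<le> C" if "f \<in> V0" "0 \<le> C" "Bd C f" for f C
    using N[OF that(1,2)] that enn2real_leI[of C "N f"] unfolding V_def
    by (auto intro: le_less_trans[OF _ ennreal_less_top])
  have VV0: "f \<in> V0" if "f \<in> V" for f using that unfolding V_def by blast
  have addV: "f + g \<in> V \<and> enn2real (N (f + g)) \<le> enn2real (N f) + enn2real (N g)"
    if "f \<in> V" "g \<in> V" for f g
    by (rule least) (use add bound that VV0 cfun.subspace_add[OF V0] in auto)
  have scaleV: "cscale c f \<in> V \<and> enn2real (N (cscale c f)) \<le> cmod c * enn2real (N f)"
    if "f \<in> V" for f c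
    by (rule least) (use scale bound that VV0 cfun.subspace_scale[OF V0] in auto)
  have zeroV: "0 \<in> V \<and> enn2real (N 0) \<le> 0"
    by (rule least) (use zero cfun.subspace_0[OF V0] in auto)
  show "cfun.subspace V"
    using addV scaleV zeroV by (intro cfun.subspaceI) auto
  have "enn2real (N (cscale c f)) = cmod c * enn2real (N f)" if f: "f \<in> V" for f c
  proof (cases "c = 0")
    case True
    then have "cscale c f = 0" by (auto simp: cscale_def)
    then show ?thesis using zeroV enn2real_nonneg[of "N 0"] True by simp
  next
    case False
    have eq: "cscale (1 / c) (cscale c f) = f" using False by (auto simp: cscale_def)
    have "enn2real (N f) \<le> cmod (1 / c) * enn2real (N (cscale c f))"
      using scaleV[of "cscale c f" "1 / c"] scaleV[OF f] unfolding eq by blast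
    then have "cmod c * enn2real (N f) \<le> enn2real (N (cscale c f))"
      using False by (simp add: norm_divide field_simps)
    then show ?thesis using scaleV[OF f, of c] by linarith
  qed
  then show "seminorm_on V (\<lambda>f. enn2real (N f))"
    using addV unfolding seminorm_on_def by auto
qed

section \<open>The Hahn-Banach theorem\<close>

abbreviation rscale :: "real \<Rightarrow> ('b \<Rightarrow> complex) \<Rightarrow> ('b \<Rightarrow> complex)" where
  "rscale r \<equiv> cscale (complex_of_real r)"

text \<open>Partial real functionals are handled as additive, homogeneous relations \<open>G\<close> below the graph of
  \<open>p\<close>; since \<open>p 0 = 0\<close>, such a relation is automatically single valued.\<close>

definition subfunctional ::
    "('b \<Rightarrow> complex) set \<Rightarrow> (('b \<Rightarrow> complex) \<Rightarrow> real) \<Rightarrow> (('b \<Rightarrow> complex) \<times> real) set \<Rightarrow> bool" where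
  "subfunctional V p G \<longleftrightarrow>
     (\<forall>f a g b. (f, a) \<in> G \<and> (g, b) \<in> G \<longrightarrow> (f + g, a + b) \<in> G) \<and>
     (\<forall>r f a. (f, a) \<in> G \<longrightarrow> (rscale r f, r * a) \<in> G) \<and>
     (\<forall>f a. (f, a) \<in> G \<longrightarrow> f \<in> V \<and> a \<le> p f)"

lemma subfunctionalD:
  assumes "subfunctional V p G"
  shows "(f, a) \<in> G \<Longrightarrow> (g, b) \<in> G \<Longrightarrow> (f + g, a + b) \<in> G"
    and "(f, a) \<in> G \<Longrightarrow> (rscale r f, r * a) \<in> G"
    and "(f, a) \<in> G \<Longrightarrow> f \<in> V"
    and "(f, a) \<in> G \<Longrightarrow> a \<le> p f"
  using assms unfolding subfunctional_def by blast+

lemma subfunctional_unique: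
  assumes V: "cfun.subspace V" "seminorm_on V p" and G: "subfunctional V p G"
    and "(f, a) \<in> G" "(f, b) \<in> G"
  shows "a = b"
proof -
  have le: "a \<le> b" if "(f, a) \<in> G" "(f, b) \<in> G" for a b
  proof -
    have "(f + rscale (- 1) f, a + (- 1) * b) \<in> G"
      using subfunctionalD(1)[OF G that(1) subfunctionalD(2)[OF G that(2)]] .
    moreover have "f + rscale (- 1) f = 0" by (auto simp: cscale_def)
    ultimately have "(0, a - b) \<in> G" by simp
    then show ?thesis using subfunctionalD(4)[OF G] seminorm_on_zero[OF V] by fastforce
  qed
  show ?thesis using le assms(4,5) by (simp add: order_antisym)
qed

text \<open>The value \<open>c\<close> at \<open>x\<close> has to satisfy
  \<open>a - p (f - x) \<le> c \<le> p (g + x) - b\<close> for all pairs \<open>(f, a)\<close> and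
  \<open>(g, b)\<close> in \<open>G\<close>. Subadditivity of \<open>p\<close> puts every lower
  bound below every upper bound, so the supremum of the lower bounds works.\<close>

lemma subfunctional_extend:
  assumes V: "cfun.subspace V" and p: "seminorm_on V p" and G: "subfunctional V p G" "G \<noteq> {}"
    and x: "x \<in> V"
  shows "\<exists>G'. subfunctional V p G' \<and> G \<subseteq> G' \<and> x \<in> fst ` G'"
proof -
  note GD = subfunctionalD[OF G(1)]
  obtain f0 a0 where fa0: "(f0, a0) \<in> G" using G(2) by auto
  define L where "L = {a - p (f - x) | f a. (f, a) \<in> G}"
  define c where "c = Sup L"
  have key: "a - p (f - x) \<le> p (g + x) - b" if "(f, a) \<in> G" "(g, b) \<in> G" for f a g b
  proof -
    have "a + b \<le> p (f + g)" using GD(1,4) that by blast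
    also have "f + g = (f - x) + (g + x)" by simp
    also have "p \<dots> \<le> p (f - x) + p (g + x)"
      using seminorm_onD(2)[OF p cfun.subspace_diff[OF V GD(3)[OF that(1)] x]
          cfun.subspace_add[OF V GD(3)[OF that(2)] x]] .
    finally show ?thesis by simp
  qed
  have bdd: "bdd_above L" 
  proof (rule bdd_aboveI)
    fix y assume "y \<in> L"
    then obtain f a where "y = a - p (f - x)" "(f, a) \<in> G" unfolding L_def by blast
    then show "y \<le> p (f0 + x) - a0" using key[OF _ fa0, of f a] by simp
  qed
  have lo: "a - p (f - x) \<le> c" if "(f, a) \<in> G" for f a
    unfolding c_def by (rule cSup_upper[OF _ bdd]) (use that in \<open>unfold L_def, blast\<close>)
  have hi: "c \<le> p (g + x) - b" if "(g, b) \<in> G" for g b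
    unfolding c_def
  proof (rule cSup_least)
    show "L \<noteq> {}" unfolding L_def using fa0 by blast
    show "y \<le> p (g + x) - b" if "y \<in> L" for y
      using that key[OF _ \<open>(g, b) \<in> G\<close>] unfolding L_def by blast
  qed
  define G' where "G' = {(f + rscale t x, a + t * c) | f a t. (f, a) \<in> G}"
  \<comment> \<open>Homogeneity reduces a nonzero \<open>t\<close> to 1 or -1, where
    \<open>hi\<close> and \<open>lo\<close> apply.\<close>
  have bound: "a + t * c \<le> p (f + rscale t x)" if fa: "(f, a) \<in> G" for f a t
  proof (cases t "0 :: real" rule: linorder_cases)
    case equal
    then have "f + rscale t x = f" by (auto simp: cscale_def)
    then show ?thesis using GD(4)[OF fa] equal by simp
  next
    case greater
    have "(rscale (1 / t) f, (1 / t) * a) \<in> G" by (rule GD(2)[OF fa])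
    from hi[OF this] have h: "a / t + c \<le> p (rscale (1 / t) f + x)" by simp
    have "rscale (1 / t) f + x \<in> V"
      using cfun.subspace_add[OF V cfun.subspace_scale[OF V GD(3)[OF fa]] x] .
    from seminorm_onD(3)[OF p this, of "complex_of_real t"]
    have "p (rscale t (rscale (1 / t) f + x)) = t * p (rscale (1 / t) f + x)"
      using greater by simp
    moreover have "rscale t (rscale (1 / t) f + x) = f + rscale t x"
      using greater by (auto simp: cscale_def fun_eq_iff field_simps)
    moreover have "t * (a / t + c) \<le> t * p (rscale (1 / t) f + x)"
      using h greater by (intro mult_left_mono) auto
    ultimately show ?thesis using greater by (simp add: distrib_left)
  next
    case less
    define s where "s = - t"
    have s: "0 < s" using less by (simp add: s_def)
    have "(rscale (1 / s) f, (1 / s) * a) \<in> G" by (rule GD(2)[OF fa])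
    from lo[OF this] have h: "a / s - c \<le> p (rscale (1 / s) f - x)" by simp
    have "rscale (1 / s) f - x \<in> V"
      using cfun.subspace_diff[OF V cfun.subspace_scale[OF V GD(3)[OF fa]] x] .
    from seminorm_onD(3)[OF p this, of "complex_of_real s"]
    have "p (rscale s (rscale (1 / s) f - x)) = s * p (rscale (1 / s) f - x)"
      using s by simp
    moreover have "rscale s (rscale (1 / s) f - x) = f + rscale t x"
      using s by (auto simp: cscale_def fun_eq_iff field_simps s_def)
    moreover have "s * (a / s - c) \<le> s * p (rscale (1 / s) f - x)"
      using h s by (intro mult_left_mono) auto
    ultimately show ?thesis using s by (simp add: right_diff_distrib s_def)
  qed
  have "subfunctional V p G'" unfolding subfunctional_def
  proof (intro conjI allI impI)
    fix f a g b assume "(f, a) \<in> G' \<and> (g, b) \<in> G'"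
    then obtain f1 a1 t1 f2 a2 t2 where
      1: "f = f1 + rscale t1 x" "a = a1 + t1 * c" "(f1, a1) \<in> G" and
      2: "g = f2 + rscale t2 x" "b = a2 + t2 * c" "(f2, a2) \<in> G"
      unfolding G'_def by blast
    have "f + g = (f1 + f2) + rscale (t1 + t2) x" "a + b = (a1 + a2) + (t1 + t2) * c"
      unfolding 1 2 by (auto simp: cscale_def fun_eq_iff algebra_simps)
    then show "(f + g, a + b) \<in> G'" unfolding G'_def using GD(1)[OF 1(3) 2(3)] by blast
  next
    fix r f a assume "(f, a) \<in> G'"
    then obtain f1 a1 t1 where 1: "f = f1 + rscale t1 x" "a = a1 + t1 * c" "(f1, a1) \<in> G"
      unfolding G'_def by blast
    have "rscale r f = rscale r f1 + rscale (r * t1) x" "r * a = r * a1 + (r * t1) * c"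
      unfolding 1 by (auto simp: cscale_def fun_eq_iff algebra_simps)
    then show "(rscale r f, r * a) \<in> G'" unfolding G'_def using GD(2)[OF 1(3)] by blast
  next
    fix f a assume "(f, a) \<in> G'"
    then show "f \<in> V" "a \<le> p f"
      unfolding G'_def using bound GD(3) x cfun.subspace_add[OF V] cfun.subspace_scale[OF V] by auto
  qed
  moreover have "G \<subseteq> G'"
  proof
    fix z assume "z \<in> G"
    moreover have "z = (fst z + rscale 0 x, snd z + 0 * c)" by (auto simp: cscale_def prod_eq_iff)
    ultimately show "z \<in> G'" unfolding G'_def by (metis (mono_tags, lifting) CollectI prod.collapse)
  qed
  moreover have "(0, 0) \<in> G"
  proof -
    have "rscale 0 f0 = 0" by (auto simp: cscale_def)
    then show ?thesis using GD(2)[OF fa0, of 0] by simp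
  qed
  then have "(0 + rscale 1 x, 0 + 1 * c) \<in> G'" unfolding G'_def by blast
  then have "x \<in> fst ` G'" by (force simp: cscale_def)
  ultimately show ?thesis by blast
qed

text \<open>Zorn's lemma for inclusion of relations: two pairs from the union of a chain lie in a
  common member, so the union is again admissible. A maximal relation has full domain, since
  otherwise one more vector could be adjoined.\<close>

lemma subfunctional_maximal:
  assumes V: "cfun.subspace V" and p: "seminorm_on V p" and G0: "subfunctional V p G0" "G0 \<noteq> {}"
  shows "\<exists>G. subfunctional V p G \<and> G0 \<subseteq> G \<and> fst ` G = V"
proof -
  define A where "A = {G. subfunctional V p G \<and> G0 \<subseteq> G}"
  have "\<Union>C \<in> A" if C: "C \<noteq> {}" "subset.chain A C" for C
  proof -
    have CA: "subfunctional V p G \<and> G0 \<subseteq> G" if "G \<in> C" for G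
      using that C(2) unfolding A_def subset_chain_def by blast
    have dir: "\<exists>G\<in>C. z \<in> G \<and> w \<in> G" if "z \<in> \<Union>C" "w \<in> \<Union>C" for z w
      using that C(2) unfolding subset_chain_def by blast
    have "subfunctional V p (\<Union>C)" unfolding subfunctional_def
    proof (intro conjI allI impI)
      fix f a g b assume "(f, a) \<in> \<Union>C \<and> (g, b) \<in> \<Union>C"
      then obtain G where "G \<in> C" "(f, a) \<in> G" "(g, b) \<in> G" using dir by blast
      then show "(f + g, a + b) \<in> \<Union>C" using CA subfunctionalD(1) by blast
    next
      fix r f a assume "(f, a) \<in> \<Union>C"
      then show "(rscale r f, r * a) \<in> \<Union>C" using CA subfunctionalD(2) by blast
    next
      fix f a assume "(f, a) \<in> \<Union>C"
      then show "f \<in> V" "a \<le> p f" using CA subfunctionalD(3,4) by blast+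
    qed
    then show ?thesis using C(1) CA unfolding A_def by blast
  qed
  moreover have "A \<noteq> {}" using G0 unfolding A_def by blast
  ultimately obtain G where G: "G \<in> A" "\<And>X. X \<in> A \<Longrightarrow> G \<subseteq> X \<Longrightarrow> X = G"
    using subset_Zorn_nonempty[of A] by blast
  have GA: "subfunctional V p G" "G0 \<subseteq> G" using G(1) unfolding A_def by auto
  have "fst ` G = V"
  proof
    show "fst ` G \<subseteq> V" using subfunctionalD(3)[OF GA(1)] by auto
    show "V \<subseteq> fst ` G"
    proof
      fix x assume "x \<in> V"
      moreover have "G \<noteq> {}" using GA(2) G0(2) by blast
      ultimately obtain G' where G': "subfunctional V p G'" "G \<subseteq> G'" "x \<in> fst ` G'"
        using subfunctional_extend[OF V p GA(1)] by blast
      then have "G' \<in> A" using GA(2) unfolding A_def by blast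
      then show "x \<in> fst ` G" using G(2) G' by blast
    qed
  qed
  then show ?thesis using GA by blast
qed

text \<open>A complex functional is determined by its real part \<open>u\<close> through S f = u(f)
  - i u(i f), so a real extension of Re T below \<open>p\<close> suffices. Turning \<open>f\<close>
  by a unimodular factor that makes \<open>S f\<close> real and nonnegative carries the bound over
  from \<open>u\<close> to \<open>cmod (S f)\<close>.\<close>

theorem hahn_banach_seminorm:
  assumes V: "cfun.subspace V" and p: "seminorm_on V p"
    and M: "cfun.subspace M" "M \<subseteq> V" and T: "linear_on M T"
    and bound: "\<And>f. f \<in> M \<Longrightarrow> cmod (T f) \<le> p f"
  shows "\<exists>S. linear_on V S \<and> (\<forall>f\<in>M. S f = T f) \<and> (\<forall>f\<in>V. cmod (S f) \<le> p f)"
proof -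
  define G0 where "G0 = {(f, Re (T f)) | f. f \<in> M}"
  have "subfunctional V p G0" unfolding subfunctional_def
  proof (intro conjI allI impI)
    fix f a g b assume "(f, a) \<in> G0 \<and> (g, b) \<in> G0"
    then show "(f + g, a + b) \<in> G0"
      unfolding G0_def using linear_onD(1)[OF T] cfun.subspace_add[OF M(1)] by auto
  next
    fix r f a assume "(f, a) \<in> G0"
    then show "(rscale r f, r * a) \<in> G0"
      unfolding G0_def using linear_onD(2)[OF T] cfun.subspace_scale[OF M(1)] by auto
  next
    fix f a assume "(f, a) \<in> G0"
    then have "f \<in> M" "a = Re (T f)" unfolding G0_def by auto
    then show "f \<in> V" "a \<le> p f"
      using M(2) order_trans[OF complex_Re_le_cmod bound[of f]] by auto
  qed
  moreover have "G0 \<noteq> {}" unfolding G0_def using cfun.subspace_0[OF M(1)] by blast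
  ultimately obtain G where G: "subfunctional V p G" "G0 \<subseteq> G" "fst ` G = V"
    using subfunctional_maximal[OF V p] by blast
  define u where "u f = (THE a. (f, a) \<in> G)" for f
  have uG: "(f, a) \<in> G \<longleftrightarrow> f \<in> V \<and> a = u f" for f a
  proof -
    have "(f, u f) \<in> G" if "f \<in> V"
    proof -
      have "f \<in> fst ` G" using that G(3) by simp
      then obtain b where b: "(f, b) \<in> G" by auto
      then have "u f = b" unfolding u_def using subfunctional_unique[OF V p G(1)] by blast
      then show ?thesis using b by simp
    qed
    then show ?thesis using subfunctional_unique[OF V p G(1)] subfunctionalD(3)[OF G(1)] by blast
  qed
  have u_add: "u (f + g) = u f + u g" if "f \<in> V" "g \<in> V" for f g
    using subfunctionalD(1)[OF G(1), of f "u f" g "u g"] that by (simp add: uG)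
  have u_scale: "u (rscale r f) = r * u f" if "f \<in> V" for r f
    using subfunctionalD(2)[OF G(1), of f "u f" r] that by (simp add: uG)
  have u_le: "u f \<le> p f" if "f \<in> V" for f
    using subfunctionalD(4)[OF G(1), of f "u f"] that by (simp add: uG)
  have u_T: "u f = Re (T f)" if "f \<in> M" for f
  proof -
    have "(f, Re (T f)) \<in> G" using G(2) that unfolding G0_def by auto
    then show ?thesis by (simp add: uG)
  qed
  have sV: "cscale c f \<in> V" if "f \<in> V" for c f using cfun.subspace_scale[OF V that] .
  define S where "S f = Complex (u f) (- u (cscale \<i> f))" for f
  have lin: "linear_on V S" unfolding linear_on_def
  proof (intro conjI ballI allI)
    fix f g assume fg: "f \<in> V" "g \<in> V"
    have "cscale \<i> (f + g) = cscale \<i> f + cscale \<i> g" by (auto simp: cscale_def algebra_simps)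
    then show "S (f + g) = S f + S g"
      unfolding S_def using u_add fg sV by (simp add: complex_eq_iff)
  next
    fix c f assume f: "f \<in> V"
    have "cscale c f = rscale (Re c) f + rscale (Im c) (cscale \<i> f)"
      by (auto simp: cscale_def fun_eq_iff complex_eq_iff algebra_simps)
    then have 1: "u (cscale c f) = Re c * u f + Im c * u (cscale \<i> f)"
      using u_add[of "rscale (Re c) f" "rscale (Im c) (cscale \<i> f)"] u_scale f sV by (simp del: cfun.scale_scale)
    have "cscale \<i> (cscale c f) = rscale (Re c) (cscale \<i> f) + rscale (- Im c) f"
      by (auto simp: cscale_def fun_eq_iff complex_eq_iff algebra_simps)
    then have 2: "u (cscale \<i> (cscale c f)) = Re c * u (cscale \<i> f) + - Im c * u f"
      unfolding u_scale[OF sV[OF f], symmetric] u_scale[OF f, symmetric]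
      by (simp only: u_add[OF sV[OF sV[OF f]] sV[OF f]])
    show "S (cscale c f) = c * S f"
      unfolding S_def 1 2 by (simp add: complex_eq_iff)
  qed
  have "cmod (S f) \<le> p f" if f: "f \<in> V" for f
  proof (cases "S f = 0")
    case True
    then show ?thesis using seminorm_onD(1)[OF p f] by simp
  next
    case False
    define c where "c = cnj (S f) / complex_of_real (cmod (S f))"
    have c: "cmod c = 1" using False by (simp add: c_def norm_divide)
    have "S (cscale c f) = c * S f" using linear_onD(2)[OF lin f] .
    also have "\<dots> = complex_of_real (cmod (S f))"
      using False complex_norm_square[of "S f"] unfolding c_def
      by (simp add: field_simps power2_eq_square)
    finally have "Re (S (cscale c f)) = cmod (S f)" by simp
    then have "cmod (S f) = u (cscale c f)" unfolding S_def by simp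
    also have "\<dots> \<le> p (cscale c f)" using u_le sV[OF f] .
    also have "\<dots> = p f" using seminorm_onD(3)[OF p f] c by simp
    finally show ?thesis .
  qed
  moreover have "S f = T f" if f: "f \<in> M" for f
    using u_T[OF f] u_T[OF cfun.subspace_scale[OF M(1) f], of \<i>] linear_onD(2)[OF T f, of \<i>]
    unfolding S_def by (simp add: complex_eq_iff)
  ultimately show ?thesis using lin by blast
qed

section \<open>Iterated partial derivatives\<close>

lemma partials_Nil [simp]: "partials [] f = f"
  and partials_Cons [simp]: "partials (i # is) f = partial i (partials is f)"
  and partials_append: "partials (js @ is) f = partials js (partials is f)"
  by (simp_all add: partials_def)

lemma smooth_partials: "smooth f \<Longrightarrow> smooth (partials js f)"
  unfolding smooth_def by (simp flip: partials_append)

lemma smooth_partial: "smooth f \<Longrightarrow> smooth (partial i f)"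
  using smooth_partials[of f "[i]"] by simp

lemma smooth_continuous: "smooth f \<Longrightarrow> continuous_on UNIV f"
  unfolding smooth_def by (metis partials_Nil)

text \<open>\<open>smooth\<close> speaks of the parameter 0 at each base point; moving the base
  point along the axis gives the derivative at every \<open>s\<close>, as mean value arguments
  require.\<close>

lemma has_vector_derivative_partial:
  assumes "smooth f"
  shows "((\<lambda>t. f (x + t *\<^sub>R axis i 1)) has_vector_derivative partial i f (x + s *\<^sub>R axis i 1)) (at s)"
proof -
  have "(\<lambda>t. partials [] f ((x + s *\<^sub>R axis i 1) + t *\<^sub>R axis i 1)) differentiable (at 0)"
    using assms unfolding smooth_def by blast
  then have "((\<lambda>t. f ((x + s *\<^sub>R axis i 1) + t *\<^sub>R axis i 1)) has_vector_derivative
      partial i f (x + s *\<^sub>R axis i 1)) (at (s - s))"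
    by (simp add: vector_derivative_works partial_def)
  moreover have "((\<lambda>t. t - s) has_vector_derivative 1) (at s)"
    by (auto intro!: derivative_eq_intros)
  ultimately have "((\<lambda>t. f ((x + s *\<^sub>R axis i 1) + t *\<^sub>R axis i 1)) \<circ> (\<lambda>t. t - s) has_vector_derivative
      1 *\<^sub>R partial i f (x + s *\<^sub>R axis i 1)) (at s)"
    by (intro vector_diff_chain_at) auto
  moreover have "(\<lambda>t. f ((x + s *\<^sub>R axis i 1) + t *\<^sub>R axis i 1)) \<circ> (\<lambda>t. t - s) = (\<lambda>t. f (x + t *\<^sub>R axis i 1))"
    by (auto simp: fun_eq_iff algebra_simps)
  ultimately show ?thesis by simp
qed

lemma has_vector_derivative_partial_0:
  "smooth f \<Longrightarrow> ((\<lambda>t. f (x + t *\<^sub>R axis i 1)) has_vector_derivative partial i f x) (at 0)"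
  using has_vector_derivative_partial[of f x i 0] by simp

text \<open>A family of continuous functions, indexed by lists and closed under differentiation, can
  only consist of the iterated partial derivatives of its first member. The rules for sums,
  multiples and reflections are read off from candidate families, and later so is the smoothness of
  a convolution.\<close>

lemma
  assumes nil: "d [] = g"
    and cont: "\<And>is. continuous_on UNIV (d is)"
    and der: "\<And>is i x. ((\<lambda>t. d is (x + t *\<^sub>R axis i 1)) has_vector_derivative d (i # is) x) (at 0)"
  shows partials_family: "partials is g = d is"
    and smooth_family: "smooth g"
proof -
  have *: "partials is g = d is" for "is"
  proof (induction "is")
    case (Cons i "is")
    then show ?case using vector_derivative_at[OF der] by (simp add: partial_def fun_eq_iff)
  qed (use nil in simp)
  then show "partials is g = d is" .
  show "smooth g"
    unfolding smooth_def * using cont der by (blast intro: differentiableI_vector)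
qed

lemma
  assumes "smooth f" "smooth g"
  shows partials_add: "partials is (f + g) = partials is f + partials is g"
    and smooth_add: "smooth (f + g)"
proof -
  let ?d = "\<lambda>is. partials is f + partials is g"
  have c: "continuous_on UNIV (?d is)" for "is"
    using smooth_continuous[OF smooth_partials[OF assms(1)]] smooth_continuous[OF smooth_partials[OF assms(2)]]
    by (simp add: plus_fun_def continuous_on_add)
  have d: "((\<lambda>t. ?d is (x + t *\<^sub>R axis i 1)) has_vector_derivative ?d (i # is) x) (at 0)" for "is" i x
    using has_vector_derivative_add[OF
      has_vector_derivative_partial_0[OF smooth_partials[OF assms(1), of "is"]]
      has_vector_derivative_partial_0[OF smooth_partials[OF assms(2), of "is"]]]
    by simp
  show "partials is (f + g) = ?d is" by (rule partials_family[of ?d, OF _ c d]) (simp add: plus_fun_def)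
  show "smooth (f + g)" by (rule smooth_family[of ?d, OF _ c d]) (simp add: plus_fun_def)
qed

lemma
  assumes "smooth f"
  shows partials_cscale: "partials is (cscale c f) = cscale c (partials is f)"
    and smooth_cscale: "smooth (cscale c f)"
proof -
  let ?d = "\<lambda>is. cscale c (partials is f)"
  have c: "continuous_on UNIV (?d is)" for "is"
    using smooth_continuous[OF smooth_partials[OF assms]]
    by (simp add: cscale_def continuous_on_mult_left)
  have d: "((\<lambda>t. ?d is (x + t *\<^sub>R axis i 1)) has_vector_derivative ?d (i # is) x) (at 0)" for "is" i x
    using has_vector_derivative_mult_right[OF
      has_vector_derivative_partial_0[OF smooth_partials[OF assms, of "is"]]]
    by (simp add: cscale_def)
  show "partials is (cscale c f) = ?d is" by (rule partials_family[of ?d, OF _ c d]) simp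
  show "smooth (cscale c f)" by (rule smooth_family[of ?d, OF _ c d]) simp
qed

lemma
  shows partials_zero: "partials is 0 = (0 :: real ^ 'n \<Rightarrow> complex)"
    and smooth_zero: "smooth (0 :: real ^ 'n \<Rightarrow> complex)"
proof -
  let ?d = "\<lambda>is::'n list. (0 :: real ^ 'n \<Rightarrow> complex)"
  have c: "continuous_on UNIV (?d is)" for "is" by (simp add: zero_fun_def)
  have d: "((\<lambda>t. ?d is (x + t *\<^sub>R axis i 1)) has_vector_derivative ?d (i # is) x) (at 0)" for "is" i x
    by simp
  show "partials is 0 = ?d is" by (rule partials_family[of ?d, OF _ c d]) (simp add: zero_fun_def)
  show "smooth (0 :: real ^ 'n \<Rightarrow> complex)" by (rule smooth_family[of ?d, OF _ c d]) (simp add: zero_fun_def)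
qed

lemma
  assumes "smooth f" "smooth g"
  shows partials_diff: "partials is (f - g) = partials is f - partials is g"
    and smooth_diff: "smooth (f - g)"
proof -
  have *: "h - k = h + cscale (- 1) k" for h k :: "real ^ 'n \<Rightarrow> complex" by (auto simp: cscale_def)
  show "partials is (f - g) = partials is f - partials is g"
    unfolding * partials_add[OF assms(1) smooth_cscale[OF assms(2)]] partials_cscale[OF assms(2)] ..
  show "smooth (f - g)" unfolding * using smooth_add[OF assms(1) smooth_cscale[OF assms(2)]] .
qed

lemma
  assumes "smooth f"
  shows partials_reflect: "partials is (\<lambda>y. f (a - y)) = (\<lambda>y. (- 1) ^ length is * partials is f (a - y))"
    and smooth_reflect: "smooth (\<lambda>y. f (a - y))"
proof -
  let ?d = "\<lambda>is y. (- 1) ^ length is * partials is f (a - y)"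
  have c: "continuous_on UNIV (?d is)" for "is"
    by (intro continuous_intros continuous_on_compose2[OF smooth_continuous[OF smooth_partials[OF assms]]]) auto
  have d: "((\<lambda>t. ?d is (x + t *\<^sub>R axis i 1)) has_vector_derivative ?d (i # is) x) (at 0)" for "is" i x
  proof -
    have "((\<lambda>t. - t) has_vector_derivative - 1) (at 0)"
      by (auto intro!: derivative_eq_intros)
    moreover have "((\<lambda>t. partials is f ((a - x) + t *\<^sub>R axis i 1)) has_vector_derivative
        partial i (partials is f) (a - x)) (at (- 0))"
      using has_vector_derivative_partial_0[OF smooth_partials[OF assms, of "is"]] by simp
    ultimately have "((\<lambda>t. partials is f ((a - x) + t *\<^sub>R axis i 1)) \<circ> (\<lambda>t. - t) has_vector_derivative
        (- 1) *\<^sub>R partial i (partials is f) (a - x)) (at 0)"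
      by (rule vector_diff_chain_at)
    moreover have "(\<lambda>t. partials is f ((a - x) + t *\<^sub>R axis i 1)) \<circ> (\<lambda>t. - t) =
        (\<lambda>t. partials is f (a - (x + t *\<^sub>R axis i 1)))"
      by (auto simp: fun_eq_iff algebra_simps)
    ultimately have "((\<lambda>t. (- 1) ^ length is * partials is f (a - (x + t *\<^sub>R axis i 1))) has_vector_derivative
        (- 1) ^ length is * ((- 1) *\<^sub>R partial i (partials is f) (a - x))) (at 0)"
      by (intro has_vector_derivative_mult_right) simp
    then show ?thesis by simp
  qed
  show "partials is (\<lambda>y. f (a - y)) = ?d is" by (rule partials_family[of ?d, OF _ c d]) simp
  show "smooth (\<lambda>y. f (a - y))" by (rule smooth_family[of ?d, OF _ c d]) simp
qed

lemma subspace_smooth: "cfun.subspace {f. smooth f}"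
  by (intro cfun.subspaceI) (auto simp: smooth_zero smooth_add smooth_cscale)

subsection \<open>Symmetry of mixed partial derivatives\<close>

text \<open>Both orders of mean values represent the same second difference, so the mixed derivatives
  agree at nearby points.\<close>

lemma second_difference_mean_value:
  fixes u v w :: "'a::real_normed_vector \<Rightarrow> real"
  assumes v: "\<And>x t. ((\<lambda>t. u (x + t *\<^sub>R a)) has_real_derivative v (x + t *\<^sub>R a)) (at t)"
    and w: "\<And>x t. ((\<lambda>t. v (x + t *\<^sub>R b)) has_real_derivative w (x + t *\<^sub>R b)) (at t)"
    and h: "0 < h"
  shows "\<exists>y. norm (y - x) \<le> h * (norm a + norm b) \<and>
    u (x + h *\<^sub>R a + h *\<^sub>R b) - u (x + h *\<^sub>R a) - u (x + h *\<^sub>R b) + u x = h * h * w y"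
proof -
  have "\<exists>s>0. s < h \<and> (u ((x + h *\<^sub>R b) + h *\<^sub>R a) - u (x + h *\<^sub>R a)) - (u ((x + h *\<^sub>R b) + 0 *\<^sub>R a) - u (x + 0 *\<^sub>R a))
      = (h - 0) * (v ((x + h *\<^sub>R b) + s *\<^sub>R a) - v (x + s *\<^sub>R a))"
    using h v by (intro MVT2[where f = "\<lambda>t. u ((x + h *\<^sub>R b) + t *\<^sub>R a) - u (x + t *\<^sub>R a)"] DERIV_diff) auto
  then obtain s where s: "0 < s" "s < h"
    "(u ((x + h *\<^sub>R b) + h *\<^sub>R a) - u (x + h *\<^sub>R a)) - (u (x + h *\<^sub>R b) - u x)
      = h * (v ((x + h *\<^sub>R b) + s *\<^sub>R a) - v (x + s *\<^sub>R a))"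
    by auto
  have "\<exists>t>0. t < h \<and> v ((x + s *\<^sub>R a) + h *\<^sub>R b) - v ((x + s *\<^sub>R a) + 0 *\<^sub>R b)
      = (h - 0) * w ((x + s *\<^sub>R a) + t *\<^sub>R b)"
    using h w by (intro MVT2[where f = "\<lambda>t. v ((x + s *\<^sub>R a) + t *\<^sub>R b)"]) auto
  then obtain t where t: "0 < t" "t < h"
    "v ((x + s *\<^sub>R a) + h *\<^sub>R b) - v (x + s *\<^sub>R a) = h * w ((x + s *\<^sub>R a) + t *\<^sub>R b)"
    by auto
  define y where "y = (x + s *\<^sub>R a) + t *\<^sub>R b"
  have "norm (y - x) = norm (s *\<^sub>R a + t *\<^sub>R b)" by (simp add: y_def)
  also have "\<dots> \<le> s * norm a + t * norm b"
    using norm_triangle_ineq[of "s *\<^sub>R a" "t *\<^sub>R b"] s t by simp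
  also have "\<dots> \<le> h * norm a + h * norm b"
    using s t by (intro add_mono mult_right_mono) auto
  finally have "norm (y - x) \<le> h * (norm a + norm b)" by (simp add: distrib_left)
  moreover have "u (x + h *\<^sub>R a + h *\<^sub>R b) - u (x + h *\<^sub>R a) - u (x + h *\<^sub>R b) + u x = h * h * w y"
  proof -
    have "(x + h *\<^sub>R b) + s *\<^sub>R a = (x + s *\<^sub>R a) + h *\<^sub>R b" "x + h *\<^sub>R a + h *\<^sub>R b = (x + h *\<^sub>R b) + h *\<^sub>R a"
      by (simp_all add: algebra_simps)
    then have e: "x + h *\<^sub>R a + h *\<^sub>R b = (x + h *\<^sub>R b) + h *\<^sub>R a"
      "v ((x + h *\<^sub>R b) + s *\<^sub>R a) = v ((x + s *\<^sub>R a) + h *\<^sub>R b)" by metis+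
    have "u (x + h *\<^sub>R a + h *\<^sub>R b) - u (x + h *\<^sub>R a) - u (x + h *\<^sub>R b) + u x =
        h * (v ((x + s *\<^sub>R a) + h *\<^sub>R b) - v (x + s *\<^sub>R a))"
      using s(3) unfolding e by simp
    then show ?thesis unfolding t(3) y_def by simp
  qed
  ultimately show ?thesis by blast
qed

lemma mixed_derivatives_eq:
  fixes u v1 v2 w1 w2 :: "'a::real_normed_vector \<Rightarrow> real"
  assumes v1: "\<And>x t. ((\<lambda>t. u (x + t *\<^sub>R a)) has_real_derivative v1 (x + t *\<^sub>R a)) (at t)"
    and w1: "\<And>x t. ((\<lambda>t. v1 (x + t *\<^sub>R b)) has_real_derivative w1 (x + t *\<^sub>R b)) (at t)"
    and v2: "\<And>x t. ((\<lambda>t. u (x + t *\<^sub>R b)) has_real_derivative v2 (x + t *\<^sub>R b)) (at t)"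
    and w2: "\<And>x t. ((\<lambda>t. v2 (x + t *\<^sub>R a)) has_real_derivative w2 (x + t *\<^sub>R a)) (at t)"
    and cont: "continuous_on UNIV w1" "continuous_on UNIV w2"
  shows "w1 x = w2 x"
proof -
  define c where "c = norm a + norm b"
  define h where "h n = 1 / real (Suc n)" for n
  have h: "0 < h n" for n by (simp add: h_def)
  have "\<exists>y z. norm (y - x) \<le> h n * c \<and> norm (z - x) \<le> h n * c \<and> w1 y = w2 z" for n
  proof -
    obtain y where y: "norm (y - x) \<le> h n * c"
      "u (x + h n *\<^sub>R a + h n *\<^sub>R b) - u (x + h n *\<^sub>R a) - u (x + h n *\<^sub>R b) + u x = h n * h n * w1 y"
      using second_difference_mean_value[OF v1 w1 h] unfolding c_def by blast
    obtain z where z: "norm (z - x) \<le> h n * (norm b + norm a)"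
      "u (x + h n *\<^sub>R b + h n *\<^sub>R a) - u (x + h n *\<^sub>R b) - u (x + h n *\<^sub>R a) + u x = h n * h n * w2 z"
      using second_difference_mean_value[OF v2 w2 h] by blast
    have "h n * h n * w1 y = h n * h n * w2 z"
      using y(2) z(2) by (simp add: algebra_simps)
    then have "w1 y = w2 z" using h[of n] by simp
    then show ?thesis using y(1) z(1) by (auto simp: c_def add.commute)
  qed
  then obtain y z where yz: "\<And>n. norm (y n - x) \<le> h n * c" "\<And>n. norm (z n - x) \<le> h n * c"
      "\<And>n. w1 (y n) = w2 (z n)" by metis
  have hc: "(\<lambda>n. h n * c) \<longlonglongrightarrow> 0"
    unfolding h_def using tendsto_mult_left_zero[OF LIMSEQ_inverse_real_of_nat, of c]
    by (simp add: inverse_eq_divide)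
  have "(\<lambda>n. y n - x) \<longlonglongrightarrow> 0" "(\<lambda>n. z n - x) \<longlonglongrightarrow> 0"
    using yz(1,2) by (auto intro!: tendsto_norm_zero_cancel[OF tendsto_sandwich[OF _ _ tendsto_const hc]])
  then have "y \<longlonglongrightarrow> x" "z \<longlonglongrightarrow> x" by (simp_all add: LIM_zero_iff)
  then have "(\<lambda>n. w1 (y n)) \<longlonglongrightarrow> w1 x" "(\<lambda>n. w2 (z n)) \<longlonglongrightarrow> w2 x"
    using cont by (auto intro: continuous_on_tendsto_compose)
  then show ?thesis using yz(3) LIMSEQ_unique by simp
qed

text \<open>The mean value theorem concerns real functions, so real and imaginary parts are treated
  separately.\<close>

lemma partial_commute:
  assumes f: "smooth f"
  shows "partial i (partial j f) = partial j (partial i f)"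
proof
  fix x
  have Re: "((\<lambda>t. Re (g (x + t *\<^sub>R axis k 1))) has_real_derivative Re (partial k g (x + t *\<^sub>R axis k 1))) (at t)"
    and Im: "((\<lambda>t. Im (g (x + t *\<^sub>R axis k 1))) has_real_derivative Im (partial k g (x + t *\<^sub>R axis k 1))) (at t)"
    if "smooth g" for g :: "real ^ 'a \<Rightarrow> complex" and k x t
    using has_vector_derivative_partial[OF that, of x k t]
    by (auto simp: has_vector_derivative_complex_iff)
  have s: "smooth (partial k f)" for k using smooth_partial[OF f] .
  have c: "continuous_on UNIV (partial k (partial l f))" for k l
    using smooth_continuous[OF smooth_partial[OF s]] .
  show "partial i (partial j f) x = partial j (partial i f) x"
  proof (rule complex_eqI)
    show "Re (partial i (partial j f) x) = Re (partial j (partial i f) x)"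
      by (rule mixed_derivatives_eq[OF Re[OF f] Re[OF s] Re[OF f] Re[OF s]]) (intro continuous_on_Re c)+
    show "Im (partial i (partial j f) x) = Im (partial j (partial i f) x)"
      by (rule mixed_derivatives_eq[OF Im[OF f] Im[OF s] Im[OF f] Im[OF s]]) (intro continuous_on_Im c)+
  qed
qed

lemma partials_partial:
  assumes "smooth f"
  shows "partials is (partial j f) = partial j (partials is f)"
  by (induction "is") (simp_all add: partial_commute[OF smooth_partials[OF assms]])

lemma partials_cong_mset:
  assumes "smooth f" "mset is = mset js"
  shows "partials is f = partials js f"
  using assms(2)
proof (induction "is" arbitrary: js)
  case (Cons i "is")
  then have "i \<in> set js" by (metis list.set_intros(1) mset_eq_setD)
  then obtain ks ls where js: "js = ks @ i # ls" by (meson split_list)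
  have "partials js f = partial i (partials (ks @ ls) f)"
    unfolding js by (simp add: partials_append partials_partial[OF smooth_partials[OF assms(1)]])
  also have "partials (ks @ ls) f = partials is f"
    using Cons.IH[of "ks @ ls"] Cons.prems unfolding js by simp
  finally show ?case by simp
qed simp

lemma mset_eq_iff_count_list: "mset xs = mset ys \<longleftrightarrow> (\<forall>x. count_list xs x = count_list ys x)"
  by (simp add: multiset_eq_iff count_mset)

text \<open>\<open>mderiv\<close> uses an unspecified list with the right counts; symmetry of mixed
  derivatives allows any such list. Suprema over multi-indices thus become statements about all
  lists, which simply concatenate when derivatives are iterated.\<close>

lemma mderiv_count_list:
  assumes "smooth f"
  shows "mderiv (count_list is) f = partials is f"
  unfolding mderiv_def
  by (rule partials_cong_mset[OF assms], subst mset_eq_iff_count_list) (rule someI[of _ "is"], simp)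

lemma mi_order_count_list: "mi_order (count_list is) = length is"
  unfolding mi_order_def by (simp add: sum_count_set)

lemma ex_count_list:
  fixes \<alpha> :: "'n::finite \<Rightarrow> nat"
  shows "\<exists>is. \<alpha> = count_list is"
proof -
  obtain xs where "mset xs = Abs_multiset \<alpha>" using ex_mset by blast
  then have "count (mset xs) = \<alpha>" by simp
  then show ?thesis by (intro exI[of _ xs]) (simp add: count_mset fun_eq_iff)
qed

lemma all_mi_iff: "(\<forall>\<alpha>::'n::finite \<Rightarrow> nat. Q \<alpha>) \<longleftrightarrow> (\<forall>is. Q (count_list is))"
  using ex_count_list by metis

subsection \<open>Mean value estimates\<close>

text \<open>Openness makes the claim local: around each point of \<open>U\<close> the function
  vanishes on a piece of every axis line, so each further derivative vanishes on \<open>U\<close>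
  again.\<close>

lemma partials_outside:
  assumes "open U" "\<And>x. x \<in> U \<Longrightarrow> f x = 0" "x \<in> U"
  shows "partials is f x = 0"
  using assms(3)
proof (induction "is" arbitrary: x)
  case (Cons i "is")
  have "open ((\<lambda>t::real. x + t *\<^sub>R axis i 1) -` U)"
    by (intro open_vimage assms(1) continuous_intros)
  then have "((\<lambda>t. partials is f (x + t *\<^sub>R axis i 1)) has_vector_derivative 0) (at 0)"
  proof (rule has_vector_derivative_transform_within_open[rotated])
    show "((\<lambda>t::real. 0) has_vector_derivative (0::complex)) (at 0)" by simp
    show "0 = partials is f (x + t *\<^sub>R axis i 1)" if "t \<in> (\<lambda>t. x + t *\<^sub>R axis i 1) -` U" for t
      using Cons.IH that by simp
  qed (use Cons.prems in simp_all)
  then show ?case by (simp add: partial_def vector_derivative_at)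
qed (use assms in simp)

lemma vector_derivative_bound:
  fixes g :: "real \<Rightarrow> complex"
  assumes d: "\<And>s. (g has_vector_derivative g' s) (at s)"
    and M: "\<And>s. \<bar>s\<bar> \<le> \<bar>t\<bar> \<Longrightarrow> cmod (g' s) \<le> M"
  shows "cmod (g t - g 0) \<le> M * \<bar>t\<bar>"
proof -
  have "norm (g t - g 0) \<le> M * norm (t - 0)"
  proof (rule differentiable_bound[of "cball 0 \<bar>t\<bar>"])
    fix s :: real assume s: "s \<in> cball 0 \<bar>t\<bar>"
    show "(g has_derivative (\<lambda>h. h *\<^sub>R g' s)) (at s within cball 0 \<bar>t\<bar>)"
      using d[of s] unfolding has_vector_derivative_def by (rule has_derivative_at_withinI)
    show "onorm (\<lambda>h. h *\<^sub>R g' s) \<le> M"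
    proof (rule onorm_le)
      fix h :: real
      show "norm (h *\<^sub>R g' s) \<le> M * norm h"
        using mult_right_mono[OF M[of s], of "\<bar>h\<bar>"] s by (simp add: mult.commute[of "\<bar>h\<bar>"])
    qed
  qed auto
  then show ?thesis by simp
qed

text \<open>The coordinates of \<open>x\<close> are replaced by those of \<open>y\<close> one at a
  time, each replacement being a one-dimensional mean value estimate. Every point met on the way
  differs from \<open>x\<close> in each coordinate by at most as much as \<open>y\<close> does, so
  it stays in the ball where \<open>bound\<close> holds. The hypotheses mention only derivatives
  along axes because this estimate is the source of continuity for convolutions.\<close>

lemma lipschitz_of_bounded_partials:
  fixes u :: "real ^ 'n \<Rightarrow> complex" and M :: real
  assumes d: "\<And>z i. ((\<lambda>t. u (z + t *\<^sub>R axis i 1)) has_vector_derivative d i z) (at 0)"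
    and bound: "\<And>z i. norm (z - x) \<le> norm (y - x) \<Longrightarrow> cmod (d i z) \<le> M"
  shows "cmod (u y - u x) \<le> CARD('n) * M * norm (y - x)"
proof -
  have D: "((\<lambda>t. u (z + t *\<^sub>R axis i 1)) has_vector_derivative d i (z + s *\<^sub>R axis i 1)) (at s)" for z i s
  proof -
    have "((\<lambda>t. t - s) has_vector_derivative 1) (at s)" by (auto intro!: derivative_eq_intros)
    moreover have "((\<lambda>t. u ((z + s *\<^sub>R axis i 1) + t *\<^sub>R axis i 1)) has_vector_derivative
        d i (z + s *\<^sub>R axis i 1)) (at (s - s))" using d by simp
    ultimately have "((\<lambda>t. u ((z + s *\<^sub>R axis i 1) + t *\<^sub>R axis i 1)) \<circ> (\<lambda>t. t - s) has_vector_derivative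
        1 *\<^sub>R d i (z + s *\<^sub>R axis i 1)) (at s)"
      by (rule vector_diff_chain_at)
    moreover have "(\<lambda>t. u ((z + s *\<^sub>R axis i 1) + t *\<^sub>R axis i 1)) \<circ> (\<lambda>t. t - s) = (\<lambda>t. u (z + t *\<^sub>R axis i 1))"
      by (auto simp: fun_eq_iff algebra_simps)
    ultimately show ?thesis by simp
  qed
  have "cmod (u z - u x) \<le> card J * M * norm (y - x)"
    if "finite J" "\<And>i. z $ i = (if i \<in> J then y $ i else x $ i)" for J z
    using that
  proof (induction J arbitrary: z)
    case empty
    then have "z = x" by (simp add: vec_eq_iff)
    then show ?case by simp
  next
    case (insert j J)
    define z' where "z' = (\<chi> i. if i \<in> J then y $ i else x $ i)"
    have IH: "cmod (u z' - u x) \<le> card J * M * norm (y - x)"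
      by (rule insert.IH) (simp add: z'_def)
    define a where "a = y $ j - x $ j"
    have z: "z = z' + a *\<^sub>R axis j 1"
      using insert by (auto simp: vec_eq_iff z'_def a_def axis_def)
    have a: "\<bar>a\<bar> \<le> norm (y - x)"
      using component_le_norm_cart[of "y - x" j] by (simp add: a_def)
    have "cmod (d j (z' + s *\<^sub>R axis j 1)) \<le> M" if s: "\<bar>s\<bar> \<le> \<bar>a\<bar>" for s
    proof (rule bound)
      have "\<bar>(z' + s *\<^sub>R axis j 1 - x) $ i\<bar> \<le> \<bar>(y - x) $ i\<bar>" for i
        using insert.hyps(2) s by (auto simp: z'_def axis_def a_def)
      then show "norm (z' + s *\<^sub>R axis j 1 - x) \<le> norm (y - x)"
        unfolding norm_vec_def by (intro L2_set_mono) auto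
    qed
    from vector_derivative_bound[OF D this]
    have step: "cmod (u z - u z') \<le> M * \<bar>a\<bar>" by (simp add: z)
    have "0 \<le> M" using order_trans[OF norm_ge_zero bound[of x]] by simp
    then have "M * \<bar>a\<bar> \<le> M * norm (y - x)" using a by (rule mult_left_mono[rotated])
    moreover have "cmod (u z - u x) \<le> cmod (u z - u z') + cmod (u z' - u x)"
      using norm_triangle_ineq[of "u z - u z'" "u z' - u x"] by simp
    ultimately have "cmod (u z - u x) \<le> M * norm (y - x) + card J * M * norm (y - x)"
      using step IH by linarith
    also have "\<dots> = card (insert j J) * M * norm (y - x)"
      using insert.hyps by (simp add: algebra_simps)
    finally show ?case .
  qed
  from this[of UNIV y] show ?thesis by simp
qed

section \<open>Ultradifferentiable bounds\<close>

locale ultra_weight =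
  fixes \<omega> :: "real \<Rightarrow> real"
  assumes weight: "weight_function \<omega>"
    and ln_smallo: "(\<lambda>t. ln (1 + t)) \<in> o[at_top](\<omega>)"
begin

lemma weight_nonneg: "0 \<le> t \<Longrightarrow> 0 \<le> \<omega> t"
  using weight unfolding weight_function_def by blast

lemma weight_mono: "0 \<le> s \<Longrightarrow> s \<le> t \<Longrightarrow> \<omega> s \<le> \<omega> t"
  using weight unfolding weight_function_def mono_on_def by (meson atLeast_iff order_trans)

text \<open>Since s + t is at most twice the larger argument, the doubling condition applies. The
  constant is taken natural so that its product with \<open>n\<close> is again an index of the
  spaces.\<close>

lemma weight_add_bound: "\<exists>k::nat. (1::nat) \<le> k \<and> (\<forall>s\<ge>0. \<forall>t\<ge>0. \<omega> (s + t) \<le> k * (1 + \<omega> s + \<omega> t))"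
proof -
  obtain K where K: "1 \<le> K" "\<And>t. 0 \<le> t \<Longrightarrow> \<omega> (2 * t) \<le> K * (1 + \<omega> t)"
    using weight unfolding weight_function_def by blast
  obtain k :: nat where k: "K \<le> k" using real_arch_simple by blast
  have "\<omega> (s + t) \<le> k * (1 + \<omega> s + \<omega> t)" if st: "0 \<le> s" "0 \<le> t" for s t
  proof -
    have "\<omega> (s + t) \<le> \<omega> (2 * max s t)" using st by (intro weight_mono) auto
    also have "\<dots> \<le> K * (1 + \<omega> (max s t))" using K(2) st by simp
    also have "\<dots> \<le> k * (1 + \<omega> s + \<omega> t)"
    proof (rule mult_mono)
      show "1 + \<omega> (max s t) \<le> 1 + \<omega> s + \<omega> t" "0 \<le> 1 + \<omega> (max s t)"
        using weight_nonneg[OF st(1)] weight_nonneg[OF st(2)] by (auto simp: max_def)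
    qed (use k K(1) in auto)
    finally show ?thesis .
  qed
  moreover have "(1::nat) \<le> k" using K(1) k by simp
  ultimately show ?thesis by (intro exI[of _ k]) auto
qed

definition \<kappa> :: nat where
  "\<kappa> = (SOME k::nat. (1::nat) \<le> k \<and> (\<forall>s\<ge>0. \<forall>t\<ge>0. \<omega> (s + t) \<le> k * (1 + \<omega> s + \<omega> t)))"

lemma kappa_ge_1: "1 \<le> \<kappa>"
  and weight_add: "0 \<le> s \<Longrightarrow> 0 \<le> t \<Longrightarrow> \<omega> (s + t) \<le> \<kappa> * (1 + \<omega> s + \<omega> t)"
proof -
  have "(1::nat) \<le> \<kappa> \<and> (\<forall>s\<ge>0. \<forall>t\<ge>0. \<omega> (s + t) \<le> \<kappa> * (1 + \<omega> s + \<omega> t))"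
    unfolding \<kappa>_def by (rule someI_ex[OF weight_add_bound])
  then show "1 \<le> \<kappa>" "0 \<le> s \<Longrightarrow> 0 \<le> t \<Longrightarrow> \<omega> (s + t) \<le> \<kappa> * (1 + \<omega> s + \<omega> t)" by auto
qed

text \<open>At e^t the growth condition reads t \<le> log(1 + e^t) \<le> \<epsilon> \<omega>(e^t)
  for large t, so any positive multiple of \<omega>(e^t) beats every linear function. This is
  finiteness of the Young conjugate.\<close>

lemma linear_minus_weight_bounded:
  assumes "0 \<le> k" "0 < m"
  shows "\<exists>c. \<forall>t\<ge>0. k * t - m * \<omega> (exp t) \<le> c"
proof -
  \<comment> \<open>Dividing by \<open>k + 1\<close> instead of \<open>k\<close> covers
    \<open>k = 0\<close> as well.\<close>
  have "eventually (\<lambda>t. norm (ln (1 + t)) \<le> m / (k + 1) * norm (\<omega> t)) at_top"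
    using assms by (intro landau_o.smallD[OF ln_smallo]) auto
  then obtain u where u: "\<And>t. u \<le> t \<Longrightarrow> norm (ln (1 + t)) \<le> m / (k + 1) * norm (\<omega> t)"
    unfolding eventually_at_top_linorder by blast
  have "k * t - m * \<omega> (exp t) \<le> k * max u 0" if t: "0 \<le> t" for t
  proof (cases "u \<le> exp t")
    case True
    have "0 \<le> ln (1 + exp t)" "t \<le> ln (1 + exp t)"
      using t add_pos_pos[OF zero_less_one exp_gt_zero, of t] by (simp_all add: ln_ge_iff)
    moreover have "ln (1 + exp t) \<le> m / (k + 1) * \<omega> (exp t)"
      using u[OF True] weight_nonneg[of "exp t"] by simp
    ultimately have "(k + 1) * t \<le> (k + 1) * (m / (k + 1) * \<omega> (exp t))"
      using assms by (intro mult_left_mono) auto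
    then have "(k + 1) * t \<le> m * \<omega> (exp t)" using assms by simp
    moreover have "k * t \<le> (k + 1) * t" using t by (simp add: mult_right_mono)
    moreover have "0 \<le> k * max u 0" using assms by simp
    ultimately show ?thesis by linarith
  next
    case False
    then have "t \<le> max u 0" using exp_ge_add_one_self[of t] by linarith
    then have "k * t \<le> k * max u 0" using assms by (intro mult_left_mono) auto
    moreover have "0 \<le> m * \<omega> (exp t)" using assms weight_nonneg[of "exp t"] by simp
    ultimately show ?thesis by linarith
  qed
  then show ?thesis by blast
qed

text \<open>\<open>Phi m |\<alpha>|\<close> is the exponent \<open>m \<phi>\<^sup>*(|\<alpha>|/m)\<close>, finite because \<open>ln (1 + t) = o(\<omega>)\<close>;
  the bounds \<open>bnd m n C f\<close> and \<open>pbnd K m C f\<close> below say \<open>r\<^bsub>m,n\<^esub>(f) \<le> C\<close> and \<open>p\<^bsub>K,m\<^esub>(f) \<le> C\<close>.\<close>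

definition Phi :: "nat \<Rightarrow> nat \<Rightarrow> real" where
  "Phi m k = real m * real_of_ereal (young_conj \<omega> (real k / real m))"

text \<open>Bounded above by the growth of \<omega> and below by the value at t = 0, the conjugate
  is a real number.\<close>

lemma young_conj_Phi:
  assumes m: "1 \<le> m"
  shows "ereal (real m) * young_conj \<omega> (real k / real m) = ereal (Phi m k)"
proof -
  let ?s = "real k / real m"
  obtain c where c: "\<And>t. 0 \<le> t \<Longrightarrow> ?s * t - 1 * \<omega> (exp t) \<le> c"
    using linear_minus_weight_bounded[of ?s 1] m by auto
  have le: "young_conj \<omega> ?s \<le> ereal c"
    unfolding young_conj_def by (rule SUP_least) (use c in auto)
  have ge: "ereal (?s * 0 - \<omega> (exp 0)) \<le> young_conj \<omega> ?s"
    unfolding young_conj_def by (rule SUP_upper) simp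
  have "\<bar>young_conj \<omega> ?s\<bar> \<noteq> \<infinity>" using le ge by auto
  then have "young_conj \<omega> ?s = ereal (real_of_ereal (young_conj \<omega> ?s))"
    by (simp add: ereal_real)
  then show ?thesis unfolding Phi_def by (metis times_ereal.simps(1))
qed

text \<open>Multiplying the conjugate by \<open>m\<close> cancels the division of \<open>k\<close>
  by \<open>m\<close>: \<open>Phi m k\<close> is the supremum of
  \<open>k * t - m * \<omega> (exp t)\<close> over t \<ge> 0. Monotonicity in \<open>m\<close> and
  the splitting of derivative counts both follow from this description.\<close>

lemma Phi_upper:
  assumes m: "1 \<le> m" and t: "0 \<le> t"
  shows "real k * t - real m * \<omega> (exp t) \<le> Phi m k"
proof -
  have "ereal (real k / real m * t - \<omega> (exp t)) \<le> young_conj \<omega> (real k / real m)"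
    unfolding young_conj_def by (rule SUP_upper) (use t in simp)
  then have "ereal (real m) * ereal (real k / real m * t - \<omega> (exp t)) \<le> ereal (Phi m k)"
    unfolding young_conj_Phi[OF m, symmetric] by (intro ereal_mult_left_mono) auto
  then show ?thesis using m by (simp add: right_diff_distrib)
qed

lemma Phi_least:
  assumes m: "1 \<le> m" and c: "\<And>t. 0 \<le> t \<Longrightarrow> real k * t - real m * \<omega> (exp t) \<le> c"
  shows "Phi m k \<le> c"
proof -
  have "real k / real m * t - \<omega> (exp t) \<le> c / real m" if "0 \<le> t" for t
    using divide_right_mono[OF c[OF that], of "real m"] m by (simp add: diff_divide_distrib)
  then have "young_conj \<omega> (real k / real m) \<le> ereal (c / real m)"
    unfolding young_conj_def by (intro SUP_least) auto
  then have "ereal (Phi m k) \<le> ereal (real m) * ereal (c / real m)"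
    unfolding young_conj_Phi[OF m, symmetric] by (intro ereal_mult_left_mono) auto
  then show ?thesis using m by simp
qed

lemma Phi_antimono:
  assumes "1 \<le> m" "m \<le> m'"
  shows "Phi m' k \<le> Phi m k"
proof (rule Phi_least)
  fix t :: real assume t: "0 \<le> t"
  have "real m * \<omega> (exp t) \<le> real m' * \<omega> (exp t)"
    using assms weight_nonneg[of "exp t"] by (intro mult_right_mono) auto
  then show "real k * t - real m' * \<omega> (exp t) \<le> Phi m k"
    using Phi_upper[OF assms(1) t, of k] by linarith
qed (use assms in simp)

text \<open>At one and the same t the expression for \<open>j + k\<close> with weight
  \<open>2 * m\<close> is the sum of those for \<open>j\<close> and \<open>k\<close> with weight
  \<open>m\<close>.\<close>

lemma Phi_double_add:
  assumes "1 \<le> m"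
  shows "Phi (2 * m) (j + k) \<le> Phi m j + Phi m k"
proof (rule Phi_least)
  fix t :: real assume t: "0 \<le> t"
  show "real (j + k) * t - real (2 * m) * \<omega> (exp t) \<le> Phi m j + Phi m k"
    using Phi_upper[OF assms t, of j] Phi_upper[OF assms t, of k] by (simp add: algebra_simps)
qed (use assms in simp)

definition bnd :: "nat \<Rightarrow> nat \<Rightarrow> real \<Rightarrow> (real ^ 'n \<Rightarrow> complex) \<Rightarrow> bool" where
  "bnd m n C f \<longleftrightarrow>
     (\<forall>is x. cmod (partials is f x) \<le> C * exp (real n * \<omega> (norm x) + Phi m (length is)))"

lemma bndD:
  "bnd m n C f \<Longrightarrow> cmod (partials is f x) \<le> C * exp (real n * \<omega> (norm x) + Phi m (length is))"
  unfolding bnd_def by blast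

lemma mult_exp_minus_le_iff: "a * exp (- b) \<le> C \<longleftrightarrow> a \<le> C * exp (b::real)"
  by (simp add: exp_minus field_simps)

lemma r_norm_le_iff:
  fixes f :: "real ^ 'n \<Rightarrow> complex"
  assumes "1 \<le> m" "smooth f" "0 \<le> C"
  shows "r_norm \<omega> m n f \<le> ennreal C \<longleftrightarrow> bnd m n C f"
  unfolding r_norm_def SUP_le_iff bnd_def using assms
  by (simp add: all_mi_iff[where 'n = 'n] mderiv_count_list mi_order_count_list young_conj_Phi exp_neg_def
      mult_exp_minus_le_iff del: minus_add_distrib)

definition pbnd :: "(real ^ 'n) set \<Rightarrow> nat \<Rightarrow> real \<Rightarrow> (real ^ 'n \<Rightarrow> complex) \<Rightarrow> bool" where
  "pbnd K m C f \<longleftrightarrow> (\<forall>is. \<forall>x\<in>K. cmod (partials is f x) \<le> C * exp (Phi m (length is)))"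

lemma p_norm_le_iff:
  fixes f :: "real ^ 'n \<Rightarrow> complex"
  assumes "1 \<le> m" "smooth f" "0 \<le> C"
  shows "p_norm \<omega> K m f \<le> ennreal C \<longleftrightarrow> pbnd K m C f"
  unfolding p_norm_def SUP_le_iff pbnd_def using assms
  by (auto simp: all_mi_iff[where 'n = 'n] mderiv_count_list mi_order_count_list young_conj_Phi exp_neg_def
      mult_exp_minus_le_iff)

lemma bnd_add:
  assumes "smooth f" "smooth g" "bnd m n C f" "bnd m n D g"
  shows "bnd m n (C + D) (f + g)"
  unfolding bnd_def
proof (intro allI)
  fix "is" x
  have "cmod (partials is f x + partials is g x) \<le> cmod (partials is f x) + cmod (partials is g x)"
    by (rule norm_triangle_ineq)
  then show "cmod (partials is (f + g) x) \<le> (C + D) * exp (real n * \<omega> (norm x) + Phi m (length is))"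
    using bndD[OF assms(3), of "is" x] bndD[OF assms(4), of "is" x]
    by (simp add: partials_add[OF assms(1,2)] distrib_right)
qed

lemma bnd_cscale:
  assumes "smooth f" "bnd m n C f"
  shows "bnd m n (cmod c * C) (cscale c f)"
  using bndD[OF assms(2)] unfolding bnd_def partials_cscale[OF assms(1)]
  by (simp add: cscale_def norm_mult mult.assoc mult_left_mono)

lemma bnd_zero: "bnd m n 0 0"
  unfolding bnd_def by (simp add: partials_zero)

lemma pbnd_add:
  assumes "smooth f" "smooth g" "pbnd K m C f" "pbnd K m D g"
  shows "pbnd K m (C + D) (f + g)"
  unfolding pbnd_def
proof (intro allI ballI)
  fix "is" x assume x: "x \<in> K"
  have "cmod (partials is f x + partials is g x) \<le> cmod (partials is f x) + cmod (partials is g x)"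
    by (rule norm_triangle_ineq)
  also have "\<dots> \<le> C * exp (Phi m (length is)) + D * exp (Phi m (length is))"
    using assms(3,4) x unfolding pbnd_def by (intro add_mono) auto
  finally show "cmod (partials is (f + g) x) \<le> (C + D) * exp (Phi m (length is))"
    by (simp add: partials_add[OF assms(1,2)] distrib_right)
qed

lemma pbnd_cscale:
  assumes "smooth f" "pbnd K m C f"
  shows "pbnd K m (cmod c * C) (cscale c f)"
  using assms(2) unfolding pbnd_def partials_cscale[OF assms(1)]
  by (simp add: cscale_def norm_mult mult.assoc mult_left_mono)

lemma pbnd_zero: "pbnd K m 0 0"
  unfolding pbnd_def by (simp add: partials_zero)

section \<open>The normed steps and the effect of derivatives and reflected translations\<close>

definition S :: "nat \<Rightarrow> nat \<Rightarrow> (real ^ 'n \<Rightarrow> complex) set" where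
  "S m n = {f. smooth f \<and> r_norm \<omega> m n f < \<infinity>}"

definition \<rho> :: "nat \<Rightarrow> nat \<Rightarrow> (real ^ 'n \<Rightarrow> complex) \<Rightarrow> real" where
  "\<rho> m n f = enn2real (r_norm \<omega> m n f)"

lemma S_smooth: "f \<in> S m n \<Longrightarrow> smooth f"
  unfolding S_def by blast

lemma rho_nonneg: "0 \<le> \<rho> m n f"
  unfolding \<rho>_def by simp

lemma
  assumes m: "1 \<le> m"
  shows subspace_S: "cfun.subspace (S m n :: (real ^ 'n \<Rightarrow> complex) set)"
    and seminorm_on_rho: "seminorm_on (S m n) (\<rho> m n :: (real ^ 'n \<Rightarrow> complex) \<Rightarrow> real)"
    and rho_bound: "\<And>f :: real ^ 'n \<Rightarrow> complex. f \<in> S m n \<Longrightarrow> bnd m n (\<rho> m n f) f"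
    and rho_least: "\<And>(f :: real ^ 'n \<Rightarrow> complex) C. smooth f \<Longrightarrow> 0 \<le> C \<Longrightarrow> bnd m n C f \<Longrightarrow>
      f \<in> S m n \<and> \<rho> m n f \<le> C"
proof -
  have iff: "r_norm \<omega> m n f \<le> ennreal C \<longleftrightarrow> bnd m n C f"
    if "f \<in> {f. smooth f}" "0 \<le> C" for f :: "real ^ 'n \<Rightarrow> complex" and C
    using r_norm_le_iff[OF m _ that(2)] that(1) by simp
  have add: "bnd m n (C + D) (f + g)"
    if "f \<in> {f. smooth f}" "g \<in> {f. smooth f}" "bnd m n C f" "bnd m n D g"
    for f g :: "real ^ 'n \<Rightarrow> complex" and C D
    using bnd_add that by simp
  have scale: "bnd m n (cmod c * C) (cscale c f)" if "f \<in> {f. smooth f}" "bnd m n C f"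
    for f :: "real ^ 'n \<Rightarrow> complex" and C c
    using bnd_cscale that by simp
  have S: "S m n = {f \<in> {f. smooth f}. r_norm \<omega> m n f < \<infinity>}" by (auto simp: S_def)
  note * = subspace_smooth iff bnd_zero add scale
  show "cfun.subspace (S m n :: (real ^ 'n \<Rightarrow> complex) set)" unfolding S
    by (rule subspace_gauge[where Bd = "bnd m n"]) (fact *)+
  show "seminorm_on (S m n) (\<rho> m n :: (real ^ 'n \<Rightarrow> complex) \<Rightarrow> real)" unfolding S \<rho>_def
    by (rule seminorm_on_gauge[where Bd = "bnd m n"]) (fact *)+
  show "bnd m n (\<rho> m n f) f" if "f \<in> S m n" for f :: "real ^ 'n \<Rightarrow> complex"
    using that unfolding S \<rho>_def by (rule gauge_bound[where Bd = "bnd m n", rotated -1]) (fact *)+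
  show "f \<in> S m n \<and> \<rho> m n f \<le> C" if "smooth f" "0 \<le> C" "bnd m n C f"
    for f :: "real ^ 'n \<Rightarrow> complex" and C
    using gauge_least[where Bd = "bnd m n" and N = "r_norm \<omega> m n", OF * _ that(2,3)] that(1)
    unfolding S \<rho>_def by blast
qed

lemma bnd_mono:
  fixes f :: "real ^ 'n \<Rightarrow> complex"
  assumes "bnd m' n C f" "1 \<le> m" "m \<le> m'" "n \<le> n'" "0 \<le> C"
  shows "bnd m n' C f"
  unfolding bnd_def
proof (intro allI)
  fix "is" :: "'n list" and x :: "real ^ 'n"
  have "real n * \<omega> (norm x) + Phi m' (length is) \<le> real n' * \<omega> (norm x) + Phi m (length is)"
    using assms Phi_antimono weight_nonneg[of "norm x"] by (intro add_mono mult_right_mono) auto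
  then have "C * exp (real n * \<omega> (norm x) + Phi m' (length is)) \<le> C * exp (real n' * \<omega> (norm x) + Phi m (length is))"
    using assms(5) by (intro mult_left_mono) auto
  then show "cmod (partials is f x) \<le> C * exp (real n' * \<omega> (norm x) + Phi m (length is))"
    using bndD[OF assms(1), of "is" x] by linarith
qed

lemma rho_mono:
  assumes "f \<in> S m' n" "1 \<le> m" "m \<le> m'" "n \<le> n'"
  shows "f \<in> S m n'" "\<rho> m n' f \<le> \<rho> m' n f"
proof -
  have "bnd m' n (\<rho> m' n f) f" using rho_bound[OF le_trans[OF assms(2,3)] assms(1)] .
  then have "bnd m n' (\<rho> m' n f) f" using bnd_mono assms rho_nonneg by blast
  from rho_least[OF assms(2) S_smooth[OF assms(1)] rho_nonneg this]
  show "f \<in> S m n'" "\<rho> m n' f \<le> \<rho> m' n f" by blast+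
qed

lemma bnd_partials:
  assumes "bnd (2 * m) n C f" "1 \<le> m" "0 \<le> C"
  shows "bnd m n (C * exp (Phi m (length js))) (partials js f)"
  unfolding bnd_def
proof (intro allI)
  fix "is" x
  have "cmod (partials is (partials js f) x) \<le> C * exp (real n * \<omega> (norm x) + Phi (2 * m) (length (is @ js)))"
    using bndD[OF assms(1), of "is @ js" x] by (simp only: partials_append)
  also have "\<dots> \<le> C * exp (real n * \<omega> (norm x) + (Phi m (length is) + Phi m (length js)))"
    using Phi_double_add[OF assms(2)] assms(3) by (intro mult_left_mono) auto
  finally show "cmod (partials is (partials js f) x)
      \<le> C * exp (Phi m (length js)) * exp (real n * \<omega> (norm x) + Phi m (length is))"
    by (simp add: exp_add mult_ac)
qed

text \<open>\<omega> is subadditive only up to a factor and a constant, so the growth index passes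
  from \<open>n\<close> to \<open>n * \<kappa>\<close>, and everything depending on \<open>a\<close>
  goes into the constant.\<close>

lemma weight_norm_add_le:
  assumes "norm z \<le> a + norm y" "0 \<le> a"
  shows "real n * \<omega> (norm z) \<le> real (n * \<kappa>) * (1 + \<omega> a) + real (n * \<kappa>) * \<omega> (norm y)"
proof -
  have "\<omega> (norm z) \<le> \<omega> (a + norm y)" using assms by (intro weight_mono) auto
  also have "\<dots> \<le> \<kappa> * (1 + \<omega> a + \<omega> (norm y))" using weight_add assms(2) by simp
  finally have "real n * \<omega> (norm z) \<le> real n * (\<kappa> * (1 + \<omega> a + \<omega> (norm y)))"
    by (intro mult_left_mono) auto
  then show ?thesis by (simp add: algebra_simps)
qed

lemma bnd_reflect:
  assumes "smooth g" "bnd m n C g" "0 \<le> C"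
  shows "bnd m (n * \<kappa>) (C * exp (real (n * \<kappa>) * (1 + \<omega> (norm a)))) (\<lambda>y. g (a - y))"
  unfolding bnd_def
proof (intro allI)
  fix "is" y
  have "cmod (partials is (\<lambda>y. g (a - y)) y) = cmod (partials is g (a - y))"
    by (simp add: partials_reflect[OF assms(1)] norm_mult norm_power)
  also have "\<dots> \<le> C * exp (real n * \<omega> (norm (a - y)) + Phi m (length is))"
    by (rule bndD[OF assms(2)])
  also have "\<dots> \<le> C * exp (real (n * \<kappa>) * (1 + \<omega> (norm a)) + real (n * \<kappa>) * \<omega> (norm y) + Phi m (length is))"
    using weight_norm_add_le[OF norm_triangle_ineq4[of a y]] assms(3) by (intro mult_left_mono) auto
  finally show "cmod (partials is (\<lambda>y. g (a - y)) y) \<le> C * exp (real (n * \<kappa>) * (1 + \<omega> (norm a)))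
      * exp (real (n * \<kappa>) * \<omega> (norm y) + Phi m (length is))"
    by (simp add: exp_add mult_ac)
qed

text \<open>Reflection at the origin preserves the norm of the argument, so, in contrast to a
  translation, it changes neither index nor constant.\<close>

lemma bnd_reflect_0:
  assumes "smooth g" "bnd m n C g"
  shows "bnd m n C (\<lambda>y. g (- y))"
proof -
  have "partials is (\<lambda>y. g (- y)) y = (- 1) ^ length is * partials is g (- y)" for "is" y
    using partials_reflect[OF assms(1), of "is" 0] by (simp add: fun_eq_iff)
  then show ?thesis using bndD[OF assms(2), of _ "- y" for y] unfolding bnd_def
    by (simp add: norm_mult norm_power)
qed

end

subsection \<open>Convolution with a functional of finite growth\<close>

text \<open>The bare formula for a functional fixed in advance; \<open>conv\<close> first chooses an
  extension and is \<open>convolve\<close> of that extension.\<close>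

definition convolve :: "((real ^ 'n \<Rightarrow> complex) \<Rightarrow> complex) \<Rightarrow> (real ^ 'n \<Rightarrow> complex) \<Rightarrow> real ^ 'n \<Rightarrow> complex" where
  "convolve T f x = T (\<lambda>y. f (x - y))"

lemma has_vector_derivative_quadratic:
  fixes F :: "real \<Rightarrow> complex"
  assumes "\<And>t. \<bar>t\<bar> \<le> 1 \<Longrightarrow> cmod (F t - F 0 - t *\<^sub>R D) \<le> B * t\<^sup>2"
  shows "(F has_vector_derivative D) (at 0)"
proof -
  have lim: "((\<lambda>t. B * \<bar>t\<bar>) \<longlongrightarrow> 0) (at (0::real))"
    by (auto intro!: tendsto_eq_intros)
  have "eventually (\<lambda>t::real. t \<in> ball 0 1 - {0}) (at 0)"
    by (rule eventually_at_in_open) auto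
  then have "eventually (\<lambda>t. norm (norm (F t - F 0 - (t - 0) *\<^sub>R D) / norm (t - 0)) \<le> B * \<bar>t\<bar>) (at 0)"
  proof eventually_elim
    case (elim t)
    then show ?case using assms[of t] by (simp add: divide_le_eq power2_eq_square)
  qed
  from Lim_null_comparison[OF this lim]
  show ?thesis
    unfolding has_vector_derivative_def has_derivative_iff_norm
    by (simp add: bounded_linear_scaleR_left)
qed

context ultra_weight
begin

text \<open>\<open>W\<close> is a domain on which \<open>T\<close> is controlled by one norm:
  \<open>X m\<close> for O_M and \<open>E (n * \<kappa>)\<close> for O_C. The bound is stated for
  every admissible constant \<open>C\<close>, so that it applies directly to explicit pointwise
  estimates.\<close>

context
  fixes W :: "(real ^ 'n \<Rightarrow> complex) set" and T m n A
  assumes W: "cfun.subspace W" and lin: "linear_on W T" and A: "0 \<le> A"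
    and T_bound: "\<And>g C. g \<in> W \<Longrightarrow> 0 \<le> C \<Longrightarrow> bnd m (n * \<kappa>) C g \<Longrightarrow> cmod (T g) \<le> A * C"
begin

lemma convolve_bound:
  assumes "smooth g" "(\<lambda>y. g (x - y)) \<in> W" "bnd m n C g" "0 \<le> C"
  shows "cmod (convolve T g x) \<le> A * (C * exp (real (n * \<kappa>) * (1 + \<omega> (norm x))))"
  unfolding convolve_def by (rule T_bound) (use assms bnd_reflect in auto)

text \<open>\<open>T\<close> is applied to the whole remainder \<open>h\<close> of the translate
  after its linear term. The second derivative along the axis bounds \<open>h\<close> by a multiple
  of t^2 in the norm that controls \<open>T\<close>. The differentiation is in the translation
  parameter x, so no sign appears.\<close>

lemma convolve_has_vector_derivative:
  assumes g: "smooth g" and gW: "\<And>x. (\<lambda>y. g (x - y)) \<in> W"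
    and dW: "\<And>x. (\<lambda>y. partial i g (x - y)) \<in> W"
    and C: "bnd m n C (partial i (partial i g))" "0 \<le> C"
  shows "((\<lambda>t. convolve T g (x + t *\<^sub>R axis i 1)) has_vector_derivative
    convolve T (partial i g) x) (at 0)"
proof (rule has_vector_derivative_quadratic)
  fix t :: real assume t: "\<bar>t\<bar> \<le> 1"
  \<comment> \<open>The intermediate points are \<open>x - y\<close> moved along the axis by at most
    1, hence \<open>norm x + 1\<close>.\<close>
  define C' where "C' = C * exp (real (n * \<kappa>) * (1 + \<omega> (norm x + 1)))"
  define h where "h = (\<lambda>y. g (x + t *\<^sub>R axis i 1 - y)) - (\<lambda>y. g (x - y))
      - cscale (complex_of_real t) (\<lambda>y. partial i g (x - y))"
  note sm = smooth_reflect[OF g] smooth_reflect[OF smooth_partial[OF g]] smooth_cscale smooth_diff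
  have hW: "h \<in> W" unfolding h_def
    by (intro cfun.subspace_diff[OF W] cfun.subspace_scale[OF W] gW dW)
  have "bnd m (n * \<kappa>) (C' * t\<^sup>2) h" unfolding bnd_def
  proof (intro allI)
    fix "is" y
    \<comment> \<open>Each derivative of \<open>h\<close> in \<open>y\<close> is, up to sign, the
      same remainder formed with \<open>G\<close>, so one scalar estimate serves all lists.\<close>
    define G where "G = partials is g"
    define z where "z = x - y"
    have G: "smooth G" unfolding G_def by (rule smooth_partials[OF g])
    define E where "E = exp (real (n * \<kappa>) * \<omega> (norm y) + Phi m (length is))"
    have second: "cmod (partial i (partial i G) (z + s *\<^sub>R axis i 1)) \<le> C' * E" if s: "\<bar>s\<bar> \<le> 1" for s
    proof -
      have "norm (z + s *\<^sub>R axis i 1) \<le> norm x + norm y + norm (s *\<^sub>R axis i 1 :: real ^ 'n)"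
        unfolding z_def using norm_triangle_ineq[of "x - y" "s *\<^sub>R axis i 1"] norm_triangle_ineq4[of x y]
        by linarith
      then have "norm (z + s *\<^sub>R axis i 1) \<le> (norm x + 1) + norm y" using s by simp
      then have le: "real n * \<omega> (norm (z + s *\<^sub>R axis i 1)) \<le>
          real (n * \<kappa>) * (1 + \<omega> (norm x + 1)) + real (n * \<kappa>) * \<omega> (norm y)"
        by (rule weight_norm_add_le) simp
      have "partial i (partial i G) = partials is (partial i (partial i g))"
        unfolding G_def by (simp add: partials_partial g smooth_partial)
      then have "cmod (partial i (partial i G) (z + s *\<^sub>R axis i 1)) \<le>
          C * exp (real n * \<omega> (norm (z + s *\<^sub>R axis i 1)) + Phi m (length is))"
        using bndD[OF C(1)] by metis
      also have "\<dots> \<le> C * exp (real (n * \<kappa>) * (1 + \<omega> (norm x + 1)) + real (n * \<kappa>) * \<omega> (norm y) + Phi m (length is))"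
        using le C(2) by (intro mult_left_mono) auto
      also have "\<dots> = C' * E" unfolding C'_def E_def by (simp add: exp_add mult_ac)
      finally show ?thesis .
    qed
    have first: "cmod (partial i G (z + s *\<^sub>R axis i 1) - partial i G z) \<le> C' * E * \<bar>s\<bar>" if s: "\<bar>s\<bar> \<le> 1" for s
    proof -
      have "((\<lambda>r. partial i G (z + r *\<^sub>R axis i 1)) has_vector_derivative
          partial i (partial i G) (z + r *\<^sub>R axis i 1)) (at r)" for r
        by (rule has_vector_derivative_partial[OF smooth_partial[OF G]])
      from vector_derivative_bound[OF this, of s "C' * E"] show ?thesis using second s by simp
    qed
    \<comment> \<open>Without its linear term the function has the first difference as derivative,
      which is already of size |s|; a second mean value step then gives t^2.\<close>
    have "((\<lambda>s. G (z + s *\<^sub>R axis i 1) - s *\<^sub>R partial i G z) has_vector_derivative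
        (partial i G (z + s *\<^sub>R axis i 1) - partial i G z)) (at s)" for s
      using has_vector_derivative_partial[OF G, of z i s] by (auto intro!: derivative_eq_intros)
    moreover have "cmod (partial i G (z + s *\<^sub>R axis i 1) - partial i G z) \<le> C' * E * \<bar>t\<bar>"
      if "\<bar>s\<bar> \<le> \<bar>t\<bar>" for s
    proof -
      have "0 \<le> C' * E" unfolding C'_def E_def using C(2) by simp
      then have "C' * E * \<bar>s\<bar> \<le> C' * E * \<bar>t\<bar>" using that by (intro mult_left_mono)
      then show ?thesis using first[of s] t that by linarith
    qed
    ultimately have "cmod ((G (z + t *\<^sub>R axis i 1) - t *\<^sub>R partial i G z) -
        (G (z + 0 *\<^sub>R axis i 1) - 0 *\<^sub>R partial i G z)) \<le> C' * E * \<bar>t\<bar> * \<bar>t\<bar>"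
      by (rule vector_derivative_bound)
    then have "cmod ((G (z + t *\<^sub>R axis i 1) - t *\<^sub>R partial i G z) - G z) \<le> C' * E * \<bar>t\<bar> * \<bar>t\<bar>"
      by simp
    also have "\<dots> = C' * t\<^sup>2 * E" by (simp add: power2_eq_square mult_ac)
    finally have "cmod ((G (z + t *\<^sub>R axis i 1) - t *\<^sub>R partial i G z) - G z) \<le> C' * t\<^sup>2 * E" .
    moreover have "partials is h y =
        (- 1) ^ length is * ((G (z + t *\<^sub>R axis i 1) - t *\<^sub>R partial i G z) - G z)"
    proof -
      have "partials is h = (partials is (\<lambda>y. g (x + t *\<^sub>R axis i 1 - y)) - partials is (\<lambda>y. g (x - y)))
          - cscale (complex_of_real t) (partials is (\<lambda>y. partial i g (x - y)))"
        unfolding h_def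
        by (simp only: partials_diff[OF smooth_diff[OF sm(1) sm(1)] smooth_cscale[OF sm(2)]]
            partials_diff[OF sm(1) sm(1)] partials_cscale[OF sm(2)])
      then have "partials is h y = (partials is (\<lambda>y. g (x + t *\<^sub>R axis i 1 - y)) y - partials is (\<lambda>y. g (x - y)) y)
          - complex_of_real t * partials is (\<lambda>y. partial i g (x - y)) y"
        by (simp add: cscale_def)
      moreover have "partials is (\<lambda>y. g (x + t *\<^sub>R axis i 1 - y)) y = (- 1) ^ length is * G (z + t *\<^sub>R axis i 1)"
        unfolding partials_reflect[OF g] G_def z_def by (simp add: add_diff_eq diff_add_eq)
      moreover have "partials is (\<lambda>y. g (x - y)) y = (- 1) ^ length is * G z"
        unfolding partials_reflect[OF g] G_def z_def ..
      moreover have "partials is (\<lambda>y. partial i g (x - y)) y = (- 1) ^ length is * partial i G z"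
        unfolding partials_reflect[OF smooth_partial[OF g]] partials_partial[OF g] G_def z_def ..
      ultimately show ?thesis by (simp add: scaleR_conv_of_real right_diff_distrib)
    qed
    ultimately show "cmod (partials is h y) \<le> C' * t\<^sup>2 * exp (real (n * \<kappa>) * \<omega> (norm y) + Phi m (length is))"
      by (simp add: norm_mult norm_power E_def)
  qed
  moreover have "0 \<le> C' * t\<^sup>2" unfolding C'_def using C(2) by simp
  ultimately have "cmod (T h) \<le> A * (C' * t\<^sup>2)" using T_bound[OF hW] by blast
  moreover have "T h = convolve T g (x + t *\<^sub>R axis i 1) - convolve T g x - complex_of_real t * convolve T (partial i g) x"
  proof -
    have "T (a - b - cscale c d) = T a - T b - c * T d" if "a \<in> W" "b \<in> W" "d \<in> W" for a b d c
      using linear_on_diff[OF W lin cfun.subspace_diff[OF W that(1,2)] cfun.subspace_scale[OF W that(3), of c]]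
        linear_on_diff[OF W lin that(1,2)] linear_onD(2)[OF lin that(3), of c] by simp
    from this[OF gW gW dW] show ?thesis unfolding h_def convolve_def .
  qed
  ultimately show "cmod (convolve T g (x + t *\<^sub>R axis i 1) - convolve T g (x + 0 *\<^sub>R axis i 1)
      - t *\<^sub>R convolve T (partial i g) x) \<le> (A * (C * exp (real (n * \<kappa>) * (1 + \<omega> (norm x + 1))))) * t\<^sup>2"
    by (simp add: C'_def scaleR_conv_of_real mult.assoc)
qed

context
  fixes f :: "real ^ 'n \<Rightarrow> complex"
  assumes f: "smooth f" and fW: "\<And>is x. (\<lambda>y. partials is f (x - y)) \<in> W"
    and f_bound: "\<And>is. \<exists>C\<ge>0. bnd m n C (partials is f)"
begin

lemma convolve_partials_derivative:
  "((\<lambda>t. convolve T (partials is f) (x + t *\<^sub>R axis i 1)) has_vector_derivative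
    convolve T (partials (i # is) f) x) (at 0)"
proof -
  obtain C where "0 \<le> C" "bnd m n C (partials (i # i # is) f)" using f_bound by blast
  then show ?thesis
    using convolve_has_vector_derivative[OF smooth_partials[OF f] fW, of i "is" C x] fW[of "i # is"] by simp
qed

text \<open>Existence of directional derivatives does not give continuity in several variables. Here
  they are bounded on the unit ball around each point, and that yields a Lipschitz estimate at the
  point.\<close>

lemma convolve_partials_continuous: "continuous_on UNIV (convolve T (partials is f))"
proof -
  obtain C :: "'n \<Rightarrow> real" where C: "\<And>i. 0 \<le> C i" "\<And>i. bnd m n (C i) (partials (i # is) f)"
  proof -
    have "\<forall>i. \<exists>C. 0 \<le> C \<and> bnd m n C (partials (i # is) f)" using f_bound by blast
    from choice[OF this] show ?thesis using that by blast
  qed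
  have "isCont (convolve T (partials is f)) x" for x
  proof -
    \<comment> \<open>A bound common to all coordinate directions, with \<open>norm x + 1\<close>
      covering the unit ball around \<open>x\<close>.\<close>
    define M where "M = (\<Sum>i\<in>UNIV. A * (C i * exp (real (n * \<kappa>) * (1 + \<omega> (norm x + 1)))))"
    have M0: "0 \<le> M" unfolding M_def using A C(1) by (intro sum_nonneg) auto
    have bound: "cmod (convolve T (partials (i # is) f) z) \<le> M" if z: "norm (z - x) \<le> 1" for i z
    proof -
      have "norm z \<le> norm x + 1" using z norm_triangle_ineq2[of z x] by linarith
      then have "\<omega> (norm z) \<le> \<omega> (norm x + 1)" by (intro weight_mono) auto
      then have le: "A * (C i * exp (real (n * \<kappa>) * (1 + \<omega> (norm z)))) \<le>
          A * (C i * exp (real (n * \<kappa>) * (1 + \<omega> (norm x + 1))))"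
        using A C(1) by (intro mult_left_mono) (auto intro: mult_left_mono)
      have "cmod (convolve T (partials (i # is) f) z) \<le> A * (C i * exp (real (n * \<kappa>) * (1 + \<omega> (norm z))))"
        by (rule convolve_bound[OF smooth_partials[OF f] fW C(2,1)])
      also note le
      also have "A * (C i * exp (real (n * \<kappa>) * (1 + \<omega> (norm x + 1)))) \<le> M" unfolding M_def using A C(1)
        by (intro member_le_sum[where f = "\<lambda>i. A * (C i * exp (real (n * \<kappa>) * (1 + \<omega> (norm x + 1))))"]) auto
      finally show ?thesis .
    qed
    have lip: "cmod (convolve T (partials is f) y - convolve T (partials is f) x) \<le> CARD('n) * M * norm (y - x)"
      if "norm (y - x) \<le> 1" for y
      by (rule lipschitz_of_bounded_partials[OF convolve_partials_derivative]) (use that bound in auto)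
    have "((\<lambda>y. real CARD('n) * M * norm (y - x)) \<longlongrightarrow> 0) (at x)"
      by (auto intro!: tendsto_eq_intros)
    moreover have "eventually (\<lambda>y. y \<in> ball x 1 - {x}) (at x)"
      by (rule eventually_at_in_open) auto
    then have "eventually (\<lambda>y. norm (convolve T (partials is f) y - convolve T (partials is f) x)
        \<le> real CARD('n) * M * norm (y - x)) (at x)"
      by eventually_elim (rule lip, simp add: dist_norm norm_minus_commute)
    ultimately have "((\<lambda>y. convolve T (partials is f) y - convolve T (partials is f) x) \<longlongrightarrow> 0) (at x)"
      by (rule Lim_null_comparison[rotated])
    then show ?thesis by (simp add: isCont_def LIM_zero_iff)
  qed
  then show ?thesis by (simp add: continuous_on_eq_continuous_at)
qed

lemma convolve_smooth: "smooth (convolve T f)"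
  and partials_convolve: "partials is (convolve T f) = convolve T (partials is f)"
proof -
  show "smooth (convolve T f)"
    by (rule smooth_family[of "\<lambda>is. convolve T (partials is f)", OF _ convolve_partials_continuous
          convolve_partials_derivative]) simp
  show "partials is (convolve T f) = convolve T (partials is f)"
    by (rule partials_family[of "\<lambda>is. convolve T (partials is f)", OF _ convolve_partials_continuous
          convolve_partials_derivative]) simp
qed

text \<open>The factor \<open>exp (real (n * \<kappa>))\<close> comes from the additive 1 in the
  subadditivity estimate for \<omega>; the rest of the translation cost is the growth allowed in the
  target space.\<close>

lemma bnd_convolve:
  assumes "bnd (2 * m) n C f" "0 \<le> C" "1 \<le> m"
  shows "bnd m (n * \<kappa>) (A * exp (real (n * \<kappa>)) * C) (convolve T f)"
  unfolding bnd_def partials_convolve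
proof (intro allI)
  fix "is" x
  have "cmod (convolve T (partials is f) x) \<le>
      A * (C * exp (Phi m (length is)) * exp (real (n * \<kappa>) * (1 + \<omega> (norm x))))"
    by (rule convolve_bound[OF smooth_partials[OF f] fW bnd_partials[OF assms(1,3,2)]]) (use assms(2) in simp)
  then show "cmod (convolve T (partials is f) x) \<le>
      A * exp (real (n * \<kappa>)) * C * exp (real (n * \<kappa>) * \<omega> (norm x) + Phi m (length is))"
    by (simp add: exp_add distrib_left mult_ac)
qed

end

end

end

section \<open>The spaces \<open>\<O>\<^sub>M\<close> and \<open>\<O>\<^sub>C\<close> as seminorm topologies\<close>

lemma subspace_directed_Union:
  assumes "A \<noteq> {}" "\<And>a. a \<in> A \<Longrightarrow> cfun.subspace (V a)"
    and "\<And>a b. a \<in> A \<Longrightarrow> b \<in> A \<Longrightarrow> \<exists>c\<in>A. V a \<subseteq> V c \<and> V b \<subseteq> V c"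
  shows "cfun.subspace (\<Union>a\<in>A. V a)"
proof (rule cfun.subspaceI)
  show "0 \<in> (\<Union>a\<in>A. V a)" using assms(1,2) cfun.subspace_0 by fast
  show "cscale c f \<in> (\<Union>a\<in>A. V a)" if "f \<in> (\<Union>a\<in>A. V a)" for c f
    using that assms(2) cfun.subspace_scale by fast
  fix f g assume "f \<in> (\<Union>a\<in>A. V a)" "g \<in> (\<Union>a\<in>A. V a)"
  then obtain a b where ab: "a \<in> A" "b \<in> A" "f \<in> V a" "g \<in> V b" by blast
  then obtain c where c: "c \<in> A" "V a \<subseteq> V c" "V b \<subseteq> V c" using assms(3) by meson
  then have "f + g \<in> V c" using ab by (intro cfun.subspace_add[OF assms(2)]) auto
  then show "f + g \<in> (\<Union>a\<in>A. V a)" using c(1) by blast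
qed

lemma proj_limit_cong:
  assumes "\<And>i. i \<in> I \<Longrightarrow> X i = Y i"
  shows "proj_limit I X = proj_limit I Y"
proof -
  have "(\<Inter>j\<in>I. topspace (X j)) = (\<Inter>j\<in>I. topspace (Y j))" using assms by simp
  then show ?thesis
    unfolding proj_limit_def by (simp add: assms cong: conj_cong)
qed

context ultra_weight
begin

text \<open>\<open>X m\<close> is the step \<open>ind\<^bsub>n\<^esub> \<O>\<^sup>m\<^bsub>n\<^esub>\<close> of \<open>\<O>\<^sub>M\<close> and \<open>E n\<close> the step \<open>proj\<^bsub>m\<^esub> \<O>\<^sup>m\<^bsub>n\<^esub>\<close> of \<open>\<O>\<^sub>C\<close>;
  \<open>PX m\<close> and \<open>PC\<close> are the continuous seminorms of \<open>X m\<close> and of \<open>\<O>\<^sub>C\<close>.\<close>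

definition X :: "nat \<Rightarrow> (real ^ 'n \<Rightarrow> complex) set" where
  "X m = (\<Union>n\<in>{1..}. S m n)"

definition E :: "nat \<Rightarrow> (real ^ 'n \<Rightarrow> complex) set" where
  "E n = (\<Inter>m\<in>{1..}. S m n)"

definition OMs :: "(real ^ 'n \<Rightarrow> complex) set" where
  "OMs = (\<Inter>m\<in>{1..}. X m)"

definition OCs :: "(real ^ 'n \<Rightarrow> complex) set" where
  "OCs = (\<Union>n\<in>{1..}. E n)"

definition PX :: "nat \<Rightarrow> ((real ^ 'n \<Rightarrow> complex) \<Rightarrow> real) set" where
  "PX m = {p. seminorm_on (X m) p \<and> (\<forall>n\<ge>1. \<exists>C\<ge>0. \<forall>f\<in>S m n. p f \<le> C * \<rho> m n f)}"

definition PC :: "((real ^ 'n \<Rightarrow> complex) \<Rightarrow> real) set" where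
  "PC = {p. seminorm_on OCs p \<and> (\<forall>n\<ge>1. \<exists>m\<ge>1. \<exists>C\<ge>0. \<forall>f\<in>E n. p f \<le> C * \<rho> m n f)}"

lemma S_subset: "1 \<le> m \<Longrightarrow> m \<le> m' \<Longrightarrow> n \<le> n' \<Longrightarrow> S m' n \<subseteq> S m n'"
  using rho_mono(1) by blast

lemma X_antimono: "1 \<le> m \<Longrightarrow> m \<le> m' \<Longrightarrow> X m' \<subseteq> X m"
  unfolding X_def by (intro UN_mono S_subset) auto

lemma E_mono: "n \<le> n' \<Longrightarrow> E n \<subseteq> E n'"
  unfolding E_def by (intro INF_superset_mono S_subset) auto

lemma E_subset_S: "1 \<le> m \<Longrightarrow> E n \<subseteq> S m n"
  unfolding E_def by auto

lemma subspace_X: "1 \<le> m \<Longrightarrow> cfun.subspace (X m)"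
  unfolding X_def
proof (rule subspace_directed_Union)
  fix a b :: nat assume "1 \<le> m" "a \<in> {1..}" "b \<in> {1..}"
  then show "\<exists>c\<in>{1..}. S m a \<subseteq> S m c \<and> S m b \<subseteq> S m c"
    using S_subset[of m m a "max a b"] S_subset[of m m b "max a b"] by (intro bexI[of _ "max a b"]) auto
qed (use subspace_S in auto)

lemma subspace_E: "cfun.subspace (E n)"
  unfolding E_def by (rule cfun.subspace_Inter) (use subspace_S in auto)

lemma subspace_OMs: "cfun.subspace OMs"
  unfolding OMs_def by (rule cfun.subspace_Inter) (use subspace_X in auto)

lemma subspace_OCs: "cfun.subspace OCs"
  unfolding OCs_def
proof (rule subspace_directed_Union)
  fix a b :: nat assume "a \<in> {1..}" "b \<in> {1..}"
  then show "\<exists>c\<in>{1..}. E a \<subseteq> E c \<and> E b \<subseteq> E c"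
    using E_mono[of a "max a b"] E_mono[of b "max a b"] by (intro bexI[of _ "max a b"]) auto
qed (use subspace_E in auto)

lemma O_step_eq: "O_step \<omega> m n = seminorm_topology (S m n) {\<rho> m n}"
  unfolding O_step_def S_def \<rho>_def ..

lemma continuous_map_rho_iff:
  assumes "1 \<le> m" "seminorm_on (S m n) p"
  shows "continuous_map (O_step \<omega> m n) euclideanreal p \<longleftrightarrow> (\<exists>C\<ge>0. \<forall>f\<in>S m n. p f \<le> C * \<rho> m n f)"
proof -
  have "(\<exists>F C. finite F \<and> F \<subseteq> {\<rho> m n} \<and> 0 \<le> C \<and> (\<forall>f\<in>S m n. p f \<le> C * (\<Sum>q\<in>F. q f)))
      \<longleftrightarrow> (\<exists>C\<ge>0. \<forall>f\<in>S m n. p f \<le> C * \<rho> m n f)" (is "?l \<longleftrightarrow> ?r")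
  proof
    assume ?l
    then obtain F C where F: "F \<subseteq> {\<rho> m n}" "0 \<le> C" "\<And>f. f \<in> S m n \<Longrightarrow> p f \<le> C * (\<Sum>q\<in>F. q f)"
      by blast
    have "p f \<le> C * \<rho> m n f" if "f \<in> S m n" for f
    proof -
      have "F = {} \<or> F = {\<rho> m n}" using F(1) by blast
      then have "(\<Sum>q\<in>F. q f) \<le> \<rho> m n f" by (auto simp: rho_nonneg)
      then show ?thesis using F(3)[OF that] mult_left_mono[OF _ F(2)] order_trans by blast
    qed
    then show ?r using F(2) by blast
  next
    assume ?r
    then obtain C where "0 \<le> C" "\<forall>f\<in>S m n. p f \<le> C * \<rho> m n f" by blast
    then show ?l by (intro exI[of _ "{\<rho> m n}"] exI[of _ C]) auto
  qed
  then show ?thesis unfolding O_step_eq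
    using continuous_map_seminorm_on_iff[OF subspace_S[OF assms(1)] _ assms(2), of "{\<rho> m n}"]
    by (simp add: seminorm_on_rho[OF assms(1)])
qed

lemma S_subset_X: "1 \<le> n \<Longrightarrow> S m n \<subseteq> X m"
  unfolding X_def by auto

lemma ind_limit_O_step:
  assumes m: "1 \<le> m"
  shows "ind_limit {1..} (\<lambda>n. O_step \<omega> m n) = seminorm_topology (X m) (PX m)"
proof -
  have top: "(\<Union>n\<in>{1..}. topspace (O_step \<omega> m n)) = X m"
    unfolding O_step_eq X_def by simp
  have "seminorm_on (X m) p \<and> (\<forall>n\<in>{1..}. continuous_map (O_step \<omega> m n) euclideanreal p) \<longleftrightarrow> p \<in> PX m"
    for p
  proof -
    have "continuous_map (O_step \<omega> m n) euclideanreal p \<longleftrightarrow> (\<exists>C\<ge>0. \<forall>f\<in>S m n. p f \<le> C * \<rho> m n f)"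
      if "seminorm_on (X m) p" "1 \<le> n" for n
      using continuous_map_rho_iff[OF m seminorm_on_subset[OF that(1) S_subset_X[OF that(2)]]] .
    then show ?thesis unfolding PX_def by auto
  qed
  then have "{p. seminorm_on (X m) p \<and> (\<forall>n\<in>{1..}. continuous_map (O_step \<omega> m n) euclideanreal p)} = PX m"
    by blast
  then show ?thesis unfolding ind_limit_def top by (rule arg_cong)
qed

lemma OM_space_eq: "OM_space \<omega> = seminorm_topology OMs (\<Union>m\<in>{1..}. PX m)"
proof -
  have "OM_space \<omega> = proj_limit {1..} (\<lambda>m. seminorm_topology (X m) (PX m))"
    unfolding OM_space_def by (intro proj_limit_cong ind_limit_O_step) simp
  also have "\<dots> = seminorm_topology OMs (\<Union>m\<in>{1..}. PX m)"
    unfolding OMs_def by (rule proj_limit_seminorm_topology) (auto simp: subspace_X PX_def)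
  finally show ?thesis .
qed

lemma proj_limit_O_step:
  "proj_limit {1..} (\<lambda>m. O_step \<omega> m n) = seminorm_topology (E n) (\<Union>m\<in>{1..}. {\<rho> m n})"
  unfolding O_step_eq E_def
  by (rule proj_limit_seminorm_topology) (auto simp: subspace_S seminorm_on_rho)

lemma rho_antimono_E: "f \<in> E n \<Longrightarrow> 1 \<le> m \<Longrightarrow> m \<le> m' \<Longrightarrow> \<rho> m n f \<le> \<rho> m' n f"
  using rho_mono(2)[of f m' n m n] E_subset_S[of m' n] by auto

text \<open>On \<open>E n\<close> the norms increase with \<open>m\<close>, so the largest index
  that occurs dominates all of them and the number of summands becomes a constant.\<close>

lemma sum_rho_le:
  assumes "finite F" "F \<subseteq> (\<Union>m\<in>{1..}. {\<rho> m n})"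
  shows "\<exists>m\<ge>1. \<forall>f\<in>E n. (\<Sum>p\<in>F. p f) \<le> card F * \<rho> m n f"
proof -
  have "\<exists>m\<ge>1. \<forall>p\<in>F. \<forall>f\<in>E n. p f \<le> \<rho> m n f"
    using assms
  proof (induction F)
    case (insert p F)
    then obtain m where m: "1 \<le> m" "\<forall>p\<in>F. \<forall>f\<in>E n. p f \<le> \<rho> m n f" by auto
    obtain m' where m': "1 \<le> m'" "p = \<rho> m' n" using insert.prems by auto
    have "\<rho> m n f \<le> \<rho> (max m m') n f" "\<rho> m' n f \<le> \<rho> (max m m') n f" if "f \<in> E n" for f
      using rho_antimono_E[OF that m(1), of "max m m'"] rho_antimono_E[OF that m'(1), of "max m m'"]
      by auto
    then show ?case using m m' by (intro exI[of _ "max m m'"]) (force intro: order_trans)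
  qed auto
  then obtain m where "1 \<le> m" "\<And>p f. p \<in> F \<Longrightarrow> f \<in> E n \<Longrightarrow> p f \<le> \<rho> m n f" by blast
  then show ?thesis using sum_bounded_above[of F "\<lambda>p. p f" "\<rho> m n f" for f]
    by (intro exI[of _ m]) auto
qed

lemma continuous_map_E_iff:
  fixes p :: "(real ^ 'n \<Rightarrow> complex) \<Rightarrow> real"
  assumes "seminorm_on (E n) p"
  shows "continuous_map (seminorm_topology (E n) (\<Union>m\<in>{1..}. {\<rho> m n})) euclideanreal p \<longleftrightarrow>
    (\<exists>m\<ge>1. \<exists>C\<ge>0. \<forall>f\<in>E n. p f \<le> C * \<rho> m n f)"
proof -
  have "(\<exists>F C. finite F \<and> F \<subseteq> (\<Union>m\<in>{1..}. {\<rho> m n}) \<and> 0 \<le> C \<and> (\<forall>f\<in>E n. p f \<le> C * (\<Sum>q\<in>F. q f)))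
      \<longleftrightarrow> (\<exists>m\<ge>1. \<exists>C\<ge>0. \<forall>f\<in>E n. p f \<le> C * \<rho> m n f)" (is "?l \<longleftrightarrow> ?r")
  proof
    assume ?l
    then obtain F C where F: "finite F" "F \<subseteq> (\<Union>m\<in>{1..}. {\<rho> m n})" "0 \<le> C"
      "\<And>f. f \<in> E n \<Longrightarrow> p f \<le> C * (\<Sum>q\<in>F. q f)" by blast
    obtain m where m: "1 \<le> m" "\<And>f. f \<in> E n \<Longrightarrow> (\<Sum>q\<in>F. q f) \<le> card F * \<rho> m n f"
      using sum_rho_le[OF F(1,2)] by blast
    have "p f \<le> (C * card F) * \<rho> m n f" if "f \<in> E n" for f
      using F(4)[OF that] mult_left_mono[OF m(2)[OF that] F(3)] by (simp add: mult.assoc)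
    moreover have "0 \<le> C * card F" using F(3) by simp
    ultimately show ?r using m(1) by blast
  next
    assume ?r
    then obtain m C where "1 \<le> m" "0 \<le> C" "\<forall>f\<in>E n. p f \<le> C * \<rho> m n f" by blast
    then show ?l by (intro exI[of _ "{\<rho> m n}"] exI[of _ C]) auto
  qed
  moreover have "\<forall>q\<in>(\<Union>m\<in>{1..}. {\<rho> m n}). seminorm_on (E n :: (real ^ 'n \<Rightarrow> complex) set) q"
    by (auto intro: seminorm_on_subset[OF seminorm_on_rho E_subset_S])
  ultimately show ?thesis
    using continuous_map_seminorm_on_iff[OF subspace_E _ assms, of "\<Union>m\<in>{1..}. {\<rho> m n}"]
    by (simp only:)
qed

lemma E_subset_OCs: "1 \<le> n \<Longrightarrow> E n \<subseteq> OCs"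
  unfolding OCs_def by auto

lemma OC_space_eq: "OC_space \<omega> = seminorm_topology OCs PC"
proof -
  have top: "(\<Union>n\<in>{1..}. topspace (proj_limit {1..} (\<lambda>m. O_step \<omega> m n))) = OCs"
    unfolding proj_limit_O_step OCs_def by simp
  have "seminorm_on OCs p \<and> (\<forall>n\<in>{1..}. continuous_map (proj_limit {1..} (\<lambda>m. O_step \<omega> m n)) euclideanreal p)
      \<longleftrightarrow> p \<in> PC" for p
  proof -
    have "continuous_map (proj_limit {1..} (\<lambda>m. O_step \<omega> m n)) euclideanreal p \<longleftrightarrow>
        (\<exists>m\<ge>1. \<exists>C\<ge>0. \<forall>f\<in>E n. p f \<le> C * \<rho> m n f)"
      if "seminorm_on OCs p" "1 \<le> n" for n
      unfolding proj_limit_O_step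
      by (rule continuous_map_E_iff[OF seminorm_on_subset[OF that(1) E_subset_OCs[OF that(2)]]])
    then show ?thesis unfolding PC_def by auto
  qed
  then have "{p. seminorm_on OCs p \<and> (\<forall>n\<in>{1..}. continuous_map (proj_limit {1..} (\<lambda>m. O_step \<omega> m n)) euclideanreal p)} = PC"
    by blast
  then show ?thesis unfolding OC_space_def ind_limit_def top by (rule arg_cong)
qed

section \<open>Stability of the seminorm families and the shape of continuous functionals\<close>

lemma topspace_OM [simp]: "topspace (OM_space \<omega>) = OMs"
  and topspace_OC [simp]: "topspace (OC_space \<omega>) = OCs"
  unfolding OM_space_eq OC_space_eq by simp_all

text \<open>The steps shrink and their norms grow with \<open>m\<close>. Control at one index
  therefore persists at all larger ones, which allows common indices to be chosen.\<close>

lemma PX_mono: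
  assumes "p \<in> PX m" "1 \<le> m" "m \<le> m'"
  shows "p \<in> PX m'"
proof -
  have "\<exists>C\<ge>0. \<forall>f\<in>S m' n. p f \<le> C * \<rho> m' n f" if n: "1 \<le> n" for n
  proof -
    obtain C where C: "0 \<le> C" "\<And>f. f \<in> S m n \<Longrightarrow> p f \<le> C * \<rho> m n f"
      using assms(1) n unfolding PX_def by blast
    have "p f \<le> C * \<rho> m' n f" if "f \<in> S m' n" for f
      using C(2)[OF rho_mono(1)[OF that assms(2,3) order_refl]]
        mult_left_mono[OF rho_mono(2)[OF that assms(2,3) order_refl] C(1)] by linarith
    then show ?thesis using C(1) by blast
  qed
  moreover have "seminorm_on (X m') p"
    using assms(1) X_antimono[OF assms(2,3)] seminorm_on_subset unfolding PX_def by blast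
  ultimately show ?thesis unfolding PX_def by blast
qed

text \<open>Closure under finite nonnegative combinations reduces the bound of a continuous
  functional to a single seminorm.\<close>

lemma PX_scale_sum:
  assumes F: "finite F" "F \<subseteq> PX m" and C: "0 \<le> C"
  shows "(\<lambda>f. C * (\<Sum>p\<in>F. p f)) \<in> PX m"
proof -
  have "\<exists>D\<ge>0. \<forall>f\<in>S m n. C * (\<Sum>p\<in>F. p f) \<le> D * \<rho> m n f" if n: "1 \<le> n" for n
  proof -
    have "\<forall>p\<in>F. \<exists>C\<ge>0. \<forall>f\<in>S m n. p f \<le> C * \<rho> m n f"
      using F(2) n unfolding PX_def by blast
    then obtain D where D: "\<And>p. p \<in> F \<Longrightarrow> 0 \<le> D p \<and> (\<forall>f\<in>S m n. p f \<le> D p * \<rho> m n f)"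
      by metis
    have "C * (\<Sum>p\<in>F. p f) \<le> (C * (\<Sum>p\<in>F. D p)) * \<rho> m n f" if "f \<in> S m n" for f
      unfolding mult.assoc sum_distrib_right by (intro mult_left_mono sum_mono C) (use D that in blast)
    moreover have "0 \<le> C * (\<Sum>p\<in>F. D p)" using C D by (simp add: sum_nonneg)
    ultimately show ?thesis by blast
  qed
  moreover have "seminorm_on (X m) (\<lambda>f. C * (\<Sum>p\<in>F. p f))"
    using F(2) C unfolding PX_def by (intro seminorm_on_scale seminorm_on_sum) auto
  ultimately show ?thesis unfolding PX_def by blast
qed

lemma PC_scale_sum:
  assumes F: "finite F" "F \<subseteq> PC" and C: "0 \<le> C"
  shows "(\<lambda>f. C * (\<Sum>p\<in>F. p f)) \<in> PC"
proof -
  have "\<exists>m\<ge>1. \<exists>D\<ge>0. \<forall>f\<in>E n. C * (\<Sum>p\<in>F. p f) \<le> D * \<rho> m n f" if n: "1 \<le> n" for n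
  proof -
    have "\<forall>p\<in>F. \<exists>m\<ge>1. \<exists>C\<ge>0. \<forall>f\<in>E n. p f \<le> C * \<rho> m n f"
      using F(2) n unfolding PC_def by blast
    then obtain M where M: "\<And>p. p \<in> F \<Longrightarrow> 1 \<le> M p \<and> (\<exists>C\<ge>0. \<forall>f\<in>E n. p f \<le> C * \<rho> (M p) n f)"
      by metis
    then obtain D where D: "\<And>p. p \<in> F \<Longrightarrow> 0 \<le> D p \<and> (\<forall>f\<in>E n. p f \<le> D p * \<rho> (M p) n f)"
      by metis
    \<comment> \<open>The index may vary with the seminorm; the maximum serves all of them, and the
      inserted 1 covers an empty \<open>F\<close>.\<close>
    define m where "m = Max (insert 1 (M ` F))"
    have m: "1 \<le> m" "\<And>p. p \<in> F \<Longrightarrow> M p \<le> m" using F(1) by (auto simp: m_def)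
    have "p f \<le> D p * \<rho> m n f" if "p \<in> F" "f \<in> E n" for p f
    proof -
      have "\<rho> (M p) n f \<le> \<rho> m n f" using rho_antimono_E that M m by blast
      then have "D p * \<rho> (M p) n f \<le> D p * \<rho> m n f" using D that by (intro mult_left_mono) auto
      then show ?thesis using D that by force
    qed
    then have "C * (\<Sum>p\<in>F. p f) \<le> (C * (\<Sum>p\<in>F. D p)) * \<rho> m n f" if "f \<in> E n" for f
      unfolding mult.assoc sum_distrib_right by (intro mult_left_mono sum_mono C) (use that in blast)
    moreover have "0 \<le> C * (\<Sum>p\<in>F. D p)" using C D by (simp add: sum_nonneg)
    ultimately show ?thesis using m(1) by blast
  qed
  moreover have "seminorm_on OCs (\<lambda>f. C * (\<Sum>p\<in>F. p f))"
    using F(2) C unfolding PC_def by (intro seminorm_on_scale seminorm_on_sum) auto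
  ultimately show ?thesis unfolding PC_def by blast
qed

text \<open>Continuity involves seminorms from finitely many steps, and the largest index among them
  suffices by monotonicity.\<close>

lemma dual_OM_D:
  assumes "T \<in> dual (OM_space \<omega>)"
  shows "linear_on OMs T" "\<exists>m\<ge>1. \<exists>p\<in>PX m. \<forall>f\<in>OMs. cmod (T f) \<le> p f"
proof -
  have sn: "\<forall>p\<in>(\<Union>m\<in>{1..}. PX m). seminorm_on OMs p"
    unfolding PX_def OMs_def by (auto intro: seminorm_on_subset)
  note T = assms[unfolded OM_space_eq dual_seminorm_topology_iff[OF subspace_OMs sn]]
  then show "linear_on OMs T" by blast
  from T obtain F C where F: "finite F" "F \<subseteq> (\<Union>m\<in>{1..}. PX m)" "0 \<le> C"
    "\<And>f. f \<in> OMs \<Longrightarrow> cmod (T f) \<le> C * (\<Sum>p\<in>F. p f)" by blast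
  have "\<exists>m\<ge>1. F \<subseteq> PX m"
    using F(1,2)
  proof (induction F)
    case (insert p F)
    then obtain m where m: "1 \<le> m" "F \<subseteq> PX m" by auto
    obtain m' where m': "1 \<le> m'" "p \<in> PX m'" using insert.prems by auto
    have "F \<subseteq> PX (max m m')" using m PX_mono[of _ m "max m m'"] by auto
    moreover have "p \<in> PX (max m m')" using m' PX_mono[of _ m' "max m m'"] by auto
    ultimately show ?case using m(1) by (intro exI[of _ "max m m'"]) auto
  qed auto
  then obtain m where m: "1 \<le> m" "F \<subseteq> PX m" by blast
  show "\<exists>m\<ge>1. \<exists>p\<in>PX m. \<forall>f\<in>OMs. cmod (T f) \<le> p f"
    by (rule exI[of _ m], rule conjI[OF m(1)], rule bexI[OF _ PX_scale_sum[OF F(1) m(2) F(3)]])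
      (use F(4) in blast)
qed

lemma dual_OC_D:
  assumes "T \<in> dual (OC_space \<omega>)"
  shows "linear_on OCs T" "\<exists>p\<in>PC. \<forall>f\<in>OCs. cmod (T f) \<le> p f"
proof -
  have sn: "\<forall>p\<in>PC. seminorm_on OCs p" unfolding PC_def by blast
  note T = assms[unfolded OC_space_eq dual_seminorm_topology_iff[OF subspace_OCs sn]]
  then show "linear_on OCs T" by blast
  from T obtain F C where F: "finite F" "F \<subseteq> PC" "0 \<le> C"
    "\<And>f. f \<in> OCs \<Longrightarrow> cmod (T f) \<le> C * (\<Sum>p\<in>F. p f)" by blast
  show "\<exists>p\<in>PC. \<forall>f\<in>OCs. cmod (T f) \<le> p f"
    by (rule bexI[OF _ PC_scale_sum[OF F(1-3)]]) (use F(4) in blast)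
qed

subsection \<open>Reflections and translations\<close>

lemma S_reflect_0:
  assumes "f \<in> S m n" "1 \<le> m"
  shows "(\<lambda>y. f (- y)) \<in> S m n \<and> \<rho> m n (\<lambda>y. f (- y)) \<le> \<rho> m n f"
proof -
  have sm: "smooth f" using S_smooth[OF assms(1)] .
  then have "smooth (\<lambda>y. f (- y))" using smooth_reflect[of f 0] by simp
  from rho_least[OF assms(2) this rho_nonneg bnd_reflect_0[OF sm rho_bound[OF assms(2,1)]]]
  show ?thesis .
qed

lemma E_reflect_0: "f \<in> E n \<Longrightarrow> (\<lambda>y. f (- y)) \<in> E n"
  unfolding E_def using S_reflect_0 by auto

lemma X_reflect_0: "1 \<le> m \<Longrightarrow> f \<in> X m \<Longrightarrow> (\<lambda>y. f (- y)) \<in> X m"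
  unfolding X_def using S_reflect_0 by blast

lemma OMs_reflect_0: "f \<in> OMs \<Longrightarrow> (\<lambda>y. f (- y)) \<in> OMs"
  unfolding OMs_def using X_reflect_0 by auto

lemma OCs_reflect_0: "f \<in> OCs \<Longrightarrow> (\<lambda>y. f (- y)) \<in> OCs"
  unfolding OCs_def using E_reflect_0 by blast

lemma reflect_add: "(\<lambda>y. (f + g) (- y)) = (\<lambda>y. f (- y)) + (\<lambda>y. g (- y))"
  and reflect_diff: "(\<lambda>y. (f - g) (- y)) = (\<lambda>y. f (- y)) - (\<lambda>y. g (- y))"
  and reflect_cscale: "(\<lambda>y. cscale c f (- y)) = cscale c (\<lambda>y. f (- y))"
  for f g :: "'a::group_add \<Rightarrow> complex"
  by (auto simp: cscale_def)

lemma PX_reflect_0: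
  assumes "p \<in> PX m" "1 \<le> m"
  shows "(\<lambda>f. p (\<lambda>y. f (- y))) \<in> PX m"
proof -
  have p: "seminorm_on (X m) p" using assms(1) unfolding PX_def by blast
  have "\<exists>C\<ge>0. \<forall>f\<in>S m n. p (\<lambda>y. f (- y)) \<le> C * \<rho> m n f" if n: "1 \<le> n" for n
  proof -
    obtain C where C: "0 \<le> C" "\<And>f. f \<in> S m n \<Longrightarrow> p f \<le> C * \<rho> m n f"
      using assms(1) n unfolding PX_def by blast
    have "p (\<lambda>y. f (- y)) \<le> C * \<rho> m n f" if "f \<in> S m n" for f
      using S_reflect_0[OF that assms(2)] C(2)[of "\<lambda>y. f (- y)"] mult_left_mono[OF _ C(1)] order_trans
      by blast
    then show ?thesis using C(1) by blast
  qed
  moreover have "seminorm_on (X m) (\<lambda>f. p (\<lambda>y. f (- y)))"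
    unfolding seminorm_on_def reflect_add reflect_cscale
    using seminorm_onD[OF p] X_reflect_0[OF assms(2)] by blast
  ultimately show ?thesis unfolding PX_def by blast
qed

lemma PC_reflect_0:
  assumes "p \<in> PC"
  shows "(\<lambda>f. p (\<lambda>y. f (- y))) \<in> PC"
proof -
  have p: "seminorm_on OCs p" using assms(1) unfolding PC_def by blast
  have "\<exists>m\<ge>1. \<exists>C\<ge>0. \<forall>f\<in>E n. p (\<lambda>y. f (- y)) \<le> C * \<rho> m n f" if n: "1 \<le> n" for n
  proof -
    obtain m C where C: "1 \<le> m" "0 \<le> C" "\<And>f. f \<in> E n \<Longrightarrow> p f \<le> C * \<rho> m n f"
      using assms(1) n unfolding PC_def by blast
    have "p (\<lambda>y. f (- y)) \<le> C * \<rho> m n f" if f: "f \<in> E n" for f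
    proof -
      have "f \<in> S m n" using f E_subset_S[OF C(1)] by blast
      from mult_left_mono[OF conjunct2[OF S_reflect_0[OF this C(1)]] C(2)] C(3)[OF E_reflect_0[OF f]]
      show ?thesis by linarith
    qed
    then show ?thesis using C(1,2) by blast
  qed
  moreover have "seminorm_on OCs (\<lambda>f. p (\<lambda>y. f (- y)))"
    unfolding seminorm_on_def reflect_add reflect_cscale
    using seminorm_onD[OF p] OCs_reflect_0 by blast
  ultimately show ?thesis unfolding PC_def by blast
qed

lemma continuous_map_reflect_OM: "continuous_map (OM_space \<omega>) (OM_space \<omega>) (\<lambda>f y. f (- y))"
  unfolding OM_space_eq
proof (rule continuous_map_into_seminorm_topology)
  fix q assume "q \<in> (\<Union>m\<in>{1..}. PX m)"
  then have "(\<lambda>f. q (\<lambda>y. f (- y))) \<in> (\<Union>m\<in>{1..}. PX m)" using PX_reflect_0 by auto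
  then show "\<exists>p\<in>\<Union>m\<in>{1..}. PX m. \<forall>f\<in>OMs. q (\<lambda>y. f (- y)) \<le> p f" by fast
qed (use OMs_reflect_0 subspace_OMs in \<open>auto simp: reflect_diff\<close>)

lemma continuous_map_reflect_OC: "continuous_map (OC_space \<omega>) (OC_space \<omega>) (\<lambda>f y. f (- y))"
  unfolding OC_space_eq
proof (rule continuous_map_into_seminorm_topology)
  fix q assume "q \<in> PC"
  then have "(\<lambda>f. q (\<lambda>y. f (- y))) \<in> PC" by (rule PC_reflect_0)
  then show "\<exists>p\<in>PC. \<forall>f\<in>OCs. q (\<lambda>y. f (- y)) \<le> p f" by fast
qed (use OCs_reflect_0 subspace_OCs in \<open>auto simp: reflect_diff\<close>)

text \<open>The derivatives halve the upper index and the translation multiplies the lower one by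
  \<open>\<kappa>\<close>. The empty list gives the statement for translates themselves.\<close>

lemma S_partials_reflect:
  assumes "f \<in> S (2 * m) n" "1 \<le> m"
  shows "(\<lambda>y. partials is f (x - y)) \<in> S m (n * \<kappa>)"
proof -
  have sm: "smooth f" using S_smooth[OF assms(1)] .
  have "bnd (2 * m) n (\<rho> (2 * m) n f) f" using rho_bound[OF _ assms(1)] assms(2) by simp
  from bnd_reflect[OF smooth_partials[OF sm] bnd_partials[OF this assms(2) rho_nonneg]]
  have "bnd m (n * \<kappa>) (\<rho> (2 * m) n f * exp (Phi m (length is)) * exp (real (n * \<kappa>) * (1 + \<omega> (norm x))))
      (\<lambda>y. partials is f (x - y))"
    by (simp add: rho_nonneg)
  from rho_least[OF assms(2) smooth_reflect[OF smooth_partials[OF sm]] _ this]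
  show ?thesis by (simp add: rho_nonneg)
qed

lemma mult_kappa_ge_1: "1 \<le> n \<Longrightarrow> 1 \<le> n * \<kappa>"
  using kappa_ge_1 by (simp add: Suc_le_eq)

lemma X_reflect: "1 \<le> m \<Longrightarrow> f \<in> X (2 * m) \<Longrightarrow> (\<lambda>y. f (x - y)) \<in> X m"
  unfolding X_def using S_partials_reflect[of f m _ "[]" x] mult_kappa_ge_1 by fastforce

lemma E_partials_reflect: "f \<in> E n \<Longrightarrow> (\<lambda>y. partials is f (x - y)) \<in> E (n * \<kappa>)"
  unfolding E_def using S_partials_reflect[of f _ n "is" x] by auto

lemma OMs_reflect: "f \<in> OMs \<Longrightarrow> (\<lambda>y. f (x - y)) \<in> OMs"
  unfolding OMs_def using X_reflect[of _ f x] by auto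

lemma OCs_reflect: "f \<in> OCs \<Longrightarrow> (\<lambda>y. f (x - y)) \<in> OCs"
  unfolding OCs_def using E_partials_reflect[of f _ "[]" x] mult_kappa_ge_1 by fastforce

subsection \<open>Continuity of convolution operators\<close>

text \<open>Translation from pointwise bounds to norms: a function with bound \<open>C\<close> has
  norm at most \<open>C\<close>, so a norm bound on \<open>T\<close> yields the hypothesis required
  for each explicit constant.\<close>

lemma S_convolve:
  assumes W: "cfun.subspace W" "linear_on W T" and A: "0 \<le> A"
    and T: "\<And>g. g \<in> W \<Longrightarrow> g \<in> S m (n * \<kappa>) \<Longrightarrow> cmod (T g) \<le> A * \<rho> m (n * \<kappa>) g"
    and Wsm: "\<And>g. g \<in> W \<Longrightarrow> smooth g"
    and f: "f \<in> S (2 * m) n" "\<And>is x. (\<lambda>y. partials is f (x - y)) \<in> W" and m: "1 \<le> m"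
  shows "convolve T f \<in> S m (n * \<kappa>) \<and>
    \<rho> m (n * \<kappa>) (convolve T f) \<le> A * exp (real (n * \<kappa>)) * \<rho> (2 * m) n f"
proof -
  have sm: "smooth f" using S_smooth[OF f(1)] .
  have b: "bnd (2 * m) n (\<rho> (2 * m) n f) f" using rho_bound[OF _ f(1)] m by simp
  have T': "cmod (T g) \<le> A * C" if "g \<in> W" "0 \<le> C" "bnd m (n * \<kappa>) C g" for g C
    using rho_least[OF m Wsm[OF that(1)] that(2,3)] T[OF that(1)] mult_left_mono[OF _ A] order_trans by blast
  have fb: "\<exists>C\<ge>0. bnd m n C (partials is f)" for "is"
    using bnd_partials[OF b m rho_nonneg] rho_nonneg by (metis exp_ge_zero mult_nonneg_nonneg)
  note ctx = W A T' sm f(2) fb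
  from rho_least[OF m convolve_smooth[OF ctx] _ bnd_convolve[OF ctx b rho_nonneg m]]
  show ?thesis using A by (simp add: rho_nonneg)
qed

text \<open>All translates of derivatives of \<open>f\<close> lie in the single step with index
  \<open>n * \<kappa>\<close>, where the continuous seminorm \<open>p\<close> is at most a multiple
  of the norm. That multiple, and with it \<open>B\<close>, depends on \<open>n\<close>.\<close>

lemma X_convolve:
  assumes m: "1 \<le> m" and T: "linear_on (X m) T" "p \<in> PX m" "\<And>g. g \<in> X m \<Longrightarrow> cmod (T g) \<le> p g"
    and n: "1 \<le> n"
  shows "\<exists>B\<ge>0. \<forall>f\<in>S (2 * m) n. convolve T f \<in> S m (n * \<kappa>) \<and>
    \<rho> m (n * \<kappa>) (convolve T f) \<le> B * \<rho> (2 * m) n f"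
proof -
  obtain A where A: "0 \<le> A" "\<And>g. g \<in> S m (n * \<kappa>) \<Longrightarrow> p g \<le> A * \<rho> m (n * \<kappa>) g"
    using T(2) mult_kappa_ge_1[OF n] unfolding PX_def by blast
  have "convolve T f \<in> S m (n * \<kappa>) \<and>
      \<rho> m (n * \<kappa>) (convolve T f) \<le> A * exp (real (n * \<kappa>)) * \<rho> (2 * m) n f"
    if f: "f \<in> S (2 * m) n" for f
  proof (rule S_convolve[OF subspace_X[OF m] T(1) A(1) _ _ f _ m])
    show "cmod (T g) \<le> A * \<rho> m (n * \<kappa>) g" if "g \<in> X m" "g \<in> S m (n * \<kappa>)" for g
      using T(3) A(2) that order_trans by blast
    show "smooth g" if "g \<in> X m" for g
      using that S_smooth unfolding X_def by blast
    show "(\<lambda>y. partials is f (x - y)) \<in> X m" for "is" x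
      using S_partials_reflect[OF f m] S_subset_X[OF mult_kappa_ge_1[OF n]] by blast
  qed
  moreover have "0 \<le> A * exp (real (n * \<kappa>))" using A(1) by simp
  ultimately show ?thesis by blast
qed

text \<open>A continuous seminorm on O_C is bounded by one norm on each step separately, so
  \<open>E (n * \<kappa>)\<close> is taken as the domain of \<open>T\<close>. The norm has an index
  \<open>m1\<close> depending on \<open>n\<close>; since the norms increase with the index, every
  \<open>m \<ge> m1\<close> may be used.\<close>

lemma E_convolve:
  assumes T: "linear_on OCs T" "p \<in> PC" "\<And>g. g \<in> OCs \<Longrightarrow> cmod (T g) \<le> p g"
    and n: "1 \<le> n"
  shows "\<exists>m1\<ge>1. \<forall>m\<ge>m1. \<exists>B\<ge>0. \<forall>f\<in>E n. convolve T f \<in> S m (n * \<kappa>) \<and>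
    \<rho> m (n * \<kappa>) (convolve T f) \<le> B * \<rho> (2 * m) n f"
proof -
  note nk = mult_kappa_ge_1[OF n]
  obtain m1 A where A: "1 \<le> m1" "0 \<le> A" "\<And>g. g \<in> E (n * \<kappa>) \<Longrightarrow> p g \<le> A * \<rho> m1 (n * \<kappa>) g"
    using T(2) nk unfolding PC_def by blast
  have "convolve T f \<in> S m (n * \<kappa>) \<and>
      \<rho> m (n * \<kappa>) (convolve T f) \<le> A * exp (real (n * \<kappa>)) * \<rho> (2 * m) n f"
    if f: "f \<in> E n" and m: "m1 \<le> m" for f m
  proof (rule S_convolve[OF subspace_E linear_on_subset[OF T(1) E_subset_OCs[OF nk]] A(2)])
    show "cmod (T g) \<le> A * \<rho> m (n * \<kappa>) g" if g: "g \<in> E (n * \<kappa>)" for g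
    proof -
      have "cmod (T g) \<le> p g" using T(3) g E_subset_OCs[OF nk] by blast
      moreover have "A * \<rho> m1 (n * \<kappa>) g \<le> A * \<rho> m (n * \<kappa>) g"
        using rho_antimono_E[OF g A(1) m] A(2) by (rule mult_left_mono)
      ultimately show ?thesis using A(3)[OF g] by linarith
    qed
    show "smooth g" if "g \<in> E (n * \<kappa>)" for g
      using that S_smooth E_subset_S[of 1] by blast
    show "f \<in> S (2 * m) n" using f E_subset_S[of "2 * m" n] m A(1) by auto
    show "(\<lambda>y. partials is f (x - y)) \<in> E (n * \<kappa>)" for "is" x
      using E_partials_reflect[OF f] .
  qed (use m A(1) in simp)
  moreover have "0 \<le> A * exp (real (n * \<kappa>))" using A(2) by simp
  ultimately show ?thesis using A(1) by blast
qed

end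

section \<open>Linearity of convolution in the function\<close>

lemma convolve_add:
  assumes "linear_on W T" "\<And>x. (\<lambda>y. f (x - y)) \<in> W" "\<And>x. (\<lambda>y. g (x - y)) \<in> W"
  shows "convolve T (f + g) = convolve T f + convolve T g"
proof
  fix x
  have "(\<lambda>y. (f + g) (x - y)) = (\<lambda>y. f (x - y)) + (\<lambda>y. g (x - y))" by auto
  then show "convolve T (f + g) x = (convolve T f + convolve T g) x"
    using linear_onD(1)[OF assms(1) assms(2)[of x] assms(3)[of x]] by (simp add: convolve_def)
qed

lemma convolve_cscale:
  assumes "linear_on W T" "\<And>x. (\<lambda>y. f (x - y)) \<in> W"
  shows "convolve T (cscale c f) = cscale c (convolve T f)"
proof
  fix x
  have "(\<lambda>y. cscale c f (x - y)) = cscale c (\<lambda>y. f (x - y))" by (auto simp: cscale_def)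
  then show "convolve T (cscale c f) x = cscale c (convolve T f) x"
    using linear_onD(2)[OF assms(1) assms(2)[of x], of c] by (simp add: convolve_def cscale_def)
qed

lemma convolve_diff:
  assumes "cfun.subspace W" "linear_on W T" "\<And>x. (\<lambda>y. f (x - y)) \<in> W" "\<And>x. (\<lambda>y. g (x - y)) \<in> W"
  shows "convolve T (f - g) = convolve T f - convolve T g"
proof
  fix x
  have "(\<lambda>y. (f - g) (x - y)) = (\<lambda>y. f (x - y)) - (\<lambda>y. g (x - y))" by auto
  then show "convolve T (f - g) x = (convolve T f - convolve T g) x"
    using linear_on_diff[OF assms(1,2) assms(3)[of x] assms(4)[of x]] by (simp add: convolve_def)
qed

lemma seminorm_on_convolve:
  assumes "seminorm_on Y q" "linear_on W T" "\<And>f. f \<in> V \<Longrightarrow> convolve T f \<in> Y"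
    and "\<And>f x. f \<in> V \<Longrightarrow> (\<lambda>y. f (x - y)) \<in> W"
  shows "seminorm_on V (\<lambda>f. q (convolve T f))"
  unfolding seminorm_on_def
  using seminorm_onD[OF assms(1)] convolve_add[OF assms(2)] convolve_cscale[OF assms(2)] assms(3,4)
  by simp

section \<open>Convolution operators on O_M and O_C\<close>

context ultra_weight
begin

text \<open>Continuity is tested on seminorms \<open>q\<close> in \<open>PX m\<close> for large
  \<open>m\<close>: the pullback under convolution with the extended functional is a seminorm on
  \<open>X (2 * m)\<close>, bounded on each \<open>S (2 * m) n\<close>, and hence belongs to
  \<open>PX (2 * m)\<close>.\<close>

lemma convolve_OM:
  assumes T: "T \<in> dual (OM_space \<omega>)"
  shows "f \<in> OMs \<Longrightarrow> convolve T f \<in> OMs"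
    and "continuous_map (OM_space \<omega>) (OM_space \<omega>) (convolve T)"
proof -
  note lin = dual_OM_D(1)[OF T]
  obtain m0 p where p: "1 \<le> m0" "p \<in> PX m0" "\<And>f. f \<in> OMs \<Longrightarrow> cmod (T f) \<le> p f"
    using dual_OM_D(2)[OF T] by blast
  have psn: "seminorm_on (X m0) p" using p(2) unfolding PX_def by blast
  have sub: "OMs \<subseteq> X m" if "1 \<le> m" for m using that unfolding OMs_def by auto
  \<comment> \<open>\<open>T\<close> has to act on the steps \<open>X m\<close>, not only on \<open>OMs\<close>, for its seminorm bounds to
    become continuous seminorms of a step.\<close>
  obtain T' where T': "linear_on (X m0) T'" "\<And>f. f \<in> OMs \<Longrightarrow> T' f = T f"
      "\<And>f. f \<in> X m0 \<Longrightarrow> cmod (T' f) \<le> p f"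
    using hahn_banach_seminorm[OF subspace_X[OF p(1)] psn subspace_OMs sub[OF p(1)] lin p(3)] by blast
  \<comment> \<open>\<open>OMs\<close> is stable under reflected translations, so the choice of the
    extension does not affect the convolution there.\<close>
  have eq: "convolve T' f = convolve T f" if "f \<in> OMs" for f
    using T'(2) OMs_reflect[OF that] by (simp add: convolve_def fun_eq_iff)
  have lin': "linear_on (X m) T'" if "m0 \<le> m" for m
    using linear_on_subset[OF T'(1) X_antimono[OF p(1) that]] .
  have step: "\<exists>B\<ge>0. \<forall>f\<in>S (2 * m) n. convolve T' f \<in> S m (n * \<kappa>) \<and>
      \<rho> m (n * \<kappa>) (convolve T' f) \<le> B * \<rho> (2 * m) n f" if m: "m0 \<le> m" and n: "1 \<le> n" for m n
    by (rule X_convolve[OF _ lin'[OF m] PX_mono[OF p(2,1) m] _ n])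
      (use T'(3) X_antimono[OF p(1) m] p(1) m in auto)
  have into: "convolve T' f \<in> X m" if m: "m0 \<le> m" and f: "f \<in> X (2 * m)" for m f
  proof -
    obtain n where n: "1 \<le> n" "f \<in> S (2 * m) n" using f unfolding X_def by auto
    then have "convolve T' f \<in> S m (n * \<kappa>)" using step[OF m n(1)] by blast
    then show ?thesis using S_subset_X[OF mult_kappa_ge_1[OF n(1)]] by blast
  qed
  show OM: "convolve T f \<in> OMs" if f: "f \<in> OMs" for f
    unfolding OMs_def
  proof
    fix m :: nat assume m: "m \<in> {1..}"
    have "1 \<le> 2 * max m m0" using p(1) by linarith
    \<comment> \<open>The estimates start at \<open>m0\<close>; smaller indices follow because the
      spaces \<open>X m\<close> decrease.\<close>
    then have "convolve T f \<in> X (max m m0)"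
      using into[of "max m m0" f] f sub[of "2 * max m m0"] eq[OF f] by auto
    then show "convolve T f \<in> X m" using X_antimono[of m "max m m0"] m by auto
  qed
  have pull: "\<exists>r\<in>(\<Union>m\<in>{1..}. PX m). \<forall>f\<in>OMs. q (convolve T f) \<le> r f"
    if q: "q \<in> (\<Union>m\<in>{1..}. PX m)" for q
  proof -
    obtain m1 where m1: "1 \<le> m1" "q \<in> PX m1" using q by auto
    define m where "m = max m1 m0"
    have m: "1 \<le> m" "m0 \<le> m" and qm: "q \<in> PX m"
      using m1 PX_mono[OF m1(2,1), of m] by (auto simp: m_def)
    have "\<exists>C\<ge>0. \<forall>f\<in>S (2 * m) n. q (convolve T' f) \<le> C * \<rho> (2 * m) n f" if n: "1 \<le> n" for n
    proof -
      obtain B where B: "0 \<le> B" "\<And>f. f \<in> S (2 * m) n \<Longrightarrow> convolve T' f \<in> S m (n * \<kappa>) \<and>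
          \<rho> m (n * \<kappa>) (convolve T' f) \<le> B * \<rho> (2 * m) n f"
        using step[OF m(2) n] by blast
      obtain C where C: "0 \<le> C" "\<And>g. g \<in> S m (n * \<kappa>) \<Longrightarrow> q g \<le> C * \<rho> m (n * \<kappa>) g"
        using qm mult_kappa_ge_1[OF n] unfolding PX_def by blast
      have "q (convolve T' f) \<le> (C * B) * \<rho> (2 * m) n f" if "f \<in> S (2 * m) n" for f
      proof -
        have "q (convolve T' f) \<le> C * \<rho> m (n * \<kappa>) (convolve T' f)" using B(2) C(2) that by blast
        also have "\<dots> \<le> C * (B * \<rho> (2 * m) n f)" using B(2) C(1) that by (intro mult_left_mono) auto
        finally show ?thesis by (simp add: mult.assoc)
      qed
      moreover have "0 \<le> C * B" using B C by simp
      ultimately show ?thesis by blast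
    qed
    moreover have "seminorm_on (X (2 * m)) (\<lambda>f. q (convolve T' f))"
      by (rule seminorm_on_convolve[OF _ lin'[OF m(2)] into[OF m(2)] X_reflect[OF m(1)]])
        (use qm in \<open>auto simp: PX_def\<close>)
    ultimately have "(\<lambda>f. q (convolve T' f)) \<in> PX (2 * m)" unfolding PX_def by blast
    moreover have "q (convolve T f) \<le> q (convolve T' f)" if "f \<in> OMs" for f
      using eq[OF that] by simp
    ultimately show ?thesis using m(1) by (intro bexI[of _ "\<lambda>f. q (convolve T' f)"]) auto
  qed
  show "continuous_map (OM_space \<omega>) (OM_space \<omega>) (convolve T)"
    unfolding OM_space_eq
  proof (rule continuous_map_into_seminorm_topology)
    show "convolve T (g - f) = convolve T g - convolve T f" if "f \<in> OMs" "g \<in> OMs" for f g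
      by (rule convolve_diff[OF subspace_OMs lin]) (use that OMs_reflect in auto)
  qed (fact OM subspace_OMs pull)+
qed

text \<open>Each \<open>E n\<close> is contained in \<open>OCs\<close>, so \<open>T\<close> acts on
  the steps as it stands, and convolution maps \<open>E n\<close> into
  \<open>E (n * \<kappa>)\<close>. This makes the pullback of a continuous seminorm bounded on every
  step.\<close>

lemma convolve_OC:
  assumes T: "T \<in> dual (OC_space \<omega>)"
  shows "f \<in> OCs \<Longrightarrow> convolve T f \<in> OCs"
    and "continuous_map (OC_space \<omega>) (OC_space \<omega>) (convolve T)"
proof -
  note lin = dual_OC_D(1)[OF T]
  obtain p where p: "p \<in> PC" "\<And>f. f \<in> OCs \<Longrightarrow> cmod (T f) \<le> p f"
    using dual_OC_D(2)[OF T] by blast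
  note step = E_convolve[OF lin p]
  have into: "convolve T f \<in> E (n * \<kappa>)" if n: "1 \<le> n" and f: "f \<in> E n" for n f
    unfolding E_def
  proof
    fix m :: nat assume m: "m \<in> {1..}"
    obtain m1 where "\<And>m. m1 \<le> m \<Longrightarrow> convolve T f \<in> S m (n * \<kappa>)"
      using step[OF _ n] f by blast
    then have "convolve T f \<in> S (max m m1) (n * \<kappa>)" by simp
    then show "convolve T f \<in> S m (n * \<kappa>)"
      using S_subset[of m "max m m1" "n * \<kappa>" "n * \<kappa>"] m by auto
  qed
  show OC: "convolve T f \<in> OCs" if f: "f \<in> OCs" for f
  proof -
    obtain n where n: "1 \<le> n" "f \<in> E n" using f unfolding OCs_def by auto
    then show ?thesis using into[OF n(1,2)] E_subset_OCs[OF mult_kappa_ge_1[OF n(1)]] by blast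
  qed
  have pull: "\<exists>r\<in>PC. \<forall>f\<in>OCs. q (convolve T f) \<le> r f" if q: "q \<in> PC" for q
  proof -
    have "\<exists>m\<ge>1. \<exists>C\<ge>0. \<forall>f\<in>E n. q (convolve T f) \<le> C * \<rho> m n f" if n: "1 \<le> n" for n
    proof -
      obtain m2 C where C: "1 \<le> m2" "0 \<le> C" "\<And>g. g \<in> E (n * \<kappa>) \<Longrightarrow> q g \<le> C * \<rho> m2 (n * \<kappa>) g"
        using q mult_kappa_ge_1[OF n] unfolding PC_def by blast
      obtain m1 where m1: "1 \<le> m1" "\<forall>m\<ge>m1. \<exists>B\<ge>0. \<forall>f\<in>E n. convolve T f \<in> S m (n * \<kappa>) \<and>
          \<rho> m (n * \<kappa>) (convolve T f) \<le> B * \<rho> (2 * m) n f"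
        using step[OF _ n] by blast
      \<comment> \<open>Large enough both for the convolution estimate and for the norm that
        controls \<open>q\<close>.\<close>
      define m where "m = max m1 m2"
      obtain B where B: "0 \<le> B" "\<And>f. f \<in> E n \<Longrightarrow> \<rho> m (n * \<kappa>) (convolve T f) \<le> B * \<rho> (2 * m) n f"
        using m1(2)[rule_format, of m] by (auto simp: m_def)
      have "q (convolve T f) \<le> (C * B) * \<rho> (2 * m) n f" if f: "f \<in> E n" for f
      proof -
        have cE: "convolve T f \<in> E (n * \<kappa>)" using into[OF n f] .
        have "q (convolve T f) \<le> C * \<rho> m2 (n * \<kappa>) (convolve T f)" using C(3)[OF cE] .
        also have "\<dots> \<le> C * \<rho> m (n * \<kappa>) (convolve T f)"
          using rho_antimono_E[OF cE C(1), of m] C(2) by (intro mult_left_mono) (auto simp: m_def)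
        also have "\<dots> \<le> C * (B * \<rho> (2 * m) n f)" using B(2)[OF f] C(2) by (rule mult_left_mono)
        finally show ?thesis by (simp add: mult.assoc)
      qed
      moreover have "0 \<le> C * B" "1 \<le> 2 * m" using B C by (auto simp: m_def)
      ultimately show ?thesis by blast
    qed
    moreover have "seminorm_on OCs (\<lambda>f. q (convolve T f))"
      by (rule seminorm_on_convolve[OF _ lin OC OCs_reflect]) (use q in \<open>auto simp: PC_def\<close>)
    ultimately have "(\<lambda>f. q (convolve T f)) \<in> PC" unfolding PC_def by blast
    then show ?thesis by fast
  qed
  show "continuous_map (OC_space \<omega>) (OC_space \<omega>) (convolve T)"
    unfolding OC_space_eq
  proof (rule continuous_map_into_seminorm_topology)
    show "convolve T (g - f) = convolve T g - convolve T f" if "f \<in> OCs" "g \<in> OCs" for f g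
      by (rule convolve_diff[OF subspace_OCs lin]) (use that OCs_reflect in auto)
  qed (fact OC subspace_OCs pull)+
qed

end

section \<open>Test functions\<close>

context ultra_weight
begin

definition Es :: "(real ^ 'n \<Rightarrow> complex) set" where
  "Es = {f. smooth f \<and> (\<forall>K m. compact K \<and> 1 \<le> m \<longrightarrow> p_norm \<omega> K m f < \<infinity>)}"

definition Ds :: "(real ^ 'n \<Rightarrow> complex) set" where
  "Ds = {f \<in> Es. \<exists>K. compact K \<and> closure {x. f x \<noteq> 0} \<subseteq> K}"

lemma
  fixes K :: "(real ^ 'n) set"
  assumes m: "1 \<le> m"
  defines "V \<equiv> {f \<in> {f. smooth f}. p_norm \<omega> K m f < \<infinity>}"
  shows subspace_p: "cfun.subspace (V :: (real ^ 'n \<Rightarrow> complex) set)"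
    and seminorm_on_p: "seminorm_on V (\<lambda>f :: real ^ 'n \<Rightarrow> complex. enn2real (p_norm \<omega> K m f))"
    and p_bound: "\<And>f :: real ^ 'n \<Rightarrow> complex. f \<in> V \<Longrightarrow> pbnd K m (enn2real (p_norm \<omega> K m f)) f"
    and p_least: "\<And>(f :: real ^ 'n \<Rightarrow> complex) C. smooth f \<Longrightarrow> 0 \<le> C \<Longrightarrow> pbnd K m C f \<Longrightarrow> f \<in> V"
proof -
  have iff: "p_norm \<omega> K m f \<le> ennreal C \<longleftrightarrow> pbnd K m C f"
    if "f \<in> {f. smooth f}" "0 \<le> C" for f :: "real ^ 'n \<Rightarrow> complex" and C
    using p_norm_le_iff[OF m _ that(2)] that(1) by simp
  have add: "pbnd K m (C + D) (f + g)"
    if "f \<in> {f. smooth f}" "g \<in> {f. smooth f}" "pbnd K m C f" "pbnd K m D g"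
    for f g :: "real ^ 'n \<Rightarrow> complex" and C D
    using pbnd_add that by simp
  have scale: "pbnd K m (cmod c * C) (cscale c f)" if "f \<in> {f. smooth f}" "pbnd K m C f"
    for f :: "real ^ 'n \<Rightarrow> complex" and C c
    using pbnd_cscale that by simp
  note * = subspace_smooth iff pbnd_zero add scale
  show "cfun.subspace (V :: (real ^ 'n \<Rightarrow> complex) set)" unfolding V_def
    by (rule subspace_gauge[where Bd = "pbnd K m"]) (fact *)+
  show "seminorm_on V (\<lambda>f :: real ^ 'n \<Rightarrow> complex. enn2real (p_norm \<omega> K m f))" unfolding V_def
    by (rule seminorm_on_gauge[where Bd = "pbnd K m"]) (fact *)+
  show "pbnd K m (enn2real (p_norm \<omega> K m f)) f" if "f \<in> V" for f :: "real ^ 'n \<Rightarrow> complex"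
    using that unfolding V_def by (rule gauge_bound[where Bd = "pbnd K m", rotated -1]) (fact *)+
  show "f \<in> V" if "smooth f" "0 \<le> C" "pbnd K m C f" for f :: "real ^ 'n \<Rightarrow> complex" and C
    using gauge_least[where Bd = "pbnd K m" and N = "p_norm \<omega> K m", OF * _ that(2,3)] that(1)
    unfolding V_def by blast
qed

lemma Es_iff: "f \<in> Es \<longleftrightarrow> smooth f \<and> (\<forall>K m. compact K \<and> 1 \<le> m \<longrightarrow> (\<exists>C\<ge>0. pbnd K m C f))"
proof
  assume f: "f \<in> Es"
  have "\<exists>C\<ge>0. pbnd K m C f" if "compact K" "1 \<le> m" for K m
    using p_bound[OF that(2), of f K] f that enn2real_nonneg unfolding Es_def by blast
  then show "smooth f \<and> (\<forall>K m. compact K \<and> 1 \<le> m \<longrightarrow> (\<exists>C\<ge>0. pbnd K m C f))"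
    using f unfolding Es_def by blast
next
  assume f: "smooth f \<and> (\<forall>K m. compact K \<and> 1 \<le> m \<longrightarrow> (\<exists>C\<ge>0. pbnd K m C f))"
  have "p_norm \<omega> K m f < \<infinity>" if "compact K" "1 \<le> m" for K m
    using p_least[OF that(2), of f _ K] f that by blast
  then show "f \<in> Es" using f unfolding Es_def by blast
qed

lemma Es_subset_p: "compact K \<Longrightarrow> 1 \<le> m \<Longrightarrow> Es \<subseteq> {f \<in> {f. smooth f}. p_norm \<omega> K m f < \<infinity>}"
  unfolding Es_def by blast

lemma subspace_Es: "cfun.subspace (Es :: (real ^ 'n \<Rightarrow> complex) set)"
proof (rule cfun.subspaceI)
  note sub = subspace_p[where 'n = 'n]
  have mem: "f \<in> Es" if "smooth f" "\<And>K m. compact K \<Longrightarrow> 1 \<le> m \<Longrightarrow> f \<in> {f \<in> {f. smooth f}. p_norm \<omega> K m f < \<infinity>}"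
    for f :: "real ^ 'n \<Rightarrow> complex"
    using that unfolding Es_def by blast
  show "(0 :: real ^ 'n \<Rightarrow> complex) \<in> Es"
    by (rule mem[OF smooth_zero cfun.subspace_0[OF sub]])
  show "f + g \<in> Es" if fg: "f \<in> Es" "g \<in> Es" for f g :: "real ^ 'n \<Rightarrow> complex"
  proof (rule mem)
    show "smooth (f + g)" using fg smooth_add unfolding Es_def by blast
    show "f + g \<in> {f \<in> {f. smooth f}. p_norm \<omega> K m f < \<infinity>}" if "compact K" "1 \<le> m" for K m
      by (rule cfun.subspace_add[OF sub[OF that(2)]]) (use fg Es_subset_p[OF that] in blast)+
  qed
  show "cscale c f \<in> Es" if f: "f \<in> Es" for c and f :: "real ^ 'n \<Rightarrow> complex"
  proof (rule mem)
    show "smooth (cscale c f)" using f smooth_cscale unfolding Es_def by blast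
    show "cscale c f \<in> {f \<in> {f. smooth f}. p_norm \<omega> K m f < \<infinity>}" if "compact K" "1 \<le> m" for K m
      by (rule cfun.subspace_scale[OF sub[OF that(2)]]) (use f Es_subset_p[OF that] in blast)
  qed
qed

lemma E_space_eq:
  "E_space \<omega> = seminorm_topology Es {\<lambda>f. enn2real (p_norm \<omega> K m f) | K m. compact K \<and> 1 \<le> m}"
  unfolding E_space_def Es_def ..

lemma subspace_Ds: "cfun.subspace Ds"
proof (rule cfun.subspaceI)
  have support: "closure {x. f x \<noteq> 0} \<subseteq> K" if "compact K" "\<And>x. x \<notin> K \<Longrightarrow> f x = 0"
    for f :: "real ^ 'n \<Rightarrow> complex" and K
    by (rule closure_minimal) (use that compact_imp_closed in auto)
  have outside: "f x = 0" if "closure {x. f x \<noteq> 0} \<subseteq> K" "x \<notin> K" for f :: "real ^ 'n \<Rightarrow> complex" and K x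
    using that closure_subset[of "{x. f x \<noteq> 0}"] by blast
  show "(0 :: real ^ 'n \<Rightarrow> complex) \<in> Ds"
    unfolding Ds_def using cfun.subspace_0[OF subspace_Es] by auto
  show "f + g \<in> Ds" if "f \<in> Ds" "g \<in> Ds" for f g :: "real ^ 'n \<Rightarrow> complex"
  proof -
    obtain K L where K: "compact K" "closure {x. f x \<noteq> 0} \<subseteq> K" and L: "compact L" "closure {x. g x \<noteq> 0} \<subseteq> L"
      using \<open>f \<in> Ds\<close> \<open>g \<in> Ds\<close> unfolding Ds_def by blast
    have "closure {x. (f + g) x \<noteq> 0} \<subseteq> K \<union> L"
      by (rule support[OF compact_Un[OF K(1) L(1)]]) (simp add: outside[OF K(2)] outside[OF L(2)])
    moreover have "f + g \<in> Es" using that cfun.subspace_add[OF subspace_Es] unfolding Ds_def by blast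
    ultimately show ?thesis unfolding Ds_def using compact_Un[OF K(1) L(1)] by blast
  qed
  show "cscale c f \<in> Ds" if "f \<in> Ds" for c and f :: "real ^ 'n \<Rightarrow> complex"
  proof -
    obtain K where K: "compact K" "closure {x. f x \<noteq> 0} \<subseteq> K"
      using \<open>f \<in> Ds\<close> unfolding Ds_def by blast
    have "closure {x. cscale c f x \<noteq> 0} \<subseteq> K"
      by (rule support[OF K(1)]) (simp add: cscale_def outside[OF K(2)])
    moreover have "cscale c f \<in> Es" using that cfun.subspace_scale[OF subspace_Es] unfolding Ds_def by blast
    ultimately show ?thesis unfolding Ds_def using K(1) by blast
  qed
qed

lemma topspace_D [simp]: "topspace (D_space \<omega>) = Ds"
  unfolding D_space_def ind_limit_def E_space_eq Ds_def by auto

lemma Ds_reflect_0: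
  fixes f :: "real ^ 'n \<Rightarrow> complex"
  assumes "f \<in> Ds"
  shows "(\<lambda>y. f (- y)) \<in> Ds"
proof -
  have f: "f \<in> Es" using assms unfolding Ds_def by blast
  have sm: "smooth f" using f unfolding Es_def by blast
  have "\<exists>C\<ge>0. pbnd K m C (\<lambda>y. f (- y))" if Km: "compact K" "1 \<le> m" for K m
  proof -
    obtain C where C: "0 \<le> C" "pbnd (uminus ` K) m C f"
      using f[unfolded Es_iff] compact_negations[OF Km(1)] Km(2) by blast
    have "partials is (\<lambda>y. f (- y)) y = (- 1) ^ length is * partials is f (- y)" for "is" y
      using partials_reflect[OF sm, of "is" 0] by (simp add: fun_eq_iff)
    then have "pbnd K m C (\<lambda>y. f (- y))"
      using C(2) unfolding pbnd_def by (simp add: norm_mult norm_power)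
    then show ?thesis using C(1) by blast
  qed
  moreover have "smooth (\<lambda>y. f (- y))" using smooth_reflect[OF sm, of 0] by simp
  ultimately have "(\<lambda>y. f (- y)) \<in> Es" unfolding Es_iff by blast
  moreover obtain K where K: "compact K" "closure {x. f x \<noteq> 0} \<subseteq> K" using assms unfolding Ds_def by blast
  have "closure {y. f (- y) \<noteq> 0} \<subseteq> uminus ` K"
  proof (rule closure_minimal)
    show "{y. f (- y) \<noteq> 0} \<subseteq> uminus ` K"
    proof
      fix y assume "y \<in> {y. f (- y) \<noteq> 0}"
      then have "- y \<in> K" using K(2) closure_subset[of "{x. f x \<noteq> 0}"] by blast
      then have "- (- y) \<in> uminus ` K" by (rule imageI)
      then show "y \<in> uminus ` K" by simp
    qed
    show "closed (uminus ` K)" using compact_negations[OF K(1)] compact_imp_closed by blast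
  qed
  ultimately show ?thesis unfolding Ds_def using compact_negations[OF K(1)] by blast
qed

text \<open>On \<open>K\<close> the growth factor is at least 1; off \<open>K\<close> all
  derivatives vanish because the complement of the support is open. Functions supported in
  \<open>K\<close> therefore lie in the steps for all growth indices \<open>n\<close>, with one and
  the same bound.\<close>

lemma support_S:
  assumes f: "f \<in> Es" and K: "compact K" "closure {x. f x \<noteq> 0} \<subseteq> K" and m: "1 \<le> m"
  shows "f \<in> S m n \<and> \<rho> m n f \<le> enn2real (p_norm \<omega> K m f)"
proof -
  let ?C = "enn2real (p_norm \<omega> K m f)"
  have sm: "smooth f" using f unfolding Es_def by blast
  have pb: "pbnd K m ?C f" using p_bound[OF m] f Es_subset_p[OF K(1) m] by blast
  have "bnd m n ?C f" unfolding bnd_def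
  proof (intro allI)
    fix "is" x
    show "cmod (partials is f x) \<le> ?C * exp (real n * \<omega> (norm x) + Phi m (length is))"
    proof (cases "x \<in> K")
      case True
      then have "cmod (partials is f x) \<le> ?C * exp (Phi m (length is))" using pb unfolding pbnd_def by blast
      also have "\<dots> \<le> ?C * exp (real n * \<omega> (norm x) + Phi m (length is))"
        using weight_nonneg[of "norm x"] by (intro mult_left_mono) auto
      finally show ?thesis .
    next
      case False
      have "partials is f x = 0"
        by (rule partials_outside[of "- closure {x. f x \<noteq> 0}"])
          (use False K(2) closure_subset[of "{x. f x \<noteq> 0}"] in auto)
      then show ?thesis by simp
    qed
  qed
  then show ?thesis by (rule rho_least[OF m sm enn2real_nonneg])
qed

section \<open>Test functions inside the two spaces and restriction of functionals\<close>

lemma Ds_subset_E: "(Ds :: (real ^ 'n \<Rightarrow> complex) set) \<subseteq> E n"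
proof
  fix f :: "real ^ 'n \<Rightarrow> complex" assume "f \<in> Ds"
  then obtain K where K: "f \<in> Es" "compact K" "closure {x. f x \<noteq> 0} \<subseteq> K" unfolding Ds_def by blast
  show "f \<in> E n" unfolding E_def using support_S[OF K] by simp
qed

lemma Ds_subset_OCs: "Ds \<subseteq> OCs"
  using Ds_subset_E E_subset_OCs[of 1] by blast

lemma OCs_subset_OMs: "OCs \<subseteq> OMs"
  unfolding OCs_def OMs_def X_def E_def by auto

text \<open>All test functions lie in the step with n = 1, and on functions supported in a compact
  set its norm is dominated by a seminorm of \<open>E_space\<close>. Thus \<open>cmod (T f)\<close>
  is itself one of the seminorms defining the inductive limit, and it bounds \<open>T\<close> with
  constant 1.\<close>

lemma to_ultradistribution_in:
  fixes T :: "(real ^ 'n \<Rightarrow> complex) \<Rightarrow> complex"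
  assumes lin: "linear_on Ds T" and m: "1 \<le> m" and C: "0 \<le> C"
    and bound: "\<And>f. f \<in> Ds \<Longrightarrow> cmod (T f) \<le> C * \<rho> m 1 f"
  shows "to_ultradistribution \<omega> T \<in> ultradistributions \<omega>"
proof -
  let ?D = "\<lambda>K :: (real ^ 'n) set. subtopology (E_space \<omega>) {f. closure {x. f x \<noteq> 0} \<subseteq> K}"
  let ?T = "to_ultradistribution \<omega> T"
  let ?P = "{p. seminorm_on Ds p \<and> (\<forall>K\<in>{K. compact K}. continuous_map (?D K) euclideanreal p)}"
  have TD: "?T f = T f" if "f \<in> Ds" for f using that by (simp add: to_ultradistribution_def)
  have linT: "linear_on Ds ?T"
    unfolding linear_on_def
    by (simp add: TD cfun.subspace_add[OF subspace_Ds] cfun.subspace_scale[OF subspace_Ds] linear_onD[OF lin])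
  have "(\<Union>K\<in>{K. compact K}. topspace (?D K)) = Ds"
    unfolding E_space_eq Ds_def by auto
  then have D: "D_space \<omega> = seminorm_topology Ds ?P"
    unfolding D_space_def ind_limit_def by simp
  have "continuous_map (?D K) euclideanreal (\<lambda>f. cmod (?T f))" if K: "compact K" for K
    unfolding E_space_eq
  proof (rule continuous_map_subtopology_seminormI[OF subspace_Es])
    show "\<forall>p\<in>{\<lambda>f. enn2real (p_norm \<omega> K m f) | K m. compact K \<and> 1 \<le> m}. seminorm_on Es p"
      by (auto intro: seminorm_on_subset[OF seminorm_on_p Es_subset_p])
    show "{\<lambda>f. enn2real (p_norm \<omega> K m f)} \<subseteq> {\<lambda>f. enn2real (p_norm \<omega> K m f) | K m. compact K \<and> 1 \<le> m}"
      using K m by blast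
    fix f g assume fg: "f \<in> Es \<inter> {f. closure {x. f x \<noteq> 0} \<subseteq> K}" "g \<in> Es \<inter> {f. closure {x. f x \<noteq> 0} \<subseteq> K}"
    then have fD: "f \<in> Ds" "g \<in> Ds" unfolding Ds_def using K by auto
    have z: "f x = 0" "g x = 0" if "x \<notin> K" for x
      using fg closure_subset[of "{x. f x \<noteq> 0}"] closure_subset[of "{x. g x \<noteq> 0}"] that by blast+
    have "{x. (g - f) x \<noteq> 0} \<subseteq> K"
    proof
      fix x assume "x \<in> {x. (g - f) x \<noteq> 0}"
      then show "x \<in> K" using z[of x] by (cases "x \<in> K") auto
    qed
    then have supp: "closure {x. (g - f) x \<noteq> 0} \<subseteq> K"
      by (rule closure_minimal[OF _ compact_imp_closed[OF K]])
    have gf: "g - f \<in> Ds" using cfun.subspace_diff[OF subspace_Ds fD(2,1)] .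
    have "dist (cmod (?T g)) (cmod (?T f)) \<le> cmod (?T g - ?T f)"
      by (simp add: dist_real_def norm_triangle_ineq3)
    also have "?T g - ?T f = T (g - f)"
      using linear_on_diff[OF subspace_Ds linT fD(2,1)] TD[OF gf] by simp
    also have "cmod (T (g - f)) \<le> C * \<rho> m 1 (g - f)" by (rule bound[OF gf])
    also have "\<dots> \<le> C * enn2real (p_norm \<omega> K m (g - f))"
      by (rule mult_left_mono[OF conjunct2[OF support_S[OF _ K supp m]] C]) (use gf in \<open>unfold Ds_def, blast\<close>)
    finally show "dist (cmod (?T g)) (cmod (?T f)) \<le> C * (\<Sum>p\<in>{\<lambda>f. enn2real (p_norm \<omega> K m f)}. p (g - f))"
      by simp
  qed (use C in auto)
  then have P: "(\<lambda>f. cmod (?T f)) \<in> ?P" using seminorm_on_cmod_linear[OF linT] by blast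
  have "\<forall>p\<in>?P. seminorm_on Ds p" by blast
  note iff = dual_seminorm_topology_iff[OF subspace_Ds this, of ?T]
  show ?thesis unfolding D iff
  proof (intro conjI allI impI)
    show "\<exists>F C. finite F \<and> F \<subseteq> ?P \<and> 0 \<le> C \<and> (\<forall>f\<in>Ds. cmod (?T f) \<le> C * (\<Sum>p\<in>F. p f))"
      by (rule exI[of _ "{\<lambda>f. cmod (?T f)}"], rule exI[of _ 1]) (use P in auto)
  qed (use linT in \<open>auto simp: to_ultradistribution_def\<close>)
qed

lemma OM_to_ultradistribution:
  assumes "T \<in> dual (OM_space \<omega>)"
  shows "to_ultradistribution \<omega> T \<in> ultradistributions \<omega>"
proof -
  have sub: "Ds \<subseteq> OMs" using Ds_subset_OCs OCs_subset_OMs by blast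
  obtain m p where p: "1 \<le> m" "p \<in> PX m" "\<And>f. f \<in> OMs \<Longrightarrow> cmod (T f) \<le> p f"
    using dual_OM_D(2)[OF assms] by blast
  obtain C where C: "0 \<le> C" "\<And>f. f \<in> S m 1 \<Longrightarrow> p f \<le> C * \<rho> m 1 f"
    using p(2) unfolding PX_def by blast
  have "cmod (T f) \<le> C * \<rho> m 1 f" if "f \<in> Ds" for f
    using p(3)[of f] C(2)[of f] that sub Ds_subset_E[of 1] E_subset_S[OF p(1), of 1] by fastforce
  then show ?thesis
    using to_ultradistribution_in[OF linear_on_subset[OF dual_OM_D(1)[OF assms] sub] p(1) C(1)] by blast
qed

lemma OC_to_ultradistribution:
  assumes "T \<in> dual (OC_space \<omega>)"
  shows "to_ultradistribution \<omega> T \<in> ultradistributions \<omega>"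
proof -
  obtain p where p: "p \<in> PC" "\<And>f. f \<in> OCs \<Longrightarrow> cmod (T f) \<le> p f"
    using dual_OC_D(2)[OF assms] by blast
  obtain m C where C: "1 \<le> m" "0 \<le> C" "\<And>f. f \<in> E 1 \<Longrightarrow> p f \<le> C * \<rho> m 1 f"
    using p(1) unfolding PC_def by blast
  have "cmod (T f) \<le> C * \<rho> m 1 f" if "f \<in> Ds" for f
    using p(2)[of f] C(3)[of f] that Ds_subset_OCs Ds_subset_E[of 1] by fastforce
  then show ?thesis
    using to_ultradistribution_in[OF linear_on_subset[OF dual_OC_D(1)[OF assms] Ds_subset_OCs] C(1,2)]
    by blast
qed

end

section \<open>Convolutors\<close>

lemma dual_zero: "(\<lambda>_. 0) \<in> dual E"
  unfolding dual_def by simp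

lemma dual_add:
  assumes "S \<in> dual E" "T \<in> dual E"
  shows "S + T \<in> dual E"
proof -
  have "continuous_map E euclidean (\<lambda>f. S f + T f)"
    by (rule continuous_map_add) (use assms in \<open>auto simp: dual_def\<close>)
  then show ?thesis using assms unfolding dual_def by (simp add: plus_fun_def algebra_simps)
qed

lemma dual_cscale:
  assumes "T \<in> dual E"
  shows "cscale c T \<in> dual E"
proof -
  have "continuous_map euclidean euclidean (\<lambda>z::complex. c * z)"
    by (simp add: continuous_on_mult_left)
  moreover have "continuous_map E euclidean T" using assms unfolding dual_def by blast
  ultimately have "continuous_map E euclidean ((\<lambda>z. c * z) \<circ> T)"
    by (rule continuous_map_compose[rotated])
  then show ?thesis using assms unfolding dual_def by (simp add: cscale_def o_def algebra_simps)
qed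

lemma subspace_dual: "cfun.subspace (dual E)"
  by (intro cfun.subspaceI dual_add dual_cscale) (use dual_zero in \<open>simp_all add: zero_fun_def\<close>)

lemma subspace_dual_ultradistributions: "cfun.subspace (dual_ultradistributions \<omega> E)"
proof -
  have "to_ultradistribution \<omega> S + to_ultradistribution \<omega> T = to_ultradistribution \<omega> (S + T)"
    "cscale c (to_ultradistribution \<omega> S) = to_ultradistribution \<omega> (cscale c S)"
    "0 = to_ultradistribution \<omega> 0" for S T :: "(real ^ 'a \<Rightarrow> complex) \<Rightarrow> complex" and c
    by (auto simp: to_ultradistribution_def cscale_def)
  then show ?thesis unfolding dual_ultradistributions_def
    by (intro cfun.subspaceI)
      (auto simp: cfun.subspace_0[OF subspace_dual] dual_add dual_cscale intro!: image_eqI)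
qed

text \<open>The preimage of a neighbourhood of 0 is again one, and homogeneity carries its
  absorption of \<open>B\<close> over to the image.\<close>

lemma bounded_in_image:
  fixes L :: "('b \<Rightarrow> complex) \<Rightarrow> ('b \<Rightarrow> complex)"
  assumes L: "continuous_map E E L" and B: "bounded_in E B"
    and zero: "0 \<in> topspace E" "L 0 = 0"
    and scale: "\<And>c f. f \<in> topspace E \<Longrightarrow> L (cscale c f) = cscale c (L f)"
  shows "bounded_in E (L ` B)"
  unfolding bounded_in_def
proof (intro conjI allI impI)
  have BE: "B \<subseteq> topspace E" using B unfolding bounded_in_def by blast
  then show "L ` B \<subseteq> topspace E" using continuous_map_image_subset_topspace[OF L] by blast
  fix U assume U: "openin E U \<and> 0 \<in> U"
  define V where "V = {f \<in> topspace E. L f \<in> U}"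
  have "openin E V" unfolding V_def using openin_continuous_map_preimage[OF L] U by blast
  moreover have "0 \<in> V" using U zero unfolding V_def by simp
  ultimately obtain r where r: "0 < r" "\<And>c. r \<le> cmod c \<Longrightarrow> B \<subseteq> cscale c ` V"
    using B unfolding bounded_in_def by blast
  have "L ` B \<subseteq> cscale c ` U" if c: "r \<le> cmod c" for c
  proof
    fix g assume "g \<in> L ` B"
    then obtain f where f: "f \<in> B" "g = L f" by blast
    then obtain h where "h \<in> V" "f = cscale c h" using r(2)[OF c] by blast
    then show "g \<in> cscale c ` U" using f(2) scale[of h c] unfolding V_def by auto
  qed
  then show "\<exists>r>0. \<forall>c. r \<le> cmod c \<longrightarrow> L ` B \<subseteq> cscale c ` U" using r(1) by blast
qed

text \<open>Transposing an operator turns the seminorm of a bounded set into that of its image.\<close>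

lemma continuous_map_transpose:
  fixes L :: "('b \<Rightarrow> complex) \<Rightarrow> ('b \<Rightarrow> complex)"
  assumes L: "continuous_map E E L"
    and zero: "0 \<in> topspace E" "L 0 = 0"
    and scale: "\<And>c f. f \<in> topspace E \<Longrightarrow> L (cscale c f) = cscale c (L f)"
    and dual: "\<And>S. S \<in> dual E \<Longrightarrow> (\<lambda>f. if f \<in> topspace E then S (L f) else 0) \<in> dual E"
  shows "continuous_map (strong_dual E) (strong_dual E) (\<lambda>S f. if f \<in> topspace E then S (L f) else 0)"
  unfolding strong_dual_def
proof (rule continuous_map_into_seminorm_topology[OF dual _ subspace_dual])
  show "(\<lambda>f. if f \<in> topspace E then (S - T) (L f) else 0) =
      (\<lambda>f. if f \<in> topspace E then S (L f) else 0) - (\<lambda>f. if f \<in> topspace E then T (L f) else 0)"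
    for S T :: "('b \<Rightarrow> complex) \<Rightarrow> complex"
    by auto
  fix q :: "(('b \<Rightarrow> complex) \<Rightarrow> complex) \<Rightarrow> real"
  assume "q \<in> {\<lambda>S. enn2real (SUP f\<in>B. ennreal (cmod (S f))) | B. bounded_in E B}"
  then obtain B where B: "bounded_in E B" "q = (\<lambda>S. enn2real (SUP f\<in>B. ennreal (cmod (S f))))" by blast
  have BE: "B \<subseteq> topspace E" using B(1) unfolding bounded_in_def by blast
  have "q (\<lambda>f. if f \<in> topspace E then S (L f) else 0) = enn2real (SUP f\<in>L ` B. ennreal (cmod (S f)))" for S
  proof -
    have "(SUP f\<in>B. ennreal (cmod (if f \<in> topspace E then S (L f) else 0))) = (SUP f\<in>B. ennreal (cmod (S (L f))))"
      by (rule SUP_cong) (use BE in auto)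
    then show ?thesis unfolding B(2) image_image by simp
  qed
  moreover have "bounded_in E (L ` B)" by (rule bounded_in_image[OF L B(1) zero scale])
  ultimately show "\<exists>p\<in>{\<lambda>S. enn2real (SUP f\<in>B. ennreal (cmod (S f))) | B. bounded_in E B}.
      \<forall>S\<in>dual E. q (\<lambda>f. if f \<in> topspace E then S (L f) else 0) \<le> p S"
    by (intro bexI[of _ "\<lambda>S. enn2real (SUP f\<in>L ` B. ennreal (cmod (S f)))"]) auto
qed

lemma dual_compose:
  assumes L: "continuous_map E E L" and sub: "cfun.subspace (topspace E)"
    and add: "\<And>f g. f \<in> topspace E \<Longrightarrow> g \<in> topspace E \<Longrightarrow> L (f + g) = L f + L g"
    and scale: "\<And>c f. f \<in> topspace E \<Longrightarrow> L (cscale c f) = cscale c (L f)"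
    and S: "S \<in> dual E"
  shows "(\<lambda>f. if f \<in> topspace E then S (L f) else 0) \<in> dual E"
proof -
  have into: "L f \<in> topspace E" if "f \<in> topspace E" for f
    using continuous_map_image_subset_topspace[OF L] that by blast
  have "continuous_map E euclidean (S \<circ> L)"
    using continuous_map_compose[OF L] S unfolding dual_def by blast
  then have "continuous_map E euclidean (\<lambda>f. if f \<in> topspace E then S (L f) else 0)"
    by (rule continuous_map_eq) auto
  then show ?thesis
    using S into add scale cfun.subspace_add[OF sub] cfun.subspace_scale[OF sub]
    unfolding dual_def by auto
qed

text \<open>\<open>GREATEST\<close> refers to inclusion of sets, so in each case the dual has to be
  shown admissible and to contain every admissible space. The hypotheses collect what O_M and O_C
  have in common for this purpose.\<close>

lemma
  fixes E :: "(real ^ 'n \<Rightarrow> complex) topology"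
  assumes sub: "cfun.subspace (topspace E)"
    and D_refl: "\<And>\<phi> :: real ^ 'n \<Rightarrow> complex. \<phi> \<in> topspace (D_space \<omega>) \<Longrightarrow> (\<lambda>y. \<phi> (- y)) \<in> topspace (D_space \<omega>)"
    and restr: "\<And>T. T \<in> dual E \<Longrightarrow> to_ultradistribution \<omega> T \<in> ultradistributions \<omega>"
    and transl: "\<And>f x. f \<in> topspace E \<Longrightarrow> (\<lambda>y. f (x - y)) \<in> topspace E"
    and E_refl: "continuous_map E E (\<lambda>f y. f (- y))"
    and conv: "\<And>T. T \<in> dual E \<Longrightarrow> continuous_map E E (convolve T)"
  shows convolutors_eq_dual: "convolutors \<omega> E = dual_ultradistributions \<omega> E"
    and dual_convolutors_eq_dual: "dual_convolutors \<omega> E = dual_ultradistributions \<omega> E"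
proof -
  have zero: "0 \<in> topspace E" using cfun.subspace_0[OF sub] .
  have refl: "reflect T \<in> dual E" if T: "T \<in> dual E" for T
  proof -
    have "reflect T = (\<lambda>f. if f \<in> topspace E then T (\<lambda>y. f (- y)) else 0)"
    proof
      fix f
      have R: "(\<lambda>y. g (- y)) \<in> topspace E" if "g \<in> topspace E" for g
        by (rule subsetD[OF continuous_map_image_subset_topspace[OF E_refl]]) (rule imageI[OF that])
      \<comment> \<open>Reflection is an involution, so a function outside \<open>E\<close> is
        reflected to one outside \<open>E\<close>, where \<open>T\<close> vanishes.\<close>
      have "f \<in> topspace E" if "(\<lambda>y. f (- y)) \<in> topspace E"
        using R[OF that] by simp
      then show "reflect T f = (if f \<in> topspace E then T (\<lambda>y. f (- y)) else 0)"
        using T unfolding reflect_def dual_def by auto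
    qed
    moreover have "(\<lambda>f. if f \<in> topspace E then T (\<lambda>y. f (- y)) else 0) \<in> dual E"
      by (rule dual_compose[OF E_refl sub _ _ T]) (auto simp: cscale_def)
    ultimately show ?thesis by simp
  qed
  have conv_into: "convolve T f \<in> topspace E" if "T \<in> dual E" "f \<in> topspace E" for T f
    using continuous_map_image_subset_topspace[OF conv[OF that(1)]] that(2) by blast
  have ext: "extension \<omega> E T \<in> dual E" if "is_extension \<omega> E T R" for T R
    using someI[of "is_extension \<omega> E T", OF that] unfolding extension_def is_extension_def by blast
  have conv_eq: "conv \<omega> E T = convolve (extension \<omega> E T)" for T
    by (auto simp: conv_def convolve_def fun_eq_iff)
  have defined: "conv_defined \<omega> E T f" if "is_extension \<omega> E T R" "f \<in> topspace E" for T R f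
    using that transl unfolding conv_defined_def by blast
  have ext1: "is_extension \<omega> E (to_ultradistribution \<omega> R) R" if "R \<in> dual E" for R
    using that unfolding is_extension_def to_ultradistribution_def by simp
  \<comment> \<open>\<open>conv_dual\<close> convolves with the reflected functional, so its
    extension is the reflected one.\<close>
  have ext2: "is_extension \<omega> E (reflect (to_ultradistribution \<omega> R)) (reflect R)" if "R \<in> dual E" for R
  proof -
    have "reflect R \<phi> = reflect (to_ultradistribution \<omega> R) \<phi>" if "\<phi> \<in> topspace (D_space \<omega>)" for \<phi>
      using D_refl[OF that] by (simp add: reflect_def to_ultradistribution_def)
    then show ?thesis using refl[OF that] unfolding is_extension_def by blast
  qed
  \<comment> \<open>Ultradistributions vanish off the test functions by convention, so agreement on
    test functions is equality with the restriction of \<open>R\<close>.\<close>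
  have in_dual: "T \<in> dual_ultradistributions \<omega> E" if "is_extension \<omega> E T R" "T \<in> ultradistributions \<omega>" for T R
  proof -
    have "T = to_ultradistribution \<omega> R"
      using that unfolding is_extension_def to_ultradistribution_def dual_def by (auto simp: fun_eq_iff)
    then show ?thesis using that unfolding is_extension_def dual_ultradistributions_def by blast
  qed
  have DU: "dual_ultradistributions \<omega> E \<subseteq> ultradistributions \<omega>"
    using restr unfolding dual_ultradistributions_def by blast
  show "convolutors \<omega> E = dual_ultradistributions \<omega> E"
    unfolding convolutors_def
  proof (rule Greatest_equality)
    have "(\<forall>f\<in>topspace E. conv_defined \<omega> E T f \<and> conv \<omega> E T f \<in> topspace E) \<and> continuous_map E E (conv \<omega> E T)"
      if T: "T \<in> dual_ultradistributions \<omega> E" for T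
    proof -
      obtain R where R: "is_extension \<omega> E T R" using T ext1 unfolding dual_ultradistributions_def by blast
      show ?thesis unfolding conv_eq using conv[OF ext[OF R]] conv_into[OF ext[OF R]] defined[OF R] by blast
    qed
    then show "cfun.subspace (dual_ultradistributions \<omega> E) \<and> dual_ultradistributions \<omega> E \<subseteq> ultradistributions \<omega> \<and>
        (\<forall>f\<in>topspace E. \<forall>T\<in>dual_ultradistributions \<omega> E. conv_defined \<omega> E T f \<and> conv \<omega> E T f \<in> topspace E) \<and>
        (\<forall>T\<in>dual_ultradistributions \<omega> E. continuous_map E E (\<lambda>f. conv \<omega> E T f))"
      using subspace_dual_ultradistributions DU by blast
  next
    fix C assume C: "cfun.subspace C \<and> C \<subseteq> ultradistributions \<omega> \<and>
        (\<forall>f\<in>topspace E. \<forall>T\<in>C. conv_defined \<omega> E T f \<and> conv \<omega> E T f \<in> topspace E) \<and>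
        (\<forall>T\<in>C. continuous_map E E (\<lambda>f. conv \<omega> E T f))"
    \<comment> \<open>\<open>E\<close> contains the zero function, so the conditions on
      \<open>C\<close> are not vacuous and provide an extension of each member.\<close>
    show "C \<subseteq> dual_ultradistributions \<omega> E"
      using C zero in_dual unfolding conv_defined_def by blast
  qed
  have conv_add: "convolve T (f + g) = convolve T f + convolve T g"
    and conv_scale: "convolve T (cscale c f) = cscale c (convolve T f)"
    if "T \<in> dual E" "f \<in> topspace E" "g \<in> topspace E" for T f g c
    using that convolve_add[of "topspace E" T f g] convolve_cscale[of "topspace E" T f c] transl
    unfolding dual_iff by blast+
  show "dual_convolutors \<omega> E = dual_ultradistributions \<omega> E"
    unfolding dual_convolutors_def
  proof (rule Greatest_equality)
    have "(\<forall>f\<in>topspace E. conv_defined \<omega> E (reflect T) f \<and> conv \<omega> E (reflect T) f \<in> topspace E) \<and>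
        (\<forall>S\<in>dual E. conv_dual \<omega> E T S \<in> dual E) \<and>
        continuous_map (strong_dual E) (strong_dual E) (\<lambda>S. conv_dual \<omega> E T S)"
      if T: "T \<in> dual_ultradistributions \<omega> E" for T
    proof -
      obtain R where R: "is_extension \<omega> E (reflect T) R"
        using T ext2 unfolding dual_ultradistributions_def by blast
      define L where "L = convolve (extension \<omega> E (reflect T))"
      note X = ext[OF R]
      have L: "continuous_map E E L" unfolding L_def using conv[OF X] .
      have add: "L (f + g) = L f + L g" if "f \<in> topspace E" "g \<in> topspace E" for f g
        unfolding L_def using conv_add[OF X that] .
      have scale: "L (cscale c f) = cscale c (L f)" if "f \<in> topspace E" for f c
        unfolding L_def using conv_scale[OF X that zero] .
      \<comment> \<open>Homogeneity with the scalar 0 yields \<open>L 0 = 0\<close>, which is used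
        for images of bounded sets.\<close>
      have "L (cscale 0 0) = cscale 0 (L 0)" by (rule scale[OF zero])
      then have L0: "L 0 = 0" by simp
      have cd: "conv_dual \<omega> E T = (\<lambda>S f. if f \<in> topspace E then S (L f) else 0)"
        unfolding conv_dual_def conv_eq L_def ..
      have "conv_dual \<omega> E T S \<in> dual E" if "S \<in> dual E" for S
        unfolding cd by (rule dual_compose[OF L sub add scale that])
      moreover have "continuous_map (strong_dual E) (strong_dual E) (conv_dual \<omega> E T)"
        unfolding cd by (rule continuous_map_transpose[OF L zero L0 scale dual_compose[OF L sub add scale]])
      ultimately show ?thesis using defined[OF R] conv_into[OF X] unfolding conv_eq by blast
    qed
    then show "cfun.subspace (dual_ultradistributions \<omega> E) \<and> dual_ultradistributions \<omega> E \<subseteq> ultradistributions \<omega> \<and>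
        (\<forall>S\<in>dual E. \<forall>T\<in>dual_ultradistributions \<omega> E.
          (\<forall>f\<in>topspace E. conv_defined \<omega> E (reflect T) f \<and> conv \<omega> E (reflect T) f \<in> topspace E) \<and>
          conv_dual \<omega> E T S \<in> dual E) \<and>
        (\<forall>T\<in>dual_ultradistributions \<omega> E. continuous_map (strong_dual E) (strong_dual E) (\<lambda>S. conv_dual \<omega> E T S))"
      using subspace_dual_ultradistributions DU by blast
  next
    fix C assume C: "cfun.subspace C \<and> C \<subseteq> ultradistributions \<omega> \<and>
        (\<forall>S\<in>dual E. \<forall>T\<in>C.
          (\<forall>f\<in>topspace E. conv_defined \<omega> E (reflect T) f \<and> conv \<omega> E (reflect T) f \<in> topspace E) \<and>
          conv_dual \<omega> E T S \<in> dual E) \<and>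
        (\<forall>T\<in>C. continuous_map (strong_dual E) (strong_dual E) (\<lambda>S. conv_dual \<omega> E T S))"
    show "C \<subseteq> dual_ultradistributions \<omega> E"
    proof
      fix T assume T: "T \<in> C"
      \<comment> \<open>The condition is instantiated at the zero functional and the zero function,
        which always exist.\<close>
      then have "conv_defined \<omega> E (reflect T) 0" using C zero dual_zero[of E] by blast
      then obtain R where R: "is_extension \<omega> E (reflect T) R" unfolding conv_defined_def by blast
      \<comment> \<open>What has been obtained extends the reflected functional; reflecting once
        more gives an extension of \<open>T\<close> itself.\<close>
      have "reflect R \<phi> = T \<phi>" if "\<phi> \<in> topspace (D_space \<omega>)" for \<phi>
      proof -
        have "R (\<lambda>y. \<phi> (- y)) = reflect T (\<lambda>y. \<phi> (- y))"
          using R D_refl[OF that] unfolding is_extension_def by blast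
        then show ?thesis by (simp add: reflect_def)
      qed
      then have "is_extension \<omega> E T (reflect R)"
        using R refl[of R] unfolding is_extension_def by blast
      then show "T \<in> dual_ultradistributions \<omega> E" using in_dual T C by blast
    qed
  qed
qed

theorem mainTheorem8:
  fixes \<omega> :: "real \<Rightarrow> real"
  assumes "weight_function \<omega>"
    and "(\<lambda>t. ln (1 + t)) \<in> o[at_top](\<omega>)"
  shows "convolutors \<omega> (OM_space \<omega> :: (real ^ 'n \<Rightarrow> complex) topology)
           = dual_ultradistributions \<omega> (OM_space \<omega>)
       \<and> dual_convolutors \<omega> (OM_space \<omega> :: (real ^ 'n \<Rightarrow> complex) topology)
           = dual_ultradistributions \<omega> (OM_space \<omega>)
       \<and> convolutors \<omega> (OC_space \<omega> :: (real ^ 'n \<Rightarrow> complex) topology)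
           = dual_ultradistributions \<omega> (OC_space \<omega>)
       \<and> dual_convolutors \<omega> (OC_space \<omega> :: (real ^ 'n \<Rightarrow> complex) topology)
           = dual_ultradistributions \<omega> (OC_space \<omega>)"
proof -
  interpret ultra_weight \<omega>
    using assms by unfold_locales
  have OM: "convolutors \<omega> (OM_space \<omega> :: (real ^ 'n \<Rightarrow> complex) topology) = dual_ultradistributions \<omega> (OM_space \<omega>)"
    "dual_convolutors \<omega> (OM_space \<omega> :: (real ^ 'n \<Rightarrow> complex) topology) = dual_ultradistributions \<omega> (OM_space \<omega>)"
    by (rule convolutors_eq_dual dual_convolutors_eq_dual;
        simp add: subspace_OMs Ds_reflect_0 OM_to_ultradistribution OMs_reflect
          continuous_map_reflect_OM convolve_OM(2))+
  have OC: "convolutors \<omega> (OC_space \<omega> :: (real ^ 'n \<Rightarrow> complex) topology) = dual_ultradistributions \<omega> (OC_space \<omega>)"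
    "dual_convolutors \<omega> (OC_space \<omega> :: (real ^ 'n \<Rightarrow> complex) topology) = dual_ultradistributions \<omega> (OC_space \<omega>)"
    by (rule convolutors_eq_dual dual_convolutors_eq_dual;
        simp add: subspace_OCs Ds_reflect_0 OC_to_ultradistribution OCs_reflect
          continuous_map_reflect_OC convolve_OC(2))+
  show ?thesis using OM OC by blast
qed

end
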